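(* Let $d\ge 3$ be fixed and let $\mathcal{G}$ be an infinite family of finite connected $d$-regular graphs whose girth tends to infinity as the number of vertices tends to infinity. There is an $\epsilon>0$ such that for all $R<\infty$, for all sufficiently large graphs $G\in\mathcal{G}$, there is no $R$-trivial state $\psi$ of the toric code system on $G\times G$ with $|\psi|=1$ such that $A_s\psi=\psi$ for all $0$-cells $s$ of $G\times G$ and $$\langle \psi, B\psi\rangle < -(1-\epsilon)N_p,$$ where $N_p$ is the number of $2$-cells (plaquettes) of $G\times G$.
   Context: Complex: $G\times G$ is the square complex whose $0$-cells are pairs of vertices of $G$, whose $1$-cells are (edge, vertex) or (vertex, edge) pairs, and whose $2$-cells are the squares edge $\times$ edge. Toric code on a $2$-complex: to every $1$-cell $e$ is associated a two-dimensional Hilbert space $\mathbb{C}^2$, and the total Hilbert space is the tensor product over all $1$-cells. $S^x_e,S^z_e$ denote the Pauli matrices (eigenvalues $\pm1$) acting on the factor of $e$. For each $0$-cell $s$ put $A_s=\prod_{e:\, s\in\partial e}S^x_e$ (product over $1$-cells attached to $s$), and for each $2$-cell $p$ put $B_p=\prod_{e\in\partial p}S^z_e$ (product over $1$-cells in the boundary of $p$). Put $B=-\sum_p B_p$. Metric on degrees of freedom: $1$-cells are given the path distance for which two distinct $1$-cells attached to a common $0$-cell are at distance $1$. Quantum circuits: a unitary quantum circuit of depth $k$ is a unitary $U=U_1U_2\cdots U_k$ in which each $U_i$ is a product $U_{i,1}\cdots U_{i,n_i}$ of unitaries whose supports (sets of degrees of freedom acted on) are pairwise disjoint for fixed $i$.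 The range of $U_{i,a}$ is the diameter of its support; the range of the circuit is its depth times the maximum range of the unitaries $U_{i,a}$. Trivial states: a unit vector $\psi$ is $R$-trivial if $\psi=U\psi_{prod}$ for some unitary quantum circuit $U$ with range $R$ and some product state $\psi_{prod}$ (a tensor product of single-degree-of-freedom states). *)

theory Defs
  imports
    Complex_Main
    "HOL-Library.Extended_Nat"
    "Graph_Theory.Pair_Digraph"
    "Graph_Theory.Digraph_Component"
begin

section \<open>Graphs\<close>

text \<open>
  A finite simple graph is a \<^locale>\<open>pair_graph\<close>: a finite, loop-free, symmetric set of arcs.
  An undirected edge is the two-element set of its end points.
\<close>

definition uedges :: "'v pair_pre_digraph \<Rightarrow> 'v set set" where
  "uedges G = {{u, v} |u v. (u, v) \<in> parcs G}"

text \<open>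
  A pair of opposite arcs is a directed cycle of length 2 that traverses a single undirected edge
  back and forth, hence the restriction to length at least 3. The girth of a forest is infinite.
\<close>

definition girth :: "'v pair_pre_digraph \<Rightarrow> enat" where
  "girth G = (INF p \<in> {p. pre_digraph.cycle (with_proj G) p \<and> 3 \<le> length p}. enat (length p))"

section \<open>The square complex of a graph with itself\<close>

definition zero_cells :: "'v pair_pre_digraph \<Rightarrow> ('v \<times> 'v) set" where
  "zero_cells G = pverts G \<times> pverts G"

datatype 'v one_cell = EV "'v set" 'v | VE 'v "'v set"

definition one_cells :: "'v pair_pre_digraph \<Rightarrow> 'v one_cell set" where
  "one_cells G = {EV e v |e v. e \<in> uedges G \<and> v \<in> pverts G} \<union>
                 {VE v e |v e. v \<in> pverts G \<and> e \<in> uedges G}"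

definition two_cells :: "'v pair_pre_digraph \<Rightarrow> ('v set \<times> 'v set) set" where
  "two_cells G = uedges G \<times> uedges G"

fun boundary1 :: "'v one_cell \<Rightarrow> ('v \<times> 'v) set" where
  "boundary1 (EV e v) = e \<times> {v}"
| "boundary1 (VE v e) = {v} \<times> e"

fun boundary2 :: "'v set \<times> 'v set \<Rightarrow> 'v one_cell set" where
  "boundary2 (e, f) = {EV e v |v. v \<in> f} \<union> {VE v f |v. v \<in> e}"

text \<open>The distance is infinite if there is no path, and the empty set has diameter 0.\<close>

definition cell_adj :: "'v pair_pre_digraph \<Rightarrow> 'v one_cell rel" where
  "cell_adj G = {(a, b). a \<in> one_cells G \<and> b \<in> one_cells G \<and> a \<noteq> b \<and> boundary1 a \<inter> boundary1 b \<noteq> {}}"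

definition cell_dist :: "'v pair_pre_digraph \<Rightarrow> 'v one_cell \<Rightarrow> 'v one_cell \<Rightarrow> enat" where
  "cell_dist G a b = (INF n \<in> {n. (a, b) \<in> cell_adj G ^^ n}. enat n)"

definition cell_diam :: "'v pair_pre_digraph \<Rightarrow> 'v one_cell set \<Rightarrow> enat" where
  "cell_diam G S = (SUP a \<in> S. SUP b \<in> S. cell_dist G a b)"

section \<open>Systems of qubits\<close>

text \<open>
  The qubits are labelled by the elements of a finite set \<open>C\<close>. A computational basis vector of the
  tensor product of the spaces \<open>\<complex>\<^sup>2\<close> is given by the set \<open>\<sigma> \<subseteq> C\<close> of those qubits which are in the
  second basis state of \<open>\<complex>\<^sup>2\<close> (the one with \<open>S\<^sup>z = -1\<close>), and a vector by its amplitudes; amplitudes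
  outside \<^term>\<open>Pow C\<close> are 0, so that equality of vectors is equality of functions.
\<close>

type_synonym 'c amplitudes = "'c set \<Rightarrow> complex"
type_synonym 'c operator = "'c amplitudes \<Rightarrow> 'c amplitudes"
type_synonym 'c local_matrix = "'c set \<Rightarrow> 'c set \<Rightarrow> complex"

definition qubit_space :: "'c set \<Rightarrow> 'c amplitudes set" where
  "qubit_space C = {\<psi>. \<forall>\<sigma>. \<not> \<sigma> \<subseteq> C \<longrightarrow> \<psi> \<sigma> = 0}"

definition qinner :: "'c set \<Rightarrow> 'c amplitudes \<Rightarrow> 'c amplitudes \<Rightarrow> complex" where
  "qinner C \<phi> \<psi> = (\<Sum>\<sigma>\<in>Pow C. cnj (\<phi> \<sigma>) * \<psi> \<sigma>)"

definition qnorm :: "'c set \<Rightarrow> 'c amplitudes \<Rightarrow> real" where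
  "qnorm C \<psi> = sqrt (\<Sum>\<sigma>\<in>Pow C. (cmod (\<psi> \<sigma>))\<^sup>2)"

text \<open>
  A matrix \<open>u\<close> indexed by the basis \<^term>\<open>Pow S\<close> of the qubits in \<open>S\<close> acts on all qubits as \<open>u\<close> on
  the tensor factor of \<open>S\<close> and as the identity on the remaining tensor factors.
\<close>

definition act_on :: "'c set \<Rightarrow> 'c local_matrix \<Rightarrow> 'c operator" where
  "act_on S u \<psi> = (\<lambda>\<sigma>. \<Sum>\<tau>\<in>Pow S. u (\<sigma> \<inter> S) \<tau> * \<psi> ((\<sigma> - S) \<union> \<tau>))"

definition unitary_matrix_on :: "'c set \<Rightarrow> 'c local_matrix \<Rightarrow> bool" where
  "unitary_matrix_on S u \<longleftrightarrow>
     (\<forall>\<sigma>\<in>Pow S. \<forall>\<sigma>'\<in>Pow S.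
        (\<Sum>\<tau>\<in>Pow S. u \<sigma> \<tau> * cnj (u \<sigma>' \<tau>)) = (if \<sigma> = \<sigma>' then 1 else 0) \<and>
        (\<Sum>\<tau>\<in>Pow S. cnj (u \<tau> \<sigma>) * u \<tau> \<sigma>') = (if \<sigma> = \<sigma>' then 1 else 0))"

definition pauli_x :: "'c \<Rightarrow> 'c operator" where
  "pauli_x c = act_on {c} (\<lambda>\<sigma> \<tau>. if \<sigma> = \<tau> then 0 else 1)"

definition pauli_z :: "'c \<Rightarrow> 'c operator" where
  "pauli_z c = act_on {c} (\<lambda>\<sigma> \<tau>. if \<sigma> \<noteq> \<tau> then 0 else if c \<in> \<sigma> then -1 else 1)"

text \<open>
  The product of a finite family of operators that commute pairwise, so that the order of the
  factors is immaterial; the two commutation lemmas below cover its uses.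
\<close>

definition op_prod :: "('c \<Rightarrow> 'c operator) \<Rightarrow> 'c set \<Rightarrow> 'c operator" where
  "op_prod T A = Finite_Set.fold (\<lambda>c. (\<circ>) (T c)) id A"

lemma Pow_single: "Pow {c} = {{}, {c}}"
  by auto

lemma pauli_x_apply: "pauli_x c \<psi> \<sigma> = \<psi> (if c \<in> \<sigma> then \<sigma> - {c} else insert c \<sigma>)"
  by (simp add: pauli_x_def act_on_def Pow_single)

lemma pauli_z_apply: "pauli_z c \<psi> \<sigma> = (if c \<in> \<sigma> then - \<psi> \<sigma> else \<psi> \<sigma>)"
  by (auto simp: pauli_z_def act_on_def Pow_single insert_absorb)

lemma comp_fun_commute_pauli_x: "comp_fun_commute (\<lambda>c. (\<circ>) (pauli_x c))"
proof
  fix c d :: 'c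
  have "pauli_x c (pauli_x d \<psi>) \<sigma> = pauli_x d (pauli_x c \<psi>) \<sigma>" for \<psi> \<sigma>
    by (auto simp: pauli_x_apply intro!: arg_cong[where f = \<psi>])
  then show "(\<circ>) (pauli_x c) \<circ> (\<circ>) (pauli_x d) = (\<circ>) (pauli_x d) \<circ> (\<circ>) (pauli_x c)"
    by (simp add: fun_eq_iff)
qed

lemma comp_fun_commute_pauli_z: "comp_fun_commute (\<lambda>c. (\<circ>) (pauli_z c))"
  by standard (simp add: fun_eq_iff pauli_z_apply)

section \<open>Quantum circuits and trivial states\<close>

text \<open>
  A gate is a set \<open>S\<close> of qubits, serving as its support, together with a matrix on \<open>S\<close>; a circuit
  \<open>U\<^sub>1 \<dots> U\<^sub>k\<close> is the list of its layers \<open>U\<^sub>i\<close>, and a layer \<open>U\<^sub>i\<close> is the list of its gates.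
\<close>

type_synonym 'c gate = "'c set \<times> 'c local_matrix"
type_synonym 'c circuit = "'c gate list list"

definition gate_op :: "'c gate \<Rightarrow> 'c operator" where
  "gate_op g = act_on (fst g) (snd g)"

definition layer_op :: "'c gate list \<Rightarrow> 'c operator" where
  "layer_op L = foldr (\<lambda>g. (\<circ>) (gate_op g)) L id"

definition circuit_op :: "'c circuit \<Rightarrow> 'c operator" where
  "circuit_op U = foldr (\<lambda>L. (\<circ>) (layer_op L)) U id"

definition unitary_circuit :: "'c set \<Rightarrow> 'c circuit \<Rightarrow> bool" where
  "unitary_circuit C U \<longleftrightarrow>
     (\<forall>L\<in>set U. (\<forall>g\<in>set L. fst g \<subseteq> C \<and> unitary_matrix_on (fst g) (snd g)) \<and>
                 sorted_wrt (\<lambda>g h. fst g \<inter> fst h = {}) L)"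

definition circuit_range :: "'v pair_pre_digraph \<Rightarrow> 'v one_cell circuit \<Rightarrow> enat" where
  "circuit_range G U = enat (length U) * (SUP g \<in> (\<Union>L\<in>set U. set L). cell_diam G (fst g))"

text \<open>
  \<open>\<phi> c False\<close> and \<open>\<phi> c True\<close> are the amplitudes of qubit \<open>c\<close> on its first and second basis state.
\<close>

definition tensor_state :: "'c set \<Rightarrow> ('c \<Rightarrow> bool \<Rightarrow> complex) \<Rightarrow> 'c amplitudes" where
  "tensor_state C \<phi> = (\<lambda>\<sigma>. if \<sigma> \<subseteq> C then \<Prod>c\<in>C. \<phi> c (c \<in> \<sigma>) else 0)"

definition product_state :: "'c set \<Rightarrow> 'c amplitudes \<Rightarrow> bool" where
  "product_state C \<psi> \<longleftrightarrow>
     (\<exists>\<phi>. (\<forall>c\<in>C. (cmod (\<phi> c False))\<^sup>2 + (cmod (\<phi> c True))\<^sup>2 = 1) \<and> \<psi> = tensor_state C \<phi>)"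

text \<open>Range \<open>R\<close> is understood as range at most \<open>R\<close>.\<close>

definition trivial_state :: "'v pair_pre_digraph \<Rightarrow> nat \<Rightarrow> 'v one_cell amplitudes \<Rightarrow> bool" where
  "trivial_state G R \<psi> \<longleftrightarrow>
     \<psi> \<in> qubit_space (one_cells G) \<and> qnorm (one_cells G) \<psi> = 1 \<and>
     (\<exists>U \<psi>\<^sub>p. unitary_circuit (one_cells G) U \<and> circuit_range G U \<le> enat R \<and>
        product_state (one_cells G) \<psi>\<^sub>p \<and> \<psi> = circuit_op U \<psi>\<^sub>p)"

section \<open>The toric code\<close>

definition toric_A :: "'v pair_pre_digraph \<Rightarrow> 'v \<times> 'v \<Rightarrow> 'v one_cell operator" where
  "toric_A G s = op_prod pauli_x {e \<in> one_cells G. s \<in> boundary1 e}"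

definition toric_Bp :: "'v set \<times> 'v set \<Rightarrow> 'v one_cell operator" where
  "toric_Bp p = op_prod pauli_z (boundary2 p)"

definition toric_B :: "'v pair_pre_digraph \<Rightarrow> 'v one_cell operator" where
  "toric_B G \<psi> = (\<lambda>\<sigma>. - (\<Sum>p\<in>two_cells G. toric_Bp p \<psi> \<sigma>))"

end

theory Submission
  imports Defs "HOL-Combinatorics.Permutations" "HOL-Library.FuncSet"
begin

text \<open>
  Let \<open>E\<close>, \<open>V\<close> be the edges and vertices of \<open>G\<close>. Measure all \<open>S\<^sup>z\<close> in a low-range state fixed by every
  \<open>A\<^sub>s\<close>. For a vertex \<open>v\<close> of the second factor, the outcomes on the cells \<open>E \<times> {v}\<close> give a class
  \<open>w v\<close> of subsets of \<open>E\<close> modulo cuts, and the classes at adjacent vertices differ by the violated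
  plaquettes between them. A product of \<open>S\<^sup>z\<close> along a long loop anticommutes with the product of
  \<open>S\<^sup>x\<close> over a strip of parallel edges that crosses the loop once. Up to the operators \<open>A\<^sub>s\<close>, this
  product equals one over far away cells, so it changes the state only near the ends of the strip,
  away from the loop; hence the loop has expectation value 0. So \<open>w v\<close> is uniformly distributed,
  and \<open>w v\<close>, \<open>w v'\<close> are independent for distant \<open>v\<close>, \<open>v'\<close>.

  This alone does not bound the density of violated plaquettes, because independence only starts at
  a distance that grows with \<open>R\<close>. But the circuit lifts to \<open>G \<times> G'\<close> for each \<open>N\<close>-sheeted covering
  \<open>G'\<close> of \<open>G\<close>: by the large girth, its gates see no holonomy, so that all local expectation values
  are unchanged, and different lifts of \<open>v\<close> are far apart. If few plaquettes are violated, then every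
  choice of a permutation of the \<open>N\<close> sheets for each edge of \<open>G\<close> admits a labelling of \<open>G'\<close> by nearly
  equidistributed classes that are almost constant along edges. Put \<open>m = |E|\<close> and \<open>n = |V|\<close>. There
  are about \<open>2^(m - n)\<close> classes, hence \<open>2^((m - n) n N)\<close> labellings, and each of these is compatible with
  a fraction of about \<open>2^(-(m - n) N)\<close> of the permutations at each of the \<open>m\<close> edges. Since
  \<open>m - n \<ge> m / 3\<close>, there are too few labellings.
\<close>

section \<open>Operators supported on a set of qubits\<close>

text \<open>The obstacle to lifting the circuit is that a covering has no global section, so no
  single relabelling carries the circuit to it. Each gate therefore gets a relabelling of its own,
  and a local operator is pulled through the circuit and through its lift with one and the same
  matrix; at the end only the vacuum entry of that matrix counts.

  The number of sheets is \<open>card (cycles G)\<close>, about \<open>2^(m - n)\<close>: the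
  \<open>N^2\<close> pairs of sheets, which agree with probability \<open>1 / N\<close>, then add as
  much as the \<open>N\<close> diagonal pairs, so that classes stay bounded on average. Fewer sheets
  would give fewer permutations, more sheets larger classes.

  The set of violated plaquettes has to be recorded along with a labelling. Per sheet, the coverings
  exceed the labellings by a factor with exponent \<open>(m - n)^2\<close>, at least
  \<open>m^2 / 9\<close>, up to terms linear in \<open>m\<close>. A set of density 1/100 among the
  \<open>m^2\<close> squares costs an exponent of at most \<open>m^2 / 10\<close>. This comparison
  fixes the value of \<epsilon>.\<close>

text \<open>
  \<open>u\<close> acts on the qubits \<open>\<iota> ` T\<close>; its indices keep the labels from before \<open>\<iota>\<close>, so that an operator
  and its copies on other sheets of a covering share one matrix.
\<close>

definition relabelled_op :: "('c \<Rightarrow> 'd) \<Rightarrow> 'c set \<Rightarrow> 'c local_matrix \<Rightarrow> 'd operator" where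
  "relabelled_op \<iota> T u \<psi> = (\<lambda>\<sigma>. \<Sum>\<tau>\<in>Pow T. u (T \<inter> \<iota> -` \<sigma>) \<tau> * \<psi> ((\<sigma> - \<iota> ` T) \<union> \<iota> ` \<tau>))"

definition mat_mult :: "'c set \<Rightarrow> 'c local_matrix \<Rightarrow> 'c local_matrix \<Rightarrow> 'c local_matrix" where
  "mat_mult T u v \<sigma> \<tau> = (\<Sum>\<rho>\<in>Pow T. u \<sigma> \<rho> * v \<rho> \<tau>)"

text \<open>The tensor product of \<open>u\<close> with the identity on the qubits outside
  \<open>T\<close>.\<close>

definition mat_extend :: "'c set \<Rightarrow> 'c local_matrix \<Rightarrow> 'c local_matrix" where
  "mat_extend T u \<sigma> \<tau> = (if \<sigma> - T = \<tau> - T then u (\<sigma> \<inter> T) (\<tau> \<inter> T) else 0)"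

definition mat_adjoint :: "'c local_matrix \<Rightarrow> 'c local_matrix" where
  "mat_adjoint u \<sigma> \<tau> = cnj (u \<tau> \<sigma>)"

lemma act_on_eq_relabelled: "act_on T u = relabelled_op id T u"
  by (intro ext) (simp add: act_on_def relabelled_op_def Int_commute)

lemma relabelled_op_cong:
  assumes "\<And>c. c \<in> T \<Longrightarrow> \<iota> c = \<kappa> c"
  shows "relabelled_op \<iota> T u = relabelled_op \<kappa> T u"
proof -
  have "T \<inter> \<iota> -` \<sigma> = T \<inter> \<kappa> -` \<sigma>" for \<sigma>
    using assms by auto
  moreover have "\<iota> ` \<tau> = \<kappa> ` \<tau>" if "\<tau> \<subseteq> T" for \<tau>
    using assms that by (intro image_cong) auto
  ultimately show ?thesis
    unfolding relabelled_op_def by (intro ext sum.cong) (auto)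
qed

lemma vimage_replace:
  assumes "inj_on \<iota> T" "\<rho> \<subseteq> T"
  shows "T \<inter> \<iota> -` (\<sigma> - \<iota> ` T \<union> \<iota> ` \<rho>) = \<rho>"
  using assms by (auto simp: inj_on_def)

lemma relabelled_op_mult:
  assumes "finite T" "inj_on \<iota> T"
  shows "relabelled_op \<iota> T u (relabelled_op \<iota> T v \<psi>) = relabelled_op \<iota> T (mat_mult T u v) \<psi>"
proof
  fix \<sigma>
  have a: "(\<sigma> - \<iota> ` T \<union> \<iota> ` \<rho>) - \<iota> ` T = \<sigma> - \<iota> ` T" if "\<rho> \<subseteq> T" for \<rho>
    using that by auto
  have "relabelled_op \<iota> T u (relabelled_op \<iota> T v \<psi>) \<sigma> =
    (\<Sum>\<rho>\<in>Pow T. u (T \<inter> \<iota> -` \<sigma>) \<rho> * (\<Sum>\<tau>\<in>Pow T. v \<rho> \<tau> * \<psi> (\<sigma> - \<iota> ` T \<union> \<iota> ` \<tau>)))"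
    unfolding relabelled_op_def
    by (intro sum.cong refl arg_cong2[where f = "(*)"]) (simp_all add: vimage_replace[OF assms(2)] a del: vimage_Un)
  also have "\<dots> = relabelled_op \<iota> T (mat_mult T u v) \<psi> \<sigma>"
    unfolding relabelled_op_def mat_mult_def sum_distrib_left sum_distrib_right
    by (subst sum.swap) (simp add: mult.assoc)
  finally show "relabelled_op \<iota> T u (relabelled_op \<iota> T v \<psi>) \<sigma> = relabelled_op \<iota> T (mat_mult T u v) \<psi> \<sigma>" .
qed

lemma relabelled_op_extend:
  assumes "finite X" "T \<subseteq> X" "inj_on \<iota> X"
  shows "relabelled_op \<iota> T u = relabelled_op \<iota> X (mat_extend T u)"
proof (intro ext)
  fix \<psi> \<sigma>
  let ?s = "X \<inter> \<iota> -` \<sigma>"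
  have "relabelled_op \<iota> X (mat_extend T u) \<psi> \<sigma> =
      (\<Sum>\<tau>\<in>{\<tau>\<in>Pow X. ?s - T = \<tau> - T}. u (?s \<inter> T) (\<tau> \<inter> T) * \<psi> (\<sigma> - \<iota> ` X \<union> \<iota> ` \<tau>))"
    unfolding relabelled_op_def mat_extend_def using assms(1)
    by (intro sum.mono_neutral_cong_right) auto
  also have "\<dots> = (\<Sum>\<tau>\<in>Pow T. u (T \<inter> \<iota> -` \<sigma>) \<tau> * \<psi> (\<sigma> - \<iota> ` T \<union> \<iota> ` \<tau>))"
  proof (rule sum.reindex_bij_witness[where i = "\<lambda>\<tau>. \<tau> \<union> (?s - T)" and j = "\<lambda>\<tau>. \<tau> \<inter> T"])
    fix \<tau> assume t: "\<tau> \<in> {\<tau> \<in> Pow X. ?s - T = \<tau> - T}"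
    have "?s \<inter> T = T \<inter> \<iota> -` \<sigma>" using assms by auto
    moreover have "\<sigma> - \<iota> ` X \<union> \<iota> ` \<tau> = \<sigma> - \<iota> ` T \<union> \<iota> ` (\<tau> \<inter> T)"
    proof -
      have "\<iota> ` \<tau> = \<iota> ` (\<tau> \<inter> T) \<union> \<iota> ` (?s - T)" using t by auto
      moreover have "\<sigma> - \<iota> ` T = (\<sigma> - \<iota> ` X) \<union> \<iota> ` (?s - T)"
        using assms(2,3) by (auto simp: inj_on_def)
      ultimately show ?thesis by auto
    qed
    ultimately show "u (T \<inter> \<iota> -` \<sigma>) (\<tau> \<inter> T) * \<psi> (\<sigma> - \<iota> ` T \<union> \<iota> ` (\<tau> \<inter> T)) =
      u (?s \<inter> T) (\<tau> \<inter> T) * \<psi> (\<sigma> - \<iota> ` X \<union> \<iota> ` \<tau>)" by simp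
  qed (use assms(2) in auto)
  finally show "relabelled_op \<iota> T u \<psi> \<sigma> = relabelled_op \<iota> X (mat_extend T u) \<psi> \<sigma>"
    by (simp add: relabelled_op_def)
qed

lemma relabelled_op_commute:
  assumes "\<iota> ` T \<inter> \<kappa> ` S = {}"
  shows "relabelled_op \<iota> T u (relabelled_op \<kappa> S v \<psi>) = relabelled_op \<kappa> S v (relabelled_op \<iota> T u \<psi>)"
proof
  fix \<sigma>
  have a: "S \<inter> \<kappa> -` (\<sigma> - \<iota> ` T \<union> \<iota> ` \<tau>) = S \<inter> \<kappa> -` \<sigma>" if "\<tau> \<subseteq> T" for \<tau>
    using assms that by blast
  have b: "T \<inter> \<iota> -` (\<sigma> - \<kappa> ` S \<union> \<kappa> ` \<rho>) = T \<inter> \<iota> -` \<sigma>" if "\<rho> \<subseteq> S" for \<rho>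
    using assms that by blast
  have c: "\<sigma> - \<iota> ` T \<union> \<iota> ` \<tau> - \<kappa> ` S \<union> \<kappa> ` \<rho> = \<sigma> - \<kappa> ` S \<union> \<kappa> ` \<rho> - \<iota> ` T \<union> \<iota> ` \<tau>"
    if "\<tau> \<subseteq> T" "\<rho> \<subseteq> S" for \<tau> \<rho>
    using assms that by blast
  have "relabelled_op \<iota> T u (relabelled_op \<kappa> S v \<psi>) \<sigma> = (\<Sum>\<tau>\<in>Pow T. \<Sum>\<rho>\<in>Pow S.
      u (T \<inter> \<iota> -` \<sigma>) \<tau> * (v (S \<inter> \<kappa> -` \<sigma>) \<rho> * \<psi> (\<sigma> - \<iota> ` T \<union> \<iota> ` \<tau> - \<kappa> ` S \<union> \<kappa> ` \<rho>)))"
    unfolding relabelled_op_def sum_distrib_left by (intro sum.cong refl) (simp add: a del: vimage_Un)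
  also have "\<dots> = (\<Sum>\<rho>\<in>Pow S. \<Sum>\<tau>\<in>Pow T.
      v (S \<inter> \<kappa> -` \<sigma>) \<rho> * (u (T \<inter> \<iota> -` \<sigma>) \<tau> * \<psi> (\<sigma> - \<kappa> ` S \<union> \<kappa> ` \<rho> - \<iota> ` T \<union> \<iota> ` \<tau>)))"
    by (subst sum.swap) (intro sum.cong refl, simp add: c)
  also have "\<dots> = relabelled_op \<kappa> S v (relabelled_op \<iota> T u \<psi>) \<sigma>"
    unfolding relabelled_op_def sum_distrib_left by (intro sum.cong refl) (simp add: b del: vimage_Un)
  finally show "relabelled_op \<iota> T u (relabelled_op \<kappa> S v \<psi>) \<sigma> = relabelled_op \<kappa> S v (relabelled_op \<iota> T u \<psi>) \<sigma>" .
qed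

lemma relabelled_op_delta:
  assumes "finite T" "inj_on \<iota> T" "\<And>\<sigma> \<tau>. \<sigma> \<subseteq> T \<Longrightarrow> \<tau> \<subseteq> T \<Longrightarrow> u \<sigma> \<tau> = (if \<sigma> = \<tau> then 1 else 0)"
  shows "relabelled_op \<iota> T u \<psi> = \<psi>"
proof
  fix \<sigma>
  have "relabelled_op \<iota> T u \<psi> \<sigma> =
    (\<Sum>\<tau>\<in>Pow T. if T \<inter> \<iota> -` \<sigma> = \<tau> then \<psi> (\<sigma> - \<iota> ` T \<union> \<iota> ` \<tau>) else 0)"
    unfolding relabelled_op_def by (intro sum.cong refl) (simp add: assms(3))
  also have "\<dots> = \<psi> (\<sigma> - \<iota> ` T \<union> \<iota> ` (T \<inter> \<iota> -` \<sigma>))"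
    using assms(1) by (simp add: sum.delta)
  also have "\<sigma> - \<iota> ` T \<union> \<iota> ` (T \<inter> \<iota> -` \<sigma>) = \<sigma>"
    by auto
  finally show "relabelled_op \<iota> T u \<psi> \<sigma> = \<psi> \<sigma>" .
qed

lemma relabelled_op_unitary:
  assumes "finite S" "inj_on \<iota> S" "unitary_matrix_on S u"
  shows "relabelled_op \<iota> S u (relabelled_op \<iota> S (mat_adjoint u) \<psi>) = \<psi>"
    and "relabelled_op \<iota> S (mat_adjoint u) (relabelled_op \<iota> S u \<psi>) = \<psi>"
  using assms
  by (auto simp: relabelled_op_mult mat_mult_def mat_adjoint_def unitary_matrix_on_def
      intro!: relabelled_op_delta)

text \<open>The conjugate \<open>w* u w\<close> as a matrix on the union of both supports: what
  becomes of \<open>u\<close> when it is moved past the gate \<open>w\<close> to the right.\<close>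

definition heisenberg_mat :: "'c set \<Rightarrow> 'c local_matrix \<Rightarrow> 'c set \<Rightarrow> 'c local_matrix \<Rightarrow> 'c local_matrix" where
  "heisenberg_mat T u S w = mat_mult (T \<union> S) (mat_extend S (mat_adjoint w))
     (mat_mult (T \<union> S) (mat_extend T u) (mat_extend S w))"

lemma relabelled_op_heisenberg:
  assumes "finite T" "finite S" "inj_on \<iota> (T \<union> S)" "unitary_matrix_on S w"
  shows "relabelled_op \<iota> T u (relabelled_op \<iota> S w \<psi>) =
         relabelled_op \<iota> S w (relabelled_op \<iota> (T \<union> S) (heisenberg_mat T u S w) \<psi>)"
proof -
  have e: "relabelled_op \<iota> (T \<union> S) (mat_extend S x) = relabelled_op \<iota> S x"
    "relabelled_op \<iota> (T \<union> S) (mat_extend T x) = relabelled_op \<iota> T x" for x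
    using assms by (auto intro!: relabelled_op_extend[symmetric])
  have "relabelled_op \<iota> (T \<union> S) (heisenberg_mat T u S w) \<psi> =
    relabelled_op \<iota> S (mat_adjoint w) (relabelled_op \<iota> T u (relabelled_op \<iota> S w \<psi>))"
    unfolding heisenberg_mat_def using assms by (simp add: e flip: relabelled_op_mult)
  then show ?thesis
    using assms by (simp add: relabelled_op_unitary(1) inj_on_Un)
qed

lemma relabelled_op_as_act_on:
  assumes "inj_on \<iota> T"
  shows "\<exists>v. relabelled_op \<iota> T u = act_on (\<iota> ` T) v"
proof (intro exI ext)
  fix \<psi> \<sigma>
  have "act_on (\<iota> ` T) (\<lambda>\<sigma> \<tau>. u (T \<inter> \<iota> -` \<sigma>) (T \<inter> \<iota> -` \<tau>)) \<psi> \<sigma> =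
    (\<Sum>\<tau>\<in>Pow (\<iota> ` T). u (T \<inter> \<iota> -` (\<sigma> \<inter> \<iota> ` T)) (T \<inter> \<iota> -` \<tau>) * \<psi> (\<sigma> - \<iota> ` T \<union> \<tau>))"
    by (simp add: act_on_def)
  also have "\<dots> = (\<Sum>\<tau>\<in>Pow T. u (T \<inter> \<iota> -` \<sigma>) \<tau> * \<psi> (\<sigma> - \<iota> ` T \<union> \<iota> ` \<tau>))"
  proof (rule sum.reindex_bij_witness[where j = "\<lambda>\<tau>. T \<inter> \<iota> -` \<tau>" and i = "\<lambda>\<tau>. \<iota> ` \<tau>"])
    fix \<tau> assume "\<tau> \<in> Pow (\<iota> ` T)"
    then have "\<iota> ` (T \<inter> \<iota> -` \<tau>) = \<tau>" by auto
    moreover have "T \<inter> \<iota> -` (\<sigma> \<inter> \<iota> ` T) = T \<inter> \<iota> -` \<sigma>" by auto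
    ultimately show "u (T \<inter> \<iota> -` \<sigma>) (T \<inter> \<iota> -` \<tau>) * \<psi> (\<sigma> - \<iota> ` T \<union> \<iota> ` (T \<inter> \<iota> -` \<tau>)) =
      u (T \<inter> \<iota> -` (\<sigma> \<inter> \<iota> ` T)) (T \<inter> \<iota> -` \<tau>) * \<psi> (\<sigma> - \<iota> ` T \<union> \<tau>)" by simp
  qed (use assms in \<open>auto simp: inj_on_def\<close>)
  finally show "relabelled_op \<iota> T u \<psi> \<sigma> = act_on (\<iota> ` T) (\<lambda>\<sigma> \<tau>. u (T \<inter> \<iota> -` \<sigma>) (T \<inter> \<iota> -` \<tau>)) \<psi> \<sigma>"
    by (simp add: relabelled_op_def)
qed

section \<open>Relabelled circuits\<close>

text \<open>Every gate carries its own relabelling: lifts of different gates follow different local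
  sections of the covering, which need not fit together.\<close>

type_synonym ('c, 'd) rgate = "('c \<Rightarrow> 'd) \<times> 'c set \<times> 'c local_matrix"

fun rgate_op :: "('c, 'd) rgate \<Rightarrow> 'd operator" where
  "rgate_op (\<kappa>, S, w) = relabelled_op \<kappa> S w"

fun rgate_supp :: "('c, 'd) rgate \<Rightarrow> 'd set" where
  "rgate_supp (\<kappa>, S, w) = \<kappa> ` S"

fun rgate_ok :: "('c, 'd) rgate \<Rightarrow> bool" where
  "rgate_ok (\<kappa>, S, w) \<longleftrightarrow> finite S \<and> inj_on \<kappa> S \<and> unitary_matrix_on S w"

definition rlayer_op :: "('c, 'd) rgate list \<Rightarrow> 'd operator" where
  "rlayer_op L = foldr (\<lambda>g. (\<circ>) (rgate_op g)) L id"

definition rcircuit_op :: "('c, 'd) rgate list list \<Rightarrow> 'd operator" where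
  "rcircuit_op U = foldr (\<lambda>L. (\<circ>) (rlayer_op L)) U id"

definition rlayer_ok :: "('c, 'd) rgate list \<Rightarrow> bool" where
  "rlayer_ok L \<longleftrightarrow> (\<forall>g\<in>set L. rgate_ok g) \<and> sorted_wrt (\<lambda>g h. rgate_supp g \<inter> rgate_supp h = {}) L"

fun rgate_agree :: "('c \<Rightarrow> 'd) \<Rightarrow> ('c, 'd) rgate \<Rightarrow> 'c gate \<Rightarrow> bool" where
  "rgate_agree \<iota> (\<kappa>, S, w) (S', w') \<longleftrightarrow> S = S' \<and> w = w' \<and> (\<forall>c\<in>S. \<kappa> c = \<iota> c)"

lemma rlayer_op_simps [simp]:
  "rlayer_op [] \<psi> = \<psi>" "rlayer_op (g # L) \<psi> = rgate_op g (rlayer_op L \<psi>)"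
  by (simp_all add: rlayer_op_def)

lemma rcircuit_op_simps [simp]:
  "rcircuit_op [] \<psi> = \<psi>" "rcircuit_op (L # U) \<psi> = rlayer_op L (rcircuit_op U \<psi>)"
  by (simp_all add: rcircuit_op_def)

lemma rlayer_ok_Cons:
  "rlayer_ok (g # L) \<longleftrightarrow> rgate_ok g \<and> (\<forall>h\<in>set L. rgate_supp g \<inter> rgate_supp h = {}) \<and> rlayer_ok L"
  by (auto simp: rlayer_ok_def)

fun heisenberg_gates :: "'c set \<times> 'c local_matrix \<Rightarrow> 'c gate list \<Rightarrow> 'c set \<times> 'c local_matrix" where
  "heisenberg_gates Tu [] = Tu"
| "heisenberg_gates (T, u) ((S, w) # gs) = heisenberg_gates (T \<union> S, heisenberg_mat T u S w) gs"

lemma fst_heisenberg_gates: "fst (heisenberg_gates (T, u) gs) = T \<union> (\<Union>g\<in>set gs. fst g)"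
  by (induction "(T, u)" gs arbitrary: T u rule: heisenberg_gates.induct) auto

text \<open>
  The matrix on the right depends on the gates that meet the support, but not on the relabelling:
  this is what makes local expectation values of a circuit and of its lift to a covering agree.
\<close>

lemma rlayer_op_heisenberg:
  assumes "rlayer_ok L"
    and "list_all2 (rgate_agree \<iota>) (filter (\<lambda>g. rgate_supp g \<inter> \<iota> ` T \<noteq> {}) L) gs"
    and "finite T" "inj_on \<iota> (fst (heisenberg_gates (T, u) gs))"
  shows "relabelled_op \<iota> T u (rlayer_op L \<psi>) =
    rlayer_op L (relabelled_op \<iota> (fst (heisenberg_gates (T, u) gs)) (snd (heisenberg_gates (T, u) gs)) \<psi>)"
  using assms
proof (induction L arbitrary: T u gs)
  case Nil
  then show ?case by simp
next
  case (Cons h L)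
  obtain \<kappa> S w where h: "h = (\<kappa>, S, w)" by (cases h)
  have ok: "finite S" "inj_on \<kappa> S" "unitary_matrix_on S w" "rlayer_ok L"
    and disj: "\<And>k. k \<in> set L \<Longrightarrow> \<kappa> ` S \<inter> rgate_supp k = {}"
    using Cons.prems(1) by (auto simp: rlayer_ok_Cons h)
  show ?case
  proof (cases "rgate_supp h \<inter> \<iota> ` T = {}")
    case True
    then have "relabelled_op \<iota> T u (rgate_op h \<chi>) = rgate_op h (relabelled_op \<iota> T u \<chi>)" for \<chi>
      using relabelled_op_commute[of \<iota> T \<kappa> S u w] by (simp add: h Int_commute)
    with True show ?thesis
      using Cons.IH[OF ok(4) _ Cons.prems(3,4)] Cons.prems(2) by simp
  next
    case False
    with Cons.prems(2) obtain gs' where gs: "gs = (S, w) # gs'" and ag: "\<And>c. c \<in> S \<Longrightarrow> \<kappa> c = \<iota> c"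
      and la: "list_all2 (rgate_agree \<iota>) (filter (\<lambda>g. rgate_supp g \<inter> \<iota> ` T \<noteq> {}) L) gs'"
      by (auto simp: h list_all2_Cons1)
    have inj: "inj_on \<iota> (T \<union> S)"
      using Cons.prems(4) by (auto simp: gs fst_heisenberg_gates intro: inj_on_subset)
    \<comment> \<open>Gates of one layer are disjoint, so the support that \<open>h\<close> adds to
      \<open>T\<close> meets none of the later gates: the list of relevant gates is fixed by the
      original \<open>T\<close>.\<close>
    have fl: "filter (\<lambda>g. rgate_supp g \<inter> \<iota> ` (T \<union> S) \<noteq> {}) L = filter (\<lambda>g. rgate_supp g \<inter> \<iota> ` T \<noteq> {}) L"
    proof (rule filter_cong[OF refl])
      fix k assume "k \<in> set L"
      with disj[OF this] have "rgate_supp k \<inter> \<iota> ` S = {}" using ag by auto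
      then show "(rgate_supp k \<inter> \<iota> ` (T \<union> S) \<noteq> {}) = (rgate_supp k \<inter> \<iota> ` T \<noteq> {})" by auto
    qed
    have gh: "rgate_op h = relabelled_op \<iota> S w"
      using relabelled_op_cong[OF ag] by (simp add: h)
    show ?thesis
      using Cons.IH[of "T \<union> S" gs' "heisenberg_mat T u S w"] ok la inj Cons.prems(3,4)
      by (simp add: gs gh fl relabelled_op_heisenberg)
  qed
qed

section \<open>Locality\<close>

text \<open>Only the existence of a matrix is kept. Arguments about supports need no more, while the
  comparison of a circuit with its lift needs the matrix itself.\<close>

definition local_op :: "'d set \<Rightarrow> 'd operator \<Rightarrow> bool" where
  "local_op T O' \<longleftrightarrow> finite T \<and> (\<exists>u. O' = act_on T u)"

lemma local_op_mono:
  assumes "local_op T O'" "T \<subseteq> X" "finite X"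
  shows "local_op X O'"
  using assms relabelled_op_extend[of X T id] by (auto simp: local_op_def act_on_eq_relabelled)

lemma local_op_comp:
  assumes "local_op T O1" "local_op T O2"
  shows "local_op T (\<lambda>\<psi>. O1 (O2 \<psi>))"
proof -
  from assms obtain u v where "O1 = act_on T u" "O2 = act_on T v" "finite T"
    by (auto simp: local_op_def)
  then have "(\<lambda>\<psi>. O1 (O2 \<psi>)) = act_on T (mat_mult T u v)"
    by (simp add: act_on_eq_relabelled relabelled_op_mult)
  with \<open>finite T\<close> show ?thesis by (auto simp: local_op_def)
qed

lemma local_op_relabelled:
  assumes "inj_on \<kappa> S" "finite S"
  shows "local_op (\<kappa> ` S) (relabelled_op \<kappa> S w)"
  using relabelled_op_as_act_on[OF assms(1), of w] assms(2) by (auto simp: local_op_def)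

lemma local_op_rlayer:
  assumes "rlayer_ok L" "local_op T O'" "finite Y" "T \<subseteq> Y"
    and "\<And>g. g \<in> set L \<Longrightarrow> rgate_supp g \<inter> T \<noteq> {} \<Longrightarrow> rgate_supp g \<subseteq> Y"
  shows "\<exists>O2. local_op Y O2 \<and> (\<forall>\<psi>. O' (rlayer_op L \<psi>) = rlayer_op L (O2 \<psi>))"
  using assms
proof (induction L arbitrary: T O')
  case Nil
  then show ?case by (auto intro: local_op_mono)
next
  case (Cons h L)
  obtain \<kappa> S w where h: "h = (\<kappa>, S, w)" by (cases h)
  have ok: "finite S" "inj_on \<kappa> S" "unitary_matrix_on S w" "rlayer_ok L"
    and disj: "\<And>k. k \<in> set L \<Longrightarrow> \<kappa> ` S \<inter> rgate_supp k = {}"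
    using Cons.prems(1) by (auto simp: rlayer_ok_Cons h)
  show ?case
  proof (cases "rgate_supp h \<inter> T = {}")
    case True
    from Cons.prems(2) obtain u where u: "O' = relabelled_op id T u"
      by (auto simp: local_op_def act_on_eq_relabelled)
    have "O' (rgate_op h \<psi>) = rgate_op h (O' \<psi>)" for \<psi>
      using True relabelled_op_commute[of id T \<kappa> S u w] by (simp add: h u Int_commute)
    moreover obtain O2 where "local_op Y O2" "\<forall>\<psi>. O' (rlayer_op L \<psi>) = rlayer_op L (O2 \<psi>)"
      using Cons.IH[OF ok(4) Cons.prems(2-4)] Cons.prems(5) by auto
    ultimately show ?thesis by (intro exI[of _ O2]) simp
  next
    case False
    have T': "local_op T O'" "finite T" "finite (T \<union> \<kappa> ` S)"
      using Cons.prems(2) ok by (auto simp: local_op_def)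
    \<comment> \<open>\<open>O'\<close> conjugated by the gate \<open>h\<close> alone. Since
      \<open>h\<close> is disjoint from the rest of the layer, no further gates become relevant and
      \<open>Y\<close> still suffices.\<close>
    define O1 where "O1 = (\<lambda>\<psi>. relabelled_op \<kappa> S (mat_adjoint w) (O' (rgate_op h \<psi>)))"
    have l: "local_op (T \<union> \<kappa> ` S) (relabelled_op \<kappa> S v)" for v
      using local_op_relabelled[OF ok(2,1)] T' by (auto intro: local_op_mono)
    have "local_op (T \<union> \<kappa> ` S) O1"
      unfolding O1_def h rgate_op.simps
      using local_op_comp[OF l[of "mat_adjoint w"] local_op_comp[OF local_op_mono[OF T'(1) _ T'(3)] l[of w]]]
      by simp
    moreover have "T \<union> \<kappa> ` S \<subseteq> Y"
      using Cons.prems(4) Cons.prems(5)[of h] False by (auto simp: h)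
    moreover have "rgate_supp g \<subseteq> Y" if "g \<in> set L" "rgate_supp g \<inter> (T \<union> \<kappa> ` S) \<noteq> {}" for g
      using Cons.prems(5)[of g] that disj[of g] by auto
    ultimately obtain O2 where O2: "local_op Y O2" "\<forall>\<psi>. O1 (rlayer_op L \<psi>) = rlayer_op L (O2 \<psi>)"
      using Cons.IH[OF ok(4), of "T \<union> \<kappa> ` S" O1] Cons.prems(3) by auto
    have "O' (rgate_op h \<psi>) = rgate_op h (O1 \<psi>)" for \<psi>
      using ok by (simp add: O1_def h relabelled_op_unitary(1))
    with O2 show ?thesis by (intro exI[of _ O2]) simp
  qed
qed

text \<open>The levels of \<open>Y\<close> only have to absorb every gate that touches the preceding
  level; the light cone then grows by one level per layer.\<close>

lemma local_op_rcircuit: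
  assumes "\<And>L. L \<in> set U \<Longrightarrow> rlayer_ok L" "local_op (Y k) O'"
    and "\<And>k. finite (Y k)" "\<And>k. Y k \<subseteq> Y (Suc k)"
    and "\<And>L g k. L \<in> set U \<Longrightarrow> g \<in> set L \<Longrightarrow> rgate_supp g \<inter> Y k \<noteq> {} \<Longrightarrow> rgate_supp g \<subseteq> Y (Suc k)"
  shows "\<exists>O2. local_op (Y (k + length U)) O2 \<and> (\<forall>\<psi>. O' (rcircuit_op U \<psi>) = rcircuit_op U (O2 \<psi>))"
  using assms
proof (induction U arbitrary: k O')
  case Nil
  then show ?case by auto
next
  case (Cons L U)
  have "rgate_supp g \<subseteq> Y (Suc k)" if "g \<in> set L" "rgate_supp g \<inter> Y k \<noteq> {}" for g
    using Cons.prems(5)[of L g k] that by simp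
  then obtain O1 where O1: "local_op (Y (Suc k)) O1" "\<forall>\<psi>. O' (rlayer_op L \<psi>) = rlayer_op L (O1 \<psi>)"
    using local_op_rlayer[of L "Y k" O' "Y (Suc k)"] Cons.prems(1-4) by (metis list.set_intros(1))
  have "\<exists>O2. local_op (Y (Suc k + length U)) O2 \<and> (\<forall>\<psi>. O1 (rcircuit_op U \<psi>) = rcircuit_op U (O2 \<psi>))"
  proof (rule Cons.IH)
    fix L' g j assume "L' \<in> set U" "g \<in> set L'" "rgate_supp g \<inter> Y j \<noteq> {}"
    then show "rgate_supp g \<subseteq> Y (Suc j)"
      using Cons.prems(5)[of L' g j] by simp
  qed (use Cons.prems(1-4) O1 in auto)
  then obtain O2 where "local_op (Y (Suc k + length U)) O2"
    "\<forall>\<psi>. O1 (rcircuit_op U \<psi>) = rcircuit_op U (O2 \<psi>)"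
    by blast
  with O1 show ?case by (intro exI[of _ O2]) simp
qed

text \<open>Both circuits are treated in one induction in order to obtain a common \<open>T'\<close>
  and \<open>u'\<close>: the gates that act on the growing support are the same on both sides, up to
  the relabelling.\<close>

lemma rcircuit_op_heisenberg:
  fixes U :: "'c gate list list" and U1 :: "('c, 'd1) rgate list list" and U2 :: "('c, 'd2) rgate list list"
  assumes "length U1 = length U" "length U2 = length U"
    and "\<And>L. L \<in> set U1 \<Longrightarrow> rlayer_ok L" "\<And>L. L \<in> set U2 \<Longrightarrow> rlayer_ok L"
    and "\<And>k. finite (Y k)" "\<And>k. Y k \<subseteq> Y (Suc k)"
    and "inj_on \<iota>1 (Y (k + length U))" "inj_on \<iota>2 (Y (k + length U))" "T \<subseteq> Y k"
    and "\<And>L g k. L \<in> set U \<Longrightarrow> g \<in> set L \<Longrightarrow> fst g \<inter> Y k \<noteq> {} \<Longrightarrow> fst g \<subseteq> Y (Suc k)"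
    and "\<And>j j' T. j < length U \<Longrightarrow> k \<le> j' \<Longrightarrow> j' < k + length U \<Longrightarrow> T \<subseteq> Y j' \<Longrightarrow>
      list_all2 (rgate_agree \<iota>1) (filter (\<lambda>g. rgate_supp g \<inter> \<iota>1 ` T \<noteq> {}) (U1 ! j)) (filter (\<lambda>g. fst g \<inter> T \<noteq> {}) (U ! j)) \<and>
      list_all2 (rgate_agree \<iota>2) (filter (\<lambda>g. rgate_supp g \<inter> \<iota>2 ` T \<noteq> {}) (U2 ! j)) (filter (\<lambda>g. fst g \<inter> T \<noteq> {}) (U ! j))"
  shows "\<exists>T' u'. T' \<subseteq> Y (k + length U) \<and>
     (\<forall>\<psi>. relabelled_op \<iota>1 T u (rcircuit_op U1 \<psi>) = rcircuit_op U1 (relabelled_op \<iota>1 T' u' \<psi>)) \<and>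
     (\<forall>\<psi>. relabelled_op \<iota>2 T u (rcircuit_op U2 \<psi>) = rcircuit_op U2 (relabelled_op \<iota>2 T' u' \<psi>))"
  using assms
proof (induction U arbitrary: U1 U2 k T u)
  case Nil
  then show ?case by auto
next
  case (Cons L U)
  obtain L1 V1 where U1: "U1 = L1 # V1" using Cons.prems(1) by (cases U1) auto
  obtain L2 V2 where U2: "U2 = L2 # V2" using Cons.prems(2) by (cases U2) auto
  define gs where "gs = filter (\<lambda>g. fst g \<inter> T \<noteq> {}) L"
  define T' where "T' = fst (heisenberg_gates (T, u) gs)"
  define u' where "u' = snd (heisenberg_gates (T, u) gs)"
  have mono: "Y i \<subseteq> Y j" if "i \<le> j" for i j
    using lift_Suc_mono_le[of Y, OF Cons.prems(6) that] .
  have finT: "finite T" using Cons.prems(5,9) finite_subset by blast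
  have sub: "T' \<subseteq> Y (Suc k)"
  proof -
    have "T \<subseteq> Y (Suc k)" using Cons.prems(6,9) by blast
    moreover have "fst g \<subseteq> Y (Suc k)" if "g \<in> set gs" for g
      using Cons.prems(10)[of L g k] that Cons.prems(9) by (auto simp: gs_def)
    ultimately show ?thesis unfolding T'_def fst_heisenberg_gates by auto
  qed
  have sub': "T' \<subseteq> Y (k + length (L # U))"
    using sub mono[of "Suc k" "k + length (L # U)"] by auto
  have la: "list_all2 (rgate_agree \<iota>1) (filter (\<lambda>g. rgate_supp g \<inter> \<iota>1 ` T \<noteq> {}) L1) gs"
    "list_all2 (rgate_agree \<iota>2) (filter (\<lambda>g. rgate_supp g \<inter> \<iota>2 ` T \<noteq> {}) L2) gs"
    using Cons.prems(11)[of 0 k T] Cons.prems(9) by (auto simp: U1 U2 gs_def)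
  have 1: "relabelled_op \<iota>1 T u (rlayer_op L1 \<psi>) = rlayer_op L1 (relabelled_op \<iota>1 T' u' \<psi>)" for \<psi>
    unfolding T'_def u'_def
    by (rule rlayer_op_heisenberg)
      (use la finT sub' Cons.prems(3,7) in \<open>auto simp: U1 T'_def intro: inj_on_subset\<close>)
  have 2: "relabelled_op \<iota>2 T u (rlayer_op L2 \<psi>) = rlayer_op L2 (relabelled_op \<iota>2 T' u' \<psi>)" for \<psi>
    unfolding T'_def u'_def
    by (rule rlayer_op_heisenberg)
      (use la finT sub' Cons.prems(4,8) in \<open>auto simp: U2 T'_def intro: inj_on_subset\<close>)
  have "\<exists>T'' u''. T'' \<subseteq> Y (Suc k + length U) \<and>
     (\<forall>\<psi>. relabelled_op \<iota>1 T' u' (rcircuit_op V1 \<psi>) = rcircuit_op V1 (relabelled_op \<iota>1 T'' u'' \<psi>)) \<and>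
     (\<forall>\<psi>. relabelled_op \<iota>2 T' u' (rcircuit_op V2 \<psi>) = rcircuit_op V2 (relabelled_op \<iota>2 T'' u'' \<psi>))"
  proof (rule Cons.IH)
    fix j j' T0 assume "j < length U" "Suc k \<le> j'" "j' < Suc k + length U" "T0 \<subseteq> Y j'"
    then show "list_all2 (rgate_agree \<iota>1) (filter (\<lambda>g. rgate_supp g \<inter> \<iota>1 ` T0 \<noteq> {}) (V1 ! j)) (filter (\<lambda>g. fst g \<inter> T0 \<noteq> {}) (U ! j)) \<and>
      list_all2 (rgate_agree \<iota>2) (filter (\<lambda>g. rgate_supp g \<inter> \<iota>2 ` T0 \<noteq> {}) (V2 ! j)) (filter (\<lambda>g. fst g \<inter> T0 \<noteq> {}) (U ! j))"
      using Cons.prems(11)[of "Suc j" j' T0] by (simp add: U1 U2)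
  next
    fix L' g j assume "L' \<in> set U" "g \<in> set L'" "fst g \<inter> Y j \<noteq> {}"
    then show "fst g \<subseteq> Y (Suc j)"
      using Cons.prems(10)[of L' g j] by simp
  qed (use Cons.prems(1-8) sub in \<open>auto simp: U1 U2\<close>)
  then obtain T'' u'' where "T'' \<subseteq> Y (Suc k + length U)"
     "\<forall>\<psi>. relabelled_op \<iota>1 T' u' (rcircuit_op V1 \<psi>) = rcircuit_op V1 (relabelled_op \<iota>1 T'' u'' \<psi>)"
     "\<forall>\<psi>. relabelled_op \<iota>2 T' u' (rcircuit_op V2 \<psi>) = rcircuit_op V2 (relabelled_op \<iota>2 T'' u'' \<psi>)"
    by blast
  with 1 2 show ?case
    by (intro exI[of _ T''] exI[of _ u'']) (simp add: U1 U2)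
qed

section \<open>Inner products and Pauli operators\<close>

definition vacuum :: "'d amplitudes" where
  "vacuum \<sigma> = (if \<sigma> = {} then 1 else 0)"

definition flip_op :: "'d set \<Rightarrow> 'd operator" where
  "flip_op T \<psi> \<sigma> = \<psi> (sym_diff \<sigma> T)"

definition sign_op :: "'d set \<Rightarrow> 'd operator" where
  "sign_op T \<psi> \<sigma> = (-1) ^ card (T \<inter> \<sigma>) * \<psi> \<sigma>"

definition flip_mat :: "'c set \<Rightarrow> 'c local_matrix" where
  "flip_mat T \<sigma> \<tau> = (if \<tau> = T - \<sigma> then 1 else 0)"

definition sign_mat :: "'c local_matrix" where
  "sign_mat \<sigma> \<tau> = (if \<sigma> = \<tau> then (-1) ^ card \<sigma> else 0)"

lemma relabelled_flip:
  assumes "finite T" "inj_on \<iota> T"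
  shows "relabelled_op \<iota> T (flip_mat T) = flip_op (\<iota> ` T)"
proof (intro ext)
  fix \<psi> \<sigma>
  have "relabelled_op \<iota> T (flip_mat T) \<psi> \<sigma> =
    (\<Sum>\<tau>\<in>Pow T. if \<tau> = T - (T \<inter> \<iota> -` \<sigma>) then \<psi> (\<sigma> - \<iota> ` T \<union> \<iota> ` \<tau>) else 0)"
    unfolding relabelled_op_def flip_mat_def by (intro sum.cong refl) simp
  also have "\<dots> = \<psi> (\<sigma> - \<iota> ` T \<union> \<iota> ` (T - (T \<inter> \<iota> -` \<sigma>)))"
    using assms(1) by simp
  also have "\<sigma> - \<iota> ` T \<union> \<iota> ` (T - (T \<inter> \<iota> -` \<sigma>)) = sym_diff \<sigma> (\<iota> ` T)"
    by auto
  finally show "relabelled_op \<iota> T (flip_mat T) \<psi> \<sigma> = flip_op (\<iota> ` T) \<psi> \<sigma>"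
    by (simp add: flip_op_def)
qed

lemma relabelled_sign:
  assumes "finite T" "inj_on \<iota> T"
  shows "relabelled_op \<iota> T sign_mat = sign_op (\<iota> ` T)"
proof (intro ext)
  fix \<psi> \<sigma>
  have i: "\<iota> ` (T \<inter> \<iota> -` \<sigma>) = \<iota> ` T \<inter> \<sigma>" by auto
  have "relabelled_op \<iota> T sign_mat \<psi> \<sigma> =
    (\<Sum>\<tau>\<in>Pow T. if T \<inter> \<iota> -` \<sigma> = \<tau> then (-1) ^ card \<tau> * \<psi> (\<sigma> - \<iota> ` T \<union> \<iota> ` \<tau>) else 0)"
    unfolding relabelled_op_def sign_mat_def by (intro sum.cong refl) simp
  also have "\<dots> = (-1) ^ card (T \<inter> \<iota> -` \<sigma>) * \<psi> (\<sigma> - \<iota> ` T \<union> \<iota> ` (T \<inter> \<iota> -` \<sigma>))"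
    using assms(1) by simp
  also have "\<sigma> - \<iota> ` T \<union> \<iota> ` (T \<inter> \<iota> -` \<sigma>) = \<sigma>"
    by auto
  also have "card (T \<inter> \<iota> -` \<sigma>) = card (\<iota> ` T \<inter> \<sigma>)"
    unfolding i[symmetric] by (rule card_image[symmetric]) (use assms(2) in \<open>auto intro: inj_on_subset\<close>)
  finally show "relabelled_op \<iota> T sign_mat \<psi> \<sigma> = sign_op (\<iota> ` T) \<psi> \<sigma>"
    by (simp add: sign_op_def)
qed

lemma op_prod_pauli_x:
  assumes "finite T"
  shows "op_prod pauli_x T = flip_op T"
  using assms
proof (induction T)
  case empty
  then show ?case by (auto simp: op_prod_def flip_op_def fun_eq_iff)
next
  case (insert c T)
  interpret comp_fun_commute "\<lambda>c. (\<circ>) (pauli_x c)"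
    by (rule comp_fun_commute_pauli_x)
  have "op_prod pauli_x (insert c T) = pauli_x c \<circ> flip_op T"
    using insert by (simp add: op_prod_def)
  also have "\<dots> = flip_op (insert c T)"
  proof (intro ext)
    fix \<psi> \<sigma>
    have "sym_diff (if c \<in> \<sigma> then \<sigma> - {c} else insert c \<sigma>) T = sym_diff \<sigma> (insert c T)"
      using insert(2) by auto
    then show "(pauli_x c \<circ> flip_op T) \<psi> \<sigma> = flip_op (insert c T) \<psi> \<sigma>"
      by (simp only: comp_apply pauli_x_apply flip_op_def)
  qed
  finally show ?case .
qed

lemma op_prod_pauli_z:
  assumes "finite T"
  shows "op_prod pauli_z T = sign_op T"
  using assms
proof (induction T)
  case empty
  then show ?case by (auto simp: op_prod_def sign_op_def fun_eq_iff)
next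
  case (insert c T)
  interpret comp_fun_commute "\<lambda>c. (\<circ>) (pauli_z c)"
    by (rule comp_fun_commute_pauli_z)
  have "op_prod pauli_z (insert c T) = pauli_z c \<circ> sign_op T"
    using insert by (simp add: op_prod_def)
  also have "\<dots> = sign_op (insert c T)"
    using insert(1,2) by (auto simp: fun_eq_iff sign_op_def pauli_z_apply Int_insert_left)
  finally show ?case .
qed

lemma sum_Pow_split:
  assumes "finite C" "\<iota> ` S \<subseteq> C" "inj_on \<iota> S"
  shows "(\<Sum>\<sigma>\<in>Pow C. F \<sigma>) = (\<Sum>\<alpha>\<in>Pow (C - \<iota> ` S). \<Sum>\<rho>\<in>Pow S. F (\<alpha> \<union> \<iota> ` \<rho>))"
proof -
  have "(\<Sum>\<sigma>\<in>Pow C. F \<sigma>) = (\<Sum>(\<alpha>, \<rho>)\<in>Pow (C - \<iota> ` S) \<times> Pow S. F (\<alpha> \<union> \<iota> ` \<rho>))"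
  proof (rule sum.reindex_bij_witness[where j = "\<lambda>\<sigma>. (\<sigma> - \<iota> ` S, S \<inter> \<iota> -` \<sigma>)" and i = "\<lambda>(\<alpha>, \<rho>). \<alpha> \<union> \<iota> ` \<rho>"], goal_cases)
    case (3 b)
    then show ?case using assms(3) by (auto simp: inj_on_def)
  next
    case (5 a)
    have "a - \<iota> ` S \<union> \<iota> ` (S \<inter> \<iota> -` a) = a" by auto
    then show ?case by simp
  qed (use assms in auto)
  then show ?thesis by (simp add: sum.cartesian_product)
qed

lemma qinner_relabelled:
  assumes "finite C" "\<iota> ` S \<subseteq> C" "inj_on \<iota> S"
  shows "qinner C \<phi> (relabelled_op \<iota> S w \<psi>) = qinner C (relabelled_op \<iota> S (mat_adjoint w) \<phi>) \<psi>"
proof -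
  have a: "relabelled_op \<iota> S u \<chi> (\<alpha> \<union> \<iota> ` \<rho>) = (\<Sum>\<tau>\<in>Pow S. u \<rho> \<tau> * \<chi> (\<alpha> \<union> \<iota> ` \<tau>))"
    if "\<alpha> \<subseteq> C - \<iota> ` S" "\<rho> \<subseteq> S" for u \<chi> \<alpha> \<rho>
  proof -
    have "S \<inter> \<iota> -` (\<alpha> \<union> \<iota> ` \<rho>) = \<rho>" "\<alpha> \<union> \<iota> ` \<rho> - \<iota> ` S = \<alpha>"
      using that assms(3) by (auto simp: inj_on_def)
    then show ?thesis by (simp add: relabelled_op_def)
  qed
  have "qinner C \<phi> (relabelled_op \<iota> S w \<psi>) = (\<Sum>\<alpha>\<in>Pow (C - \<iota> ` S). \<Sum>\<rho>\<in>Pow S. \<Sum>\<tau>\<in>Pow S.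
      cnj (\<phi> (\<alpha> \<union> \<iota> ` \<rho>)) * (w \<rho> \<tau> * \<psi> (\<alpha> \<union> \<iota> ` \<tau>)))"
    unfolding qinner_def sum_Pow_split[OF assms] by (intro sum.cong refl) (simp add: a sum_distrib_left)
  also have "\<dots> = (\<Sum>\<alpha>\<in>Pow (C - \<iota> ` S). \<Sum>\<tau>\<in>Pow S. \<Sum>\<rho>\<in>Pow S.
      cnj (mat_adjoint w \<tau> \<rho> * \<phi> (\<alpha> \<union> \<iota> ` \<rho>)) * \<psi> (\<alpha> \<union> \<iota> ` \<tau>))"
    by (subst sum.swap) (simp add: mat_adjoint_def mult_ac)
  also have "\<dots> = qinner C (relabelled_op \<iota> S (mat_adjoint w) \<phi>) \<psi>"
    unfolding qinner_def sum_Pow_split[OF assms] by (intro sum.cong refl) (simp add: a sum_distrib_right)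
  finally show ?thesis .
qed

lemma qinner_rgate_op:
  assumes "finite C" "rgate_supp g \<subseteq> C" "rgate_ok g"
  shows "qinner C (rgate_op g \<phi>) (rgate_op g \<psi>) = qinner C \<phi> \<psi>"
  using assms by (cases g) (simp add: qinner_relabelled relabelled_op_unitary(2))

lemma qubit_spaceD: "\<psi> \<in> qubit_space C \<Longrightarrow> \<not> \<sigma> \<subseteq> C \<Longrightarrow> \<psi> \<sigma> = 0"
  by (simp add: qubit_space_def)

lemma qubit_space_relabelled:
  assumes "\<psi> \<in> qubit_space C" "\<iota> ` S \<subseteq> C"
  shows "relabelled_op \<iota> S w \<psi> \<in> qubit_space C"
proof -
  have "\<psi> (\<sigma> - \<iota> ` S \<union> \<iota> ` \<tau>) = 0" if "\<not> \<sigma> \<subseteq> C" for \<sigma> \<tau>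
  proof -
    have "\<not> \<sigma> - \<iota> ` S \<union> \<iota> ` \<tau> \<subseteq> C" using assms(2) that by blast
    from qubit_spaceD[OF assms(1) this] show ?thesis .
  qed
  then show ?thesis by (auto simp: qubit_space_def relabelled_op_def)
qed

lemma rlayer_op_preserves:
  assumes "\<And>g. g \<in> set L \<Longrightarrow> rgate_supp g \<subseteq> C" "rlayer_ok L" "finite C"
  shows "qinner C (rlayer_op L \<phi>) (rlayer_op L \<psi>) = qinner C \<phi> \<psi>"
    and "\<psi> \<in> qubit_space C \<Longrightarrow> rlayer_op L \<psi> \<in> qubit_space C"
    and "rlayer_op L \<phi> = rlayer_op L \<psi> \<Longrightarrow> \<phi> = \<psi>"
proof -
  show "qinner C (rlayer_op L \<phi>) (rlayer_op L \<psi>) = qinner C \<phi> \<psi>"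
    using assms by (induction L) (simp_all add: qinner_rgate_op rlayer_ok_Cons)
  show "\<psi> \<in> qubit_space C \<Longrightarrow> rlayer_op L \<psi> \<in> qubit_space C"
    using assms
  proof (induction L)
    case (Cons g L)
    obtain \<kappa> S w where g: "g = (\<kappa>, S, w)" by (cases g)
    have "rgate_supp g \<subseteq> C" "rlayer_op L \<psi> \<in> qubit_space C"
      using Cons.IH Cons.prems by (simp_all add: rlayer_ok_Cons)
    then show ?case by (simp add: g qubit_space_relabelled)
  qed simp
  show "rlayer_op L \<phi> = rlayer_op L \<psi> \<Longrightarrow> \<phi> = \<psi>"
    using assms
  proof (induction L)
    case (Cons g L)
    obtain \<kappa> S w where g: "g = (\<kappa>, S, w)" by (cases g)
    have ok: "finite S" "inj_on \<kappa> S" "unitary_matrix_on S w" "rlayer_ok L"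
      using Cons.prems(3) by (simp_all add: g rlayer_ok_Cons)
    note inv = relabelled_op_unitary(2)[OF ok(1-3)]
    have "relabelled_op \<kappa> S w (rlayer_op L \<phi>) = relabelled_op \<kappa> S w (rlayer_op L \<psi>)"
      using Cons.prems(1) by (simp add: g)
    from arg_cong[OF this, of "relabelled_op \<kappa> S (mat_adjoint w)"]
    have "rlayer_op L \<phi> = rlayer_op L \<psi>" by (simp only: inv)
    then show ?case
      by (rule Cons.IH) (use Cons.prems(2,4) ok(4) in simp_all)
  qed simp
qed

lemma rcircuit_op_preserves:
  assumes "\<forall>L\<in>set U. rlayer_ok L \<and> (\<forall>g\<in>set L. rgate_supp g \<subseteq> C)" "finite C"
  shows "qinner C (rcircuit_op U \<phi>) (rcircuit_op U \<psi>) = qinner C \<phi> \<psi>"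
    and "\<psi> \<in> qubit_space C \<Longrightarrow> rcircuit_op U \<psi> \<in> qubit_space C"
    and "rcircuit_op U \<phi> = rcircuit_op U \<psi> \<Longrightarrow> \<phi> = \<psi>"
proof -
  have p: "qinner C (rlayer_op L \<phi>) (rlayer_op L \<psi>) = qinner C \<phi> \<psi>"
    "\<psi> \<in> qubit_space C \<Longrightarrow> rlayer_op L \<psi> \<in> qubit_space C"
    "rlayer_op L \<phi> = rlayer_op L \<psi> \<Longrightarrow> \<phi> = \<psi>"
    if "rlayer_ok L \<and> (\<forall>g\<in>set L. rgate_supp g \<subseteq> C)" for L \<phi> \<psi>
    using rlayer_op_preserves[of L C] that assms(2) by blast+
  show "qinner C (rcircuit_op U \<phi>) (rcircuit_op U \<psi>) = qinner C \<phi> \<psi>"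
    using assms(1) by (induction U) (simp_all add: p(1))
  show "\<psi> \<in> qubit_space C \<Longrightarrow> rcircuit_op U \<psi> \<in> qubit_space C"
    using assms(1) by (induction U) (simp_all add: p(2))
  show "rcircuit_op U \<phi> = rcircuit_op U \<psi> \<Longrightarrow> \<phi> = \<psi>"
    using assms(1)
  proof (induction U)
    case (Cons L U)
    then show ?case using p(3)[of L "rcircuit_op U \<phi>" "rcircuit_op U \<psi>"] by simp
  qed simp
qed

lemma vacuum_in_qubit_space: "vacuum \<in> qubit_space C"
  by (auto simp: qubit_space_def vacuum_def)

lemma qinner_vacuum: "finite C \<Longrightarrow> qinner C vacuum \<chi> = \<chi> {}"
  unfolding qinner_def vacuum_def by (simp add: if_distrib[of cnj] if_distrib[of "\<lambda>x. x * _"] cong: if_cong)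

lemma relabelled_op_vacuum:
  assumes "finite T"
  shows "relabelled_op \<iota> T u vacuum {} = u {} {}"
proof -
  have "relabelled_op \<iota> T u vacuum {} = (\<Sum>\<tau>\<in>Pow T. if \<tau> = {} then u {} \<tau> else 0)"
    unfolding relabelled_op_def vacuum_def by (intro sum.cong) auto
  also have "\<dots> = u {} {}" using assms by simp
  finally show ?thesis .
qed

section \<open>Product states\<close>

text \<open>A matrix with first column \<phi> and an orthogonal second column, so that it prepares
  \<phi> from the first basis state.\<close>

definition qubit_mat :: "'c \<Rightarrow> (bool \<Rightarrow> complex) \<Rightarrow> 'c local_matrix" where
  "qubit_mat c \<phi> \<sigma> \<tau> = (if c \<in> \<tau> then (if c \<in> \<sigma> then cnj (\<phi> False) else - cnj (\<phi> True)) else \<phi> (c \<in> \<sigma>))"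

lemma unitary_qubit_mat:
  assumes "(cmod (\<phi> False))\<^sup>2 + (cmod (\<phi> True))\<^sup>2 = 1"
  shows "unitary_matrix_on {c} (qubit_mat c \<phi>)"
proof -
  have "\<phi> False * cnj (\<phi> False) + \<phi> True * cnj (\<phi> True) = 1"
    using assms by (metis complex_norm_square of_real_1 of_real_add)
  then show ?thesis
    by (auto simp: unitary_matrix_on_def Pow_single qubit_mat_def algebra_simps)
qed

text \<open>One further layer of one-qubit gates absorbs the product state. The circuit then starts
  from \<open>vacuum\<close>, which has an evident counterpart on every covering.\<close>

definition product_layer :: "('c \<Rightarrow> bool \<Rightarrow> complex) \<Rightarrow> 'c list \<Rightarrow> 'c gate list" where
  "product_layer \<phi> cs = map (\<lambda>c. ({c}, qubit_mat c (\<phi> c))) cs"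

lemma product_layer_vacuum:
  assumes "distinct cs"
  shows "rlayer_op (map (Pair id) (product_layer \<phi> cs)) vacuum = tensor_state (set cs) \<phi>"
  using assms
proof (induction cs)
  case Nil
  then show ?case by (auto simp: product_layer_def tensor_state_def vacuum_def fun_eq_iff)
next
  case (Cons c cs)
  have *: "relabelled_op id {c} (qubit_mat c (\<phi> c)) (tensor_state (set cs) \<phi>) \<sigma> = tensor_state (set (c # cs)) \<phi> \<sigma>" for \<sigma>
  proof -
    have "relabelled_op id {c} (qubit_mat c (\<phi> c)) (tensor_state (set cs) \<phi>) \<sigma> =
       qubit_mat c (\<phi> c) ({c} \<inter> \<sigma>) {} * tensor_state (set cs) \<phi> (\<sigma> - {c})"
      using Cons.prems by (simp add: relabelled_op_def Pow_single tensor_state_def)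
    also have "\<dots> = tensor_state (set (c # cs)) \<phi> \<sigma>"
    proof -
      have "(\<Prod>x\<in>set cs. \<phi> x (x \<in> \<sigma> \<and> x \<noteq> c)) = (\<Prod>x\<in>set cs. \<phi> x (x \<in> \<sigma>))"
        using Cons.prems by (intro prod.cong refl arg_cong[where f = "\<phi> _"]) auto
      then show ?thesis
        using Cons.prems by (auto simp: qubit_mat_def tensor_state_def)
    qed
    finally show ?thesis .
  qed
  have "rlayer_op (map (Pair id) (product_layer \<phi> (c # cs))) vacuum =
      relabelled_op id {c} (qubit_mat c (\<phi> c)) (rlayer_op (map (Pair id) (product_layer \<phi> cs)) vacuum)"
    by (simp add: product_layer_def)
  also have "\<dots> = tensor_state (set (c # cs)) \<phi>"
    using Cons * by (intro ext) (simp only: distinct.simps)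
  finally show ?case .
qed

section \<open>Closed walks shorter than the girth\<close>

definition near :: "nat \<Rightarrow> 'a rel \<Rightarrow> 'a \<Rightarrow> 'a \<Rightarrow> bool" where
  "near n R a b \<longleftrightarrow> (\<exists>k\<le>n. (a, b) \<in> R ^^ k)"

lemma near_refl [simp]: "near n R a a"
  by (auto simp: near_def intro!: exI[of _ 0])

lemma near_step: "(a, b) \<in> R \<Longrightarrow> near (Suc n) R a b"
  by (auto simp: near_def intro!: exI[of _ 1])

lemma near_mono: "near m R a b \<Longrightarrow> m \<le> n \<Longrightarrow> near n R a b"
  unfolding near_def by (meson order.trans)

lemma near_trans: "near m R a b \<Longrightarrow> near n R b c \<Longrightarrow> near (m + n) R a c"
  unfolding near_def by (meson add_mono relpow_trans)

lemma near_sym: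
  assumes "sym R" "near n R a b"
  shows "near n R b a"
proof -
  have "(b, a) \<in> R ^^ k" if "(a, b) \<in> R ^^ k" for k
    using that
  proof (induction k arbitrary: b)
    case (Suc k)
    then obtain c where "(a, c) \<in> R ^^ k" "(b, c) \<in> R" using assms(1) by (auto simp: sym_def)
    with Suc.IH[of c] show ?case by (metis relpow_Suc_I2)
  qed simp
  with assms(2) show ?thesis by (auto simp: near_def)
qed

lemma near_invariant:
  assumes "near n R a b" "P a" "\<And>x y. (x, y) \<in> R \<Longrightarrow> P x \<Longrightarrow> P y"
  shows "P b"
proof -
  have "P b" if "(a, b) \<in> R ^^ k" for k
    using that by (induction k arbitrary: b) (use assms(2,3) in auto)
  with assms(1) show ?thesis by (auto simp: near_def)
qed

lemma near_image:
  assumes "near n R a b" "\<And>x y. (x, y) \<in> R \<Longrightarrow> near m Q (h x) (h y)"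
  shows "near (m * n) Q (h a) (h b)"
proof -
  have "near (m * k) Q (h a) (h b)" if "(a, b) \<in> R ^^ k" for k
    using that
  proof (induction k arbitrary: b)
    case (Suc k)
    then obtain c where "(a, c) \<in> R ^^ k" "(c, b) \<in> R" by auto
    with Suc.IH[of c] assms(2) have "near (m * k + m) Q (h a) (h b)" by (blast intro: near_trans)
    then show ?case by (simp add: add.commute)
  qed simp
  with assms(1) obtain k where "k \<le> n" "near (m * k) Q (h a) (h b)" by (auto simp: near_def)
  then show ?thesis by (auto intro: near_mono)
qed

text \<open>The derived graph of a voltage assignment. The fibre stays arbitrary: sheets numbered by
  \<open>nat\<close> give coverings, whereas the fibre \<open>int\<close> serves to count signed
  crossings of one edge.\<close>

definition lift_arcs :: "('v \<times> 'v) set \<Rightarrow> ('v \<times> 'v \<Rightarrow> 'x \<Rightarrow> 'x) \<Rightarrow> ('v \<times> 'x) rel" where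
  "lift_arcs A \<pi> = {((a, i), (b, \<pi> (a, b) i)) |a b i. (a, b) \<in> A}"

lemma in_lift_arcs: "((a, i), (b, j)) \<in> lift_arcs A \<pi> \<longleftrightarrow> (a, b) \<in> A \<and> j = \<pi> (a, b) i"
  by (auto simp: lift_arcs_def)

lemma pcas_map: "m \<le> n \<Longrightarrow> pcas (v m) (map (\<lambda>k. (v k, v (Suc k))) [m..<n]) (v n)"
proof (induction "n - m" arbitrary: m)
  case (Suc k)
  then have "[m..<n] = m # [Suc m..<n]" by (simp add: upt_conv_Cons)
  with Suc show ?case by simp
qed simp

lemma pawalk_verts_map: "m \<le> n \<Longrightarrow> pawalk_verts (v m) (map (\<lambda>k. (v k, v (Suc k))) [m..<n]) = map v [m..<Suc n]"
proof (induction "n - m" arbitrary: m)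
  case (Suc k)
  then have "[m..<n] = m # [Suc m..<n]" "[m..<Suc n] = m # [Suc m..<Suc n]" by (simp_all add: upt_conv_Cons)
  with Suc show ?case by simp
qed simp

lemma girth_le:
  assumes "\<And>k. k < n \<Longrightarrow> (v k, v (Suc k)) \<in> parcs G" "v n = v 0" "inj_on v {..<n}" "3 \<le> n" "v 0 \<in> pverts G"
  shows "girth G \<le> enat n"
proof -
  let ?p = "map (\<lambda>k. (v k, v (Suc k))) [0..<n]"
  have "tl (map v [0..<Suc n]) = map v ([1..<n] @ [n])"
    using assms(4) by (subst upt_rec) (simp add: map_tl[symmetric])
  moreover have "distinct (map v ([1..<n] @ [n]))"
  proof -
    have "v 0 \<notin> v ` {1..<n}"
      using inj_onD[OF assms(3), of 0] assms(4) by fastforce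
    moreover have "inj_on v {1..<n}" using assms(3) by (rule inj_on_subset) auto
    ultimately show ?thesis using assms(2) by (simp add: distinct_map)
  qed
  ultimately have "distinct (tl (pawalk_verts (v 0) ?p))"
    by (subst pawalk_verts_map) simp_all
  moreover have "pcas (v 0) ?p (v 0)"
    using pcas_map[of 0 n v] assms(2) by simp
  ultimately have "pre_digraph.cycle (with_proj G) ?p"
    using assms by (auto simp: pre_digraph.cycle_def pre_digraph.awalk_def cas_with_proj_eq awalk_verts_with_proj_eq)
  then have "(INF p \<in> {p. pre_digraph.cycle (with_proj G) p \<and> 3 \<le> length p}. enat (length p)) \<le> enat (length ?p)"
    using assms(4) by (intro INF_lower) simp
  then show ?thesis by (simp add: girth_def)
qed

text \<open>A repeated vertex bounds a shorter closed walk, which acts trivially by induction and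
  can be cut out. A closed walk without such repetitions is empty, or goes along an arc and back,
  which \<open>inv\<close> cancels, or would be a loop or a cycle shorter than the girth.\<close>

lemma trivial_holonomy:
  fixes \<pi> :: "'v \<times> 'v \<Rightarrow> 'x \<Rightarrow> 'x"
  assumes "pair_graph G"
    and inv: "\<And>a b i. (a, b) \<in> parcs G \<Longrightarrow> \<pi> (b, a) (\<pi> (a, b) i) = i"
    and "((a, i), (a, j)) \<in> lift_arcs (parcs G) \<pi> ^^ n" "enat n < girth G"
  shows "i = j"
  using assms(3,4)
proof (induction n arbitrary: a i j rule: less_induct)
  case (less n)
  interpret pair_graph G by fact
  from less.prems(1) obtain f where f: "f 0 = (a, i)" "f n = (a, j)"
    "\<And>k. k < n \<Longrightarrow> (f k, f (Suc k)) \<in> lift_arcs (parcs G) \<pi>"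
    by (auto simp: relpow_fun_conv)
  define v where "v k = fst (f k)" for k
  have sub: "(f p, f q) \<in> lift_arcs (parcs G) \<pi> ^^ (q - p)" if "p \<le> q" "q \<le> n" for p q
    unfolding relpow_fun_conv by (rule exI[of _ "\<lambda>k. f (p + k)"]) (use that f(3) in auto)
  have arc: "(v k, v (Suc k)) \<in> parcs G" "snd (f (Suc k)) = \<pi> (v k, v (Suc k)) (snd (f k))" if "k < n" for k
    using f(3)[OF that] by (cases "f k"; cases "f (Suc k)"; simp add: in_lift_arcs v_def)+
  show ?case
  proof (cases "\<exists>p q. p < q \<and> q \<le> n \<and> q - p < n \<and> v p = v q")
    case True
    then obtain p q where pq: "p < q" "q \<le> n" "q - p < n" "v p = v q" by blast
    have "snd (f p) = snd (f q)"
      using less.IH[OF pq(3), of "v p" "snd (f p)" "snd (f q)"] sub[of p q] pq less.prems(2)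
        order.strict_trans[of "enat (q - p)" "enat n" "girth G"]
      by (simp add: v_def)
    then have "f p = f q" using pq(4) by (simp add: v_def prod_eq_iff)
    then have "(f 0, f p) \<in> lift_arcs (parcs G) \<pi> ^^ p" "(f p, f n) \<in> lift_arcs (parcs G) \<pi> ^^ (n - q)"
      using sub[of 0 p] sub[of q n] pq by simp_all
    then have "(f 0, f n) \<in> lift_arcs (parcs G) \<pi> ^^ (p + (n - q))"
      by (rule relpow_trans)
    moreover have "p + (n - q) < n" using pq by linarith
    ultimately show ?thesis
      using less.IH[of "p + (n - q)" a i j] less.prems(2) order.strict_trans[of "enat (p + (n - q))" "enat n" "girth G"]
      by (simp add: f)
  next
    case False
    then have dist: "v p \<noteq> v q" if "p < q" "q \<le> n" "q - p < n" for p q using that by blast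
    have "v n = v 0" by (simp add: v_def f)
    consider "n = 0" | "n = 1" | "n = 2" | "3 \<le> n" by linarith
    then show ?thesis
    proof cases
      case 1 then show ?thesis using f by simp
    next
      case 2 then show ?thesis using arc(1)[of 0] \<open>v n = v 0\<close> pair_no_loops by fastforce
    next
      case 3
      then have "(v 0, v 1) \<in> parcs G" "snd (f 1) = \<pi> (v 0, v 1) i" "j = \<pi> (v 1, v 0) (snd (f 1))"
        using arc[of 0] arc[of 1] \<open>v n = v 0\<close> f by (simp_all add: numeral_2_eq_2)
      then show ?thesis using inv by simp
    next
      case 4
      have "inj_on v {..<n}"
        by (rule linorder_inj_onI) (use dist in auto)
      moreover have "v 0 \<in> pverts G" using arc(1)[of 0] 4 in_arcsD1 by auto
      ultimately have "girth G \<le> enat n" using girth_le[of n v G] arc(1) \<open>v n = v 0\<close> 4 by blast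
      with less.prems(2) show ?thesis by simp
    qed
  qed
qed

lemma trivial_holonomy_near:
  fixes \<pi> :: "'v \<times> 'v \<Rightarrow> 'x \<Rightarrow> 'x"
  assumes "pair_graph G" "\<And>a b i. (a, b) \<in> parcs G \<Longrightarrow> \<pi> (b, a) (\<pi> (a, b) i) = i"
    and "near n (lift_arcs (parcs G) \<pi>) (a, i) (a, j)" "enat n < girth G"
  shows "i = j"
proof -
  from assms(3) obtain k where "k \<le> n" "((a, i), (a, j)) \<in> lift_arcs (parcs G) \<pi> ^^ k"
    by (auto simp: near_def)
  moreover from this have "enat k < girth G"
    using assms(4) order.strict_trans1[of "enat k" "enat n" "girth G"] by simp
  ultimately show ?thesis
    using trivial_holonomy[where \<pi> = \<pi> and n = k, OF assms(1)] assms(2) by blast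
qed

lemma sym_lift_arcs:
  assumes "pair_graph G" "\<And>a b i. (a, b) \<in> parcs G \<Longrightarrow> \<pi> (b, a) (\<pi> (a, b) i) = i"
  shows "sym (lift_arcs (parcs G) \<pi>)"
proof -
  interpret pair_graph G by fact
  have "(b, a) \<in> parcs G" if "(a, b) \<in> parcs G" for a b
    using that pair_sym_arcs by (auto simp: symmetric_def sym_def)
  then show ?thesis using assms(2) by (auto simp: sym_def lift_arcs_def)
qed

section \<open>Coverings of the second factor\<close>

lemma images_meet: "f ` A \<inter> h ` B \<noteq> {} \<Longrightarrow> \<exists>a\<in>A. \<exists>b\<in>B. f a = h b"
  by auto

lemma near_from_common:
  assumes "sym R" "near m R a b" "near n R a c"
  shows "near (m + n) R b c"
  using near_trans[OF near_sym[OF assms(1,2)] assms(3)] .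

lemma near_to_common:
  assumes "sym R" "near m R a c" "near n R b c"
  shows "near (m + n) R a b"
  using near_trans[OF assms(2) near_sym[OF assms(1,3)]] .

text \<open>An arbitrary orientation. One permutation per undirected edge acts along it, and its
  inverse acts against it.\<close>

definition edge_tail :: "'v pair_pre_digraph \<Rightarrow> 'v set \<Rightarrow> 'v" where
  "edge_tail G f = (SOME a. \<exists>b. f = {a, b} \<and> (a, b) \<in> parcs G)"

definition edge_head :: "'v pair_pre_digraph \<Rightarrow> 'v set \<Rightarrow> 'v" where
  "edge_head G f = (SOME b. f = {edge_tail G f, b} \<and> (edge_tail G f, b) \<in> parcs G)"

text \<open>Unlike \<open>cell_adj\<close>, this also relates a cell to itself, so a common boundary
  point is all that has to be found.\<close>

definition cell_touch :: "'v pair_pre_digraph \<Rightarrow> 'v one_cell rel" where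
  "cell_touch G = {(a, b). a \<in> one_cells G \<and> b \<in> one_cells G \<and> boundary1 a \<inter> boundary1 b \<noteq> {}}"

lemma edge_ends:
  assumes "f \<in> uedges G"
  shows "f = {edge_tail G f, edge_head G f}" "(edge_tail G f, edge_head G f) \<in> parcs G"
proof -
  have "\<exists>a b. f = {a, b} \<and> (a, b) \<in> parcs G" using assms by (auto simp: uedges_def)
  then have "\<exists>b. f = {edge_tail G f, b} \<and> (edge_tail G f, b) \<in> parcs G"
    unfolding edge_tail_def by (rule someI_ex)
  then have "f = {edge_tail G f, edge_head G f} \<and> (edge_tail G f, edge_head G f) \<in> parcs G"
    unfolding edge_head_def by (rule someI_ex)
  then show "f = {edge_tail G f, edge_head G f}" "(edge_tail G f, edge_head G f) \<in> parcs G" by auto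
qed

text \<open>
  An \<open>N\<close>-sheeted covering of the second copy of \<open>G\<close>: the edge \<open>f\<close> has the lifts \<open>(f, i)\<close>, and
  \<open>(f, i)\<close> joins sheet \<open>i\<close> over the tail of \<open>f\<close> to sheet \<open>pf f i\<close> over its head.
\<close>

locale covering =
  fixes G :: "'v pair_pre_digraph" and N :: nat and pf :: "'v set \<Rightarrow> nat \<Rightarrow> nat"
  assumes G: "pair_graph G" and pf: "\<And>f. f \<in> uedges G \<Longrightarrow> pf f permutes {..<N}"
begin

definition transport :: "'v \<times> 'v \<Rightarrow> nat \<Rightarrow> nat" where
  "transport = (\<lambda>(a, b). if a = edge_tail G {a, b} then pf {a, b} else inv (pf {a, b}))"

abbreviation "cover_arcs \<equiv> lift_arcs (parcs G) transport"

fun lboundary :: "'v one_cell \<times> nat \<Rightarrow> ('v \<times> ('v \<times> nat)) set" where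
  "lboundary (EV e v, i) = e \<times> {(v, i)}"
| "lboundary (VE u f, i) = {u} \<times> {(edge_tail G f, i), (edge_head G f, pf f i)}"

definition lcells :: "('v one_cell \<times> nat) set" where
  "lcells = one_cells G \<times> {..<N}"

definition ltouch :: "('v one_cell \<times> nat) rel" where
  "ltouch = {(a, b). a \<in> lcells \<and> b \<in> lcells \<and> lboundary a \<inter> lboundary b \<noteq> {}}"

lemma finite_uedges: "finite (uedges G)"
proof -
  interpret pair_graph G by (rule G)
  have "uedges G \<subseteq> (\<lambda>(u, v). {u, v}) ` parcs G" by (auto simp: uedges_def)
  then show ?thesis using pair_finite_arcs finite_surj by blast
qed

lemma finite_pverts: "finite (pverts G)"
proof -
  interpret pair_graph G by (rule G)
  show ?thesis by (rule pair_finite_verts)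
qed

lemma parcs_sym: "(a, b) \<in> parcs G \<Longrightarrow> (b, a) \<in> parcs G"
proof -
  interpret pair_graph G by (rule G)
  show "(a, b) \<in> parcs G \<Longrightarrow> (b, a) \<in> parcs G"
    using pair_sym_arcs by (auto simp: symmetric_def sym_def)
qed

lemma parcs_D: "(a, b) \<in> parcs G \<Longrightarrow> a \<in> pverts G \<and> b \<in> pverts G \<and> a \<noteq> b"
proof -
  interpret pair_graph G by (rule G)
  show "(a, b) \<in> parcs G \<Longrightarrow> a \<in> pverts G \<and> b \<in> pverts G \<and> a \<noteq> b"
    using in_arcsD1 in_arcsD2 pair_no_loops by fastforce
qed

lemma uedges_I: "(a, b) \<in> parcs G \<Longrightarrow> {a, b} \<in> uedges G"
  by (auto simp: uedges_def)

lemma edge_ends':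
  assumes "f \<in> uedges G"
  shows "edge_tail G f \<in> pverts G" "edge_head G f \<in> pverts G" "edge_tail G f \<noteq> edge_head G f"
  using edge_ends[OF assms] parcs_D by blast+

lemma transport_ends:
  assumes "f \<in> uedges G"
  shows "transport (edge_tail G f, edge_head G f) = pf f" "transport (edge_head G f, edge_tail G f) = inv (pf f)"
  using edge_ends(1)[OF assms, symmetric] edge_ends'(3)[OF assms] by (simp_all add: transport_def insert_commute)

lemma parcs_cases:
  assumes "(a, b) \<in> parcs G"
  obtains "a = edge_tail G {a, b}" "b = edge_head G {a, b}" | "b = edge_tail G {a, b}" "a = edge_head G {a, b}"
  using edge_ends[OF uedges_I[OF assms]] parcs_D[OF assms] by (metis doubleton_eq_iff)

lemma transport_inverse:
  assumes "(a, b) \<in> parcs G"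
  shows "transport (b, a) (transport (a, b) i) = i"
proof -
  have f: "{a, b} \<in> uedges G" by (rule uedges_I[OF assms])
  note p = permutes_inverses[OF pf[OF f]]
  show ?thesis
    using assms by (rule parcs_cases) (use transport_ends[OF f] p in metis)+
qed

lemma transport_less:
  assumes "(a, b) \<in> parcs G" "i < N"
  shows "transport (a, b) i < N"
proof -
  have f: "{a, b} \<in> uedges G" by (rule uedges_I[OF assms(1)])
  show ?thesis
    using permutes_in_image[OF pf[OF f], of i] permutes_in_image[OF permutes_inv[OF pf[OF f]], of i] assms(2)
    by (simp add: transport_def)
qed

lemma sym_cover_arcs: "sym cover_arcs"
  by (rule sym_lift_arcs[OF G]) (rule transport_inverse)

lemma cover_arcs_unique:
  "near n cover_arcs (a, i) (a, j) \<Longrightarrow> enat n < girth G \<Longrightarrow> i = j"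
  by (rule trivial_holonomy_near[OF G, where \<pi> = transport]) (use transport_inverse in auto)

lemma sym_parcs: "sym (parcs G)"
  using parcs_sym by (auto simp: sym_def)

lemma sym_ltouch: "sym ltouch"
  by (auto simp: sym_def ltouch_def)

lemma finite_lcells: "finite lcells" and finite_one_cells: "finite (one_cells G)"
proof -
  have "one_cells G = (\<lambda>(e, v). EV e v) ` (uedges G \<times> pverts G) \<union> (\<lambda>(v, e). VE v e) ` (pverts G \<times> uedges G)"
    by (auto simp: one_cells_def)
  then show "finite (one_cells G)" using finite_uedges finite_pverts by simp
  then show "finite lcells" by (simp add: lcells_def)
qed

lemma pf_less: "f \<in> uedges G \<Longrightarrow> i < N \<Longrightarrow> pf f i < N"
  using permutes_in_image[OF pf, of f i] by simp

lemma lboundary_ne: "a \<in> lcells \<Longrightarrow> lboundary a \<noteq> {}"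
  by (auto simp: lcells_def one_cells_def uedges_def)

lemma lboundary_fst:
  assumes "a \<in> lcells" "s \<in> lboundary a" "t \<in> lboundary a"
  shows "near 1 (parcs G) (fst s) (fst t)"
proof -
  have "fst s = fst t \<or> (fst s, fst t) \<in> parcs G"
    using assms parcs_sym by (auto simp: lcells_def one_cells_def uedges_def)
  then show ?thesis using near_step[of "fst s" "fst t" "parcs G" 0] by auto
qed

lemma lboundary_snd:
  assumes "a \<in> lcells" "s \<in> lboundary a" "t \<in> lboundary a"
  shows "near 1 cover_arcs (snd s) (snd t)"
proof -
  have "snd s = snd t \<or> (snd s, snd t) \<in> cover_arcs"
  proof (cases a)
    case (Pair c i)
    show ?thesis
    proof (cases c)
      case (EV e v)
      then show ?thesis using assms by (auto simp: Pair)
    next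
      case (VE u f)
      then have f: "f \<in> uedges G" using assms by (auto simp: Pair lcells_def one_cells_def)
      then have "((edge_tail G f, i), (edge_head G f, pf f i)) \<in> cover_arcs"
        "((edge_head G f, pf f i), (edge_tail G f, i)) \<in> cover_arcs"
        using transport_ends[OF f] edge_ends(2)[OF f] parcs_sym permutes_inverses[OF pf[OF f]]
        by (simp_all add: in_lift_arcs)
      with assms VE show ?thesis by (auto simp: Pair)
    qed
  qed
  then show ?thesis using near_step[of "snd s" "snd t" "cover_arcs" 0] by auto
qed

text \<open>Inside one cell each coordinate of a boundary point moves along at most one arc. A chain
  of \<open>n\<close> steps passes \<open>n + 1\<close> cells, hence \<open>Suc n\<close>.\<close>

lemma near_ltouch_coords:
  assumes "near n ltouch a b" "a \<in> lcells" "s \<in> lboundary a" "t \<in> lboundary b"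
  shows "near (Suc n) (parcs G) (fst s) (fst t)" "near (Suc n) cover_arcs (snd s) (snd t)"
proof -
  have *: "near (Suc k) (parcs G) (fst s) (fst t) \<and> near (Suc k) cover_arcs (snd s) (snd t)"
    if "(a, b) \<in> ltouch ^^ k" "t \<in> lboundary b" for k
    using that
  proof (induction k arbitrary: b t)
    case 0
    then show ?case using lboundary_fst[OF assms(2,3)] lboundary_snd[OF assms(2,3)] by simp
  next
    case (Suc k)
    then obtain c where c: "(a, c) \<in> ltouch ^^ k" "(c, b) \<in> ltouch" by auto
    then obtain r where r: "r \<in> lboundary c" "r \<in> lboundary b" "b \<in> lcells" by (auto simp: ltouch_def)
    show ?case
      using Suc.IH[OF c(1) r(1)] lboundary_fst[OF r(3,2) Suc.prems(2)] lboundary_snd[OF r(3,2) Suc.prems(2)]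
        near_trans[of "Suc k" "parcs G" "fst s" "fst r" 1 "fst t"]
        near_trans[of "Suc k" cover_arcs "snd s" "snd r" 1 "snd t"] by simp
  qed
  from assms(1) obtain k where "k \<le> n" "(a, b) \<in> ltouch ^^ k" by (auto simp: near_def)
  with *[OF this(2) assms(4)]
  show "near (Suc n) (parcs G) (fst s) (fst t)" "near (Suc n) cover_arcs (snd s) (snd t)"
    by (auto intro: near_mono)
qed

lemma cell_position:
  assumes "c \<in> one_cells G"
  shows "\<exists>x v. \<forall>i. (x, (v, i)) \<in> lboundary (c, i)"
proof (cases c)
  case (EV e v)
  then obtain u where "u \<in> e" using assms by (auto simp: one_cells_def uedges_def)
  with EV have "\<forall>i. (u, (v, i)) \<in> lboundary (c, i)" by simp
  then show ?thesis by blast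
next
  case (VE u f)
  then have "\<forall>i. (u, (edge_tail G f, i)) \<in> lboundary (c, i)" by simp
  then show ?thesis by blast
qed

text \<open>Such a chain of cells projects to a closed walk in \<open>G\<close> below the girth,
  which has no holonomy.\<close>

lemma lift_unique:
  assumes "near n ltouch (c, i) (c, j)" "c \<in> one_cells G" "i < N" "enat (Suc n) < girth G"
  shows "i = j"
proof -
  obtain x v where "\<forall>i. (x, (v, i)) \<in> lboundary (c, i)" using cell_position[OF assms(2)] by blast
  then have "near (Suc n) cover_arcs (v, i) (v, j)"
    using near_ltouch_coords(2)[OF assms(1), of "(x, (v, i))" "(x, (v, j))"] assms(2,3) by (simp add: lcells_def)
  then show ?thesis using cover_arcs_unique assms(4) by blast
qed

lemma ltouch_boundary1:
  assumes "(x, (v, j)) \<in> lboundary (c, i)" "c \<in> one_cells G"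
  shows "(x, v) \<in> boundary1 c"
proof (cases c)
  case (VE u f)
  then have "f \<in> uedges G" using assms by (auto simp: one_cells_def)
  from edge_ends(1)[OF this] have "edge_tail G f \<in> f" "edge_head G f \<in> f" by blast+
  with assms VE show ?thesis by auto
qed (use assms in auto)

lemma lboundary_exists:
  assumes "(x, v) \<in> boundary1 c" "c \<in> one_cells G" "j < N"
  shows "\<exists>i<N. (x, (v, j)) \<in> lboundary (c, i)"
proof (cases c)
  case (EV e u)
  with assms show ?thesis by auto
next
  case (VE u f)
  then have f: "f \<in> uedges G" using assms by (auto simp: one_cells_def)
  note p = permutes_inverses[OF pf[OF f]] permutes_in_image[OF permutes_inv[OF pf[OF f]], of j]
  have "v = edge_tail G f \<or> v = edge_head G f"
    using assms(1) VE edge_ends(1)[OF f] by auto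
  then show ?thesis
  proof
    assume "v = edge_head G f"
    then have "(x, (v, j)) \<in> lboundary (c, inv (pf f) j)" "inv (pf f) j < N"
      using assms VE p by auto
    then show ?thesis by blast
  qed (use assms VE in auto)
qed

lemma lboundary_less:
  assumes "(x, (v, j)) \<in> lboundary (c, i)" "c \<in> one_cells G" "i < N"
  shows "j < N"
  using assms pf_less by (auto simp: one_cells_def)

lemma lift_touch:
  assumes "(c, c') \<in> cell_touch G" "i < N"
  shows "\<exists>i'<N. ((c, i), (c', i')) \<in> ltouch"
proof -
  from assms obtain x v where xv: "(x, v) \<in> boundary1 c" "(x, v) \<in> boundary1 c'"
    and c: "c \<in> one_cells G" "c' \<in> one_cells G" by (auto simp: cell_touch_def)
  obtain j where j: "(x, (v, j)) \<in> lboundary (c, i)"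
  proof (cases c)
    case (EV e u)
    with xv that show ?thesis by auto
  next
    case (VE u f)
    then have "f \<in> uedges G" using c by (auto simp: one_cells_def)
    from edge_ends(1)[OF this] that xv(1) VE show ?thesis by auto
  qed
  with lboundary_less[OF j c(1) assms(2)] lboundary_exists[OF xv(2) c(2)]
  obtain i' where "i' < N" "(x, (v, j)) \<in> lboundary (c', i')" by blast
  with j c assms(2) show ?thesis by (auto simp: ltouch_def lcells_def)
qed

lemma lift_near:
  assumes "near n (cell_touch G) c c'" "i < N"
  shows "\<exists>i'<N. near n ltouch (c, i) (c', i')"
proof -
  have "\<exists>i'<N. ((c, i), (c', i')) \<in> ltouch ^^ k" if "(c, c') \<in> cell_touch G ^^ k" for k
    using that
  proof (induction k arbitrary: c')
    case 0
    then show ?case using assms(2) by auto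
  next
    case (Suc k)
    then obtain b where "(c, b) \<in> cell_touch G ^^ k" "(b, c') \<in> cell_touch G" by auto
    with Suc.IH obtain j where "j < N" "((c, i), (b, j)) \<in> ltouch ^^ k" by blast
    moreover from lift_touch[OF \<open>(b, c') \<in> cell_touch G\<close> this(1)]
    obtain i' where "i' < N" "((b, j), (c', i')) \<in> ltouch" by blast
    ultimately show ?case by (auto intro: relpow_Suc_I)
  qed
  with assms(1) show ?thesis by (fastforce simp: near_def)
qed

lemma near_project: "near n ltouch a b \<Longrightarrow> near n (cell_touch G) (fst a) (fst b)"
proof -
  assume "near n ltouch a b"
  moreover have "near 1 (cell_touch G) (fst x) (fst y)" if "(x, y) \<in> ltouch" for x y
  proof -
    from that obtain s v j where "(s, (v, j)) \<in> lboundary x" "(s, (v, j)) \<in> lboundary y"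
      and "x \<in> lcells" "y \<in> lcells" by (auto simp: ltouch_def)
    then have "(fst x, fst y) \<in> cell_touch G"
      using ltouch_boundary1[of s v j "fst x" "snd x"] ltouch_boundary1[of s v j "fst y" "snd y"]
      by (auto simp: cell_touch_def lcells_def)
    then show ?thesis using near_step[of _ _ _ 0] by auto
  qed
  ultimately show ?thesis using near_image[of n ltouch a b 1 "cell_touch G" fst] by simp
qed

lemma near_lcells: "near n ltouch a b \<Longrightarrow> a \<in> lcells \<Longrightarrow> b \<in> lcells"
  by (erule near_invariant) (auto simp: ltouch_def)

subsection \<open>Lifting circuits\<close>

text \<open>A section over the ball of radius \<open>M\<close> around \<open>c0\<close>, based at
  \<open>(c0, i0)\<close>. Outside of the ball its value is arbitrary; inside, the chosen lift is
  the only one if \<open>2 * M + 1\<close> is below the girth.\<close>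

definition section_at :: "nat \<Rightarrow> 'v one_cell \<Rightarrow> nat \<Rightarrow> 'v one_cell \<Rightarrow> 'v one_cell \<times> nat" where
  "section_at M c0 i0 c = (c, SOME j. near M ltouch (c0, i0) (c, j))"

lemma fst_section_at [simp]: "fst (section_at M c0 i0 c) = c"
  by (simp add: section_at_def)

lemma inj_section_at: "inj_on (section_at M c0 i0) X"
  by (rule inj_on_inverseI[of _ fst]) simp

lemma section_at_near:
  assumes "near M (cell_touch G) c0 c" "i0 < N"
  shows "near M ltouch (c0, i0) (section_at M c0 i0 c)"
proof -
  have "\<exists>j. near M ltouch (c0, i0) (c, j)" using lift_near[OF assms] by blast
  then show ?thesis unfolding section_at_def by (rule someI_ex)
qed

lemma section_at_eqI:
  assumes "near m ltouch (c0, i0) (c, j)" "m \<le> M" "c0 \<in> one_cells G" "i0 < N" "enat (Suc (2 * M)) < girth G"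
  shows "section_at M c0 i0 c = (c, j)"
proof -
  have w: "near M ltouch (c0, i0) (c, j)" by (rule near_mono[OF assms(1,2)])
  have "near M ltouch (c0, i0) (section_at M c0 i0 c)"
    using section_at_near[of M c0 c i0] near_project[OF w] assms(4) by simp
  with w have "near (M + M) ltouch (c, j) (section_at M c0 i0 c)"
    by (rule near_from_common[OF sym_ltouch])
  moreover have "(c, j) \<in> lcells"
    using near_lcells[OF w] assms(3,4) by (simp add: lcells_def)
  ultimately have "j = snd (section_at M c0 i0 c)"
    using lift_unique[of "M + M" c j] assms(5) by (auto simp: section_at_def lcells_def mult_2)
  then show ?thesis by (simp add: section_at_def)
qed

text \<open>One copy through each lift of a cell chosen in the support; for an empty support the
  copies are scalars.\<close>

definition lift_gate :: "nat \<Rightarrow> 'v one_cell gate \<Rightarrow> ('v one_cell, 'v one_cell \<times> nat) rgate list" where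
  "lift_gate D g = map (\<lambda>i. (section_at D (SOME c. c \<in> fst g) i, g)) [0..<N]"

definition lift_layer :: "nat \<Rightarrow> 'v one_cell gate list \<Rightarrow> ('v one_cell, 'v one_cell \<times> nat) rgate list" where
  "lift_layer D L = concat (map (lift_gate D) L)"

definition gate_ok :: "nat \<Rightarrow> 'v one_cell gate \<Rightarrow> bool" where
  "gate_ok D g \<longleftrightarrow> fst g \<subseteq> one_cells G \<and> unitary_matrix_on (fst g) (snd g) \<and>
     (\<forall>c\<in>fst g. \<forall>c'\<in>fst g. near D (cell_touch G) c c')"

definition layer_ok :: "nat \<Rightarrow> 'v one_cell gate list \<Rightarrow> bool" where
  "layer_ok D L \<longleftrightarrow> (\<forall>g\<in>set L. gate_ok D g) \<and> sorted_wrt (\<lambda>g h. fst g \<inter> fst h = {}) L"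

lemma lift_gate_supp:
  assumes "gate_ok D g" "i < N" "c \<in> fst g"
  shows "near D ltouch (SOME c. c \<in> fst g, i) (section_at D (SOME c. c \<in> fst g) i c)"
    and "section_at D (SOME c. c \<in> fst g) i c \<in> lcells"
proof -
  have b: "(SOME c. c \<in> fst g) \<in> fst g" using assms(3) by (rule someI)
  then show w: "near D ltouch (SOME c. c \<in> fst g, i) (section_at D (SOME c. c \<in> fst g) i c)"
    using assms by (intro section_at_near) (auto simp: gate_ok_def)
  show "section_at D (SOME c. c \<in> fst g) i c \<in> lcells"
    using near_lcells[OF w] b assms(1,2) by (auto simp: gate_ok_def lcells_def)
qed

text \<open>A common cell would join two lifts of the base cell by a chain of \<open>2 * D\<close>
  steps.\<close>

lemma lift_gate_disjoint:
  assumes "gate_ok D g" "i < N" "j < N" "i \<noteq> j" "enat (Suc (2 * D)) < girth G"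
  shows "section_at D (SOME c. c \<in> fst g) i ` fst g \<inter> section_at D (SOME c. c \<in> fst g) j ` fst g = {}"
proof (rule ccontr)
  let ?b = "SOME c. c \<in> fst g"
  assume "\<not> ?thesis"
  from images_meet[OF this] obtain c c' where c: "c \<in> fst g" "c' \<in> fst g"
    "section_at D ?b i c = section_at D ?b j c'" by blast
  then have "c = c'" by (simp add: section_at_def)
  have "?b \<in> fst g" using c(1) by (rule someI)
  have "near (D + D) ltouch (?b, i) (?b, j)"
    using near_to_common[OF sym_ltouch lift_gate_supp(1)[OF assms(1,2) c(1)]] lift_gate_supp(1)[OF assms(1,3) c(2)] c(3)
    by simp
  then show False
    using lift_unique[of "D + D" ?b i j] assms \<open>?b \<in> fst g\<close> by (auto simp: gate_ok_def mult_2)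
qed

lemma rgate_supp_lift:
  assumes "h \<in> set (lift_gate D g)"
  shows "fst ` rgate_supp h = fst g"
proof -
  from assms obtain i where "h = (section_at D (SOME c. c \<in> fst g) i, g)" by (auto simp: lift_gate_def)
  then have "rgate_supp h = section_at D (SOME c. c \<in> fst g) i ` fst g" by (cases g) simp
  then show ?thesis by (simp add: image_image)
qed

lemma rlayer_ok_lift:
  assumes "layer_ok D L" "enat (Suc (2 * D)) < girth G"
  shows "rlayer_ok (lift_layer D L)"
  using assms(1)
proof (induction L)
  case Nil
  then show ?case by (simp add: lift_layer_def rlayer_ok_def)
next
  case (Cons g L)
  have L: "layer_ok D L" "gate_ok D g" "\<And>h. h \<in> set L \<Longrightarrow> fst g \<inter> fst h = {}"
    using Cons.prems by (auto simp: layer_ok_def)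
  have fin: "finite (fst g)"
    using L(2) finite_one_cells finite_subset by (auto simp: gate_ok_def)
  have "rgate_supp h \<inter> rgate_supp k = {}" if "h \<in> set (lift_gate D g)" "k \<in> set (lift_layer D L)" for h k
  proof -
    from that(2) obtain g' where "g' \<in> set L" "k \<in> set (lift_gate D g')" by (auto simp: lift_layer_def)
    with rgate_supp_lift[OF that(1)] rgate_supp_lift[of k D g'] L(3)[of g'] show ?thesis by blast
  qed
  moreover have "sorted_wrt (\<lambda>h k. rgate_supp h \<inter> rgate_supp k = {}) (lift_gate D g)"
    unfolding lift_gate_def sorted_wrt_map
  proof (rule sorted_wrt_mono_rel[OF _ sorted_wrt_upt])
    fix i j :: nat
    have "rgate_supp (section_at D (SOME c. c \<in> fst g) i, g) = section_at D (SOME c. c \<in> fst g) i ` fst g" for i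
      by (cases g) simp
    moreover assume "i \<in> set [0..<N]" "j \<in> set [0..<N]" "i < j"
    ultimately show "rgate_supp (section_at D (SOME c. c \<in> fst g) i, g) \<inter> rgate_supp (section_at D (SOME c. c \<in> fst g) j, g) = {}"
      using lift_gate_disjoint[OF L(2) _ _ _ assms(2), of i j] by simp
  qed
  moreover have "rgate_ok h" if "h \<in> set (lift_gate D g)" for h
    using that L(2) fin by (cases g) (auto simp: lift_gate_def gate_ok_def inj_section_at)
  moreover have "lift_layer D (g # L) = lift_gate D g @ lift_layer D L" by (simp add: lift_layer_def)
  ultimately show ?case
    using Cons.IH[OF L(1)] by (auto simp: rlayer_ok_def sorted_wrt_append)
qed

lemma filter_upt_unique:
  assumes "i < n" "P i" "\<And>j. j < n \<Longrightarrow> P j \<Longrightarrow> j = i"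
  shows "filter P [0..<n] = [i]"
proof -
  have "[0..<n] = [0..<i] @ i # [Suc i..<n]"
    using assms(1) by (metis le_add_diff_inverse less_imp_le_nat upt_add_eq_append upt_conv_Cons zero_le)
  moreover have "\<not> P j" if "j < n" "j \<noteq> i" for j
    using assms(3) that by blast
  then have "filter P [0..<i] = []" "filter P [Suc i..<n] = []"
    using assms(1) by (auto simp: filter_empty_conv)
  ultimately show ?thesis using assms(2) by simp
qed

text \<open>If a gate meets \<open>T\<close>, exactly one of its copies meets the lifted
  \<open>T\<close>: the one through the lift of its base cell that the section selects. Agreement at
  one cell extends to the entire support, because two different lifts of a cell would otherwise be
  joined by a chain of \<open>2 * M + 2 * D\<close> steps.\<close>

lemma lift_gate_agree:
  assumes "gate_ok D g" "c0 \<in> one_cells G" "i0 < N" "enat (Suc (2 * M + 2 * D)) < girth G"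
    and "\<And>c. c \<in> T \<Longrightarrow> near M (cell_touch G) c0 c"
    and "fst g \<inter> T \<noteq> {} \<Longrightarrow> \<forall>c\<in>fst g. near M (cell_touch G) c0 c"
  shows "list_all2 (rgate_agree (section_at M c0 i0))
    (filter (\<lambda>h. rgate_supp h \<inter> section_at M c0 i0 ` T \<noteq> {}) (lift_gate D g)) (if fst g \<inter> T \<noteq> {} then [g] else [])"
proof (cases "fst g \<inter> T = {}")
  case True
  have "rgate_supp h \<inter> section_at M c0 i0 ` T = {}" if "h \<in> set (lift_gate D g)" for h
  proof -
    have "fst ` rgate_supp h \<inter> fst ` section_at M c0 i0 ` T = {}"
      using rgate_supp_lift[OF that] True by (simp add: image_image)
    then show ?thesis by blast
  qed
  with True show ?thesis by (simp add: filter_empty_conv)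
next
  case False
  then obtain t where t: "t \<in> fst g" "t \<in> T" by blast
  let ?b = "SOME c. c \<in> fst g"
  let ?s = "section_at M c0 i0" and ?l = "\<lambda>i. section_at D ?b i"
  have b: "?b \<in> fst g" using t(1) by (rule someI)
  have sec: "near M ltouch (c0, i0) (?s c)" "?s c \<in> lcells" if "c \<in> fst g" for c
  proof -
    show w: "near M ltouch (c0, i0) (?s c)" using section_at_near assms(3,6) False that by auto
    show "?s c \<in> lcells" using near_lcells[OF w] assms(2,3) by (simp add: lcells_def)
  qed
  have eq: "?l i c = ?s c" if "?l i c' = ?s c'" "c \<in> fst g" "c' \<in> fst g" "i < N" for i c c'
  proof -
    have "near (D + D) ltouch (?l i c) (?l i c')"
      using near_from_common[OF sym_ltouch lift_gate_supp(1)[OF assms(1) that(4,2)] lift_gate_supp(1)[OF assms(1) that(4,3)]] .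
    moreover have "near (M + M) ltouch (?s c') (?s c)"
      using near_from_common[OF sym_ltouch sec(1)[OF that(3)] sec(1)[OF that(2)]] .
    ultimately have "near ((D + D) + (M + M)) ltouch (?l i c) (?s c)"
      unfolding that(1) by (rule near_trans)
    then have "snd (?l i c) = snd (?s c)"
      using lift_unique[of _ c "snd (?l i c)" "snd (?s c)"] lift_gate_supp(2)[OF assms(1) that(4,2)] assms(4)
      by (auto simp: section_at_def lcells_def mult_2 add_ac)
    then show ?thesis by (simp add: section_at_def)
  qed
  define i1 where "i1 = snd (?s ?b)"
  have i1: "i1 < N" using sec(2)[OF b] by (auto simp: i1_def section_at_def lcells_def)
  have "?l i1 ?b = (?b, i1)"
    by (rule section_at_eqI[of 0]) (use b assms(1,4) i1 order.strict_trans1[of "enat (Suc (2 * D))" "enat (Suc (2 * M + 2 * D))"] in \<open>auto simp: gate_ok_def\<close>)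
  then have l1: "?l i1 ?b = ?s ?b" by (simp add: i1_def section_at_def)
  have act: "?l i ` fst g \<inter> ?s ` T \<noteq> {} \<longleftrightarrow> i = i1" if "i < N" for i
  proof
    assume "i = i1"
    then have "?l i t = ?s t" using eq[OF l1 t(1) b i1] by simp
    then show "?l i ` fst g \<inter> ?s ` T \<noteq> {}" using t by blast
  next
    assume "?l i ` fst g \<inter> ?s ` T \<noteq> {}"
    from images_meet[OF this] obtain c c' where "c \<in> fst g" "c' \<in> T" "?l i c = ?s c'" by blast
    moreover from this have "c = c'" by (simp add: section_at_def)
    ultimately have "?l i ?b = ?s ?b" using eq[of i c ?b] b that by blast
    moreover have "?l i ?b = (?b, i)"
      by (rule section_at_eqI[of 0]) (use b assms(1,4) that order.strict_trans1[of "enat (Suc (2 * D))" "enat (Suc (2 * M + 2 * D))"] in \<open>auto simp: gate_ok_def\<close>)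
    ultimately show "i = i1" by (simp add: i1_def section_at_def)
  qed
  have "filter (\<lambda>h. rgate_supp h \<inter> ?s ` T \<noteq> {}) (lift_gate D g) = map (\<lambda>i. (?l i, g)) (filter (\<lambda>i. ?l i ` fst g \<inter> ?s ` T \<noteq> {}) [0..<N])"
    unfolding lift_gate_def filter_map by (cases g) (simp add: o_def)
  also have "filter (\<lambda>i. ?l i ` fst g \<inter> ?s ` T \<noteq> {}) [0..<N] = [i1]"
    by (rule filter_upt_unique) (use act i1 in auto)
  finally show ?thesis
    using False eq[OF l1 _ b i1] by (cases g) simp
qed

lemma lift_layer_agree:
  assumes "layer_ok D L" "c0 \<in> one_cells G" "i0 < N" "enat (Suc (2 * M + 2 * D)) < girth G"
    and "\<And>c. c \<in> T \<Longrightarrow> near M (cell_touch G) c0 c"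
    and "\<And>g. g \<in> set L \<Longrightarrow> fst g \<inter> T \<noteq> {} \<Longrightarrow> \<forall>c\<in>fst g. near M (cell_touch G) c0 c"
  shows "list_all2 (rgate_agree (section_at M c0 i0))
    (filter (\<lambda>h. rgate_supp h \<inter> section_at M c0 i0 ` T \<noteq> {}) (lift_layer D L)) (filter (\<lambda>g. fst g \<inter> T \<noteq> {}) L)"
  using assms(1,6)
proof (induction L)
  case Nil
  then show ?case by (simp add: lift_layer_def)
next
  case (Cons g L)
  have "lift_layer D (g # L) = lift_gate D g @ lift_layer D L" by (simp add: lift_layer_def)
  moreover have "filter (\<lambda>g. fst g \<inter> T \<noteq> {}) (g # L) = (if fst g \<inter> T \<noteq> {} then [g] else []) @ filter (\<lambda>g. fst g \<inter> T \<noteq> {}) L"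
    by simp
  moreover have L: "layer_ok D L" "gate_ok D g" using Cons.prems(1) by (auto simp: layer_ok_def)
  have "list_all2 (rgate_agree (section_at M c0 i0))
    (filter (\<lambda>h. rgate_supp h \<inter> section_at M c0 i0 ` T \<noteq> {}) (lift_layer D L)) (filter (\<lambda>g. fst g \<inter> T \<noteq> {}) L)"
    by (rule Cons.IH) (use Cons.prems L in auto)
  moreover have "list_all2 (rgate_agree (section_at M c0 i0))
    (filter (\<lambda>h. rgate_supp h \<inter> section_at M c0 i0 ` T \<noteq> {}) (lift_gate D g)) (if fst g \<inter> T \<noteq> {} then [g] else [])"
    by (rule lift_gate_agree[OF L(2) assms(2-5)]) (use Cons.prems(2)[of g] in auto)
  ultimately show ?case
    by (simp only: filter_append list_all2_appendI)
qed

end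

section \<open>Local expectation values of the lifted state\<close>

lemma circuit_op_as_rcircuit:
  fixes U :: "'c circuit"
  shows "circuit_op U = rcircuit_op (map (map (Pair id)) U)"
proof -
  have g: "gate_op g = rgate_op (id, g)" for g :: "'c gate"
    by (cases g) (simp add: gate_op_def act_on_eq_relabelled)
  have l: "layer_op L = rlayer_op (map (Pair id) L)" for L :: "'c gate list"
    by (induction L) (simp_all add: layer_op_def rlayer_op_def g id_def)
  show ?thesis
    by (induction U) (simp_all add: circuit_op_def rcircuit_op_def l id_def)
qed

lemma rgate_pair:
  "rgate_supp (\<kappa>, g) = \<kappa> ` fst g"
  "rgate_ok (\<kappa>, g) \<longleftrightarrow> finite (fst g) \<and> inj_on \<kappa> (fst g) \<and> unitary_matrix_on (fst g) (snd g)"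
  by (cases g; simp)+

lemma list_all2_agree_id:
  "list_all2 (rgate_agree id) (filter (\<lambda>h. rgate_supp h \<inter> id ` T \<noteq> {}) (map (Pair id) L)) (filter (\<lambda>g. fst g \<inter> T \<noteq> {}) L)"
proof (induction L)
  case (Cons g L)
  then show ?case by (cases g) auto
qed simp

text \<open>The girth has to exceed every closed walk met below; the longest, of length up to
  \<open>8 * R + 5\<close>, occur next to a strip of flipped cells.\<close>

locale lifted_circuit = covering G N pf for G :: "'v pair_pre_digraph" and N pf +
  fixes U :: "'v one_cell circuit" and D :: nat and R :: nat
  assumes U: "\<And>L. L \<in> set U \<Longrightarrow> layer_ok D L" and range: "length U * D \<le> R" and DR: "D \<le> R"
    and girth: "enat (20 * R + 40) < girth G"
begin

definition ground :: "'v one_cell amplitudes" where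
  "ground = circuit_op U vacuum"

definition lifted_layers :: "('v one_cell, 'v one_cell \<times> nat) rgate list list" where
  "lifted_layers = map (lift_layer D) U"

definition lifted :: "('v one_cell \<times> nat) amplitudes" where
  "lifted = rcircuit_op lifted_layers vacuum"

definition lstar :: "'v \<times> ('v \<times> nat) \<Rightarrow> ('v one_cell \<times> nat) set" where
  "lstar s = {c \<in> lcells. s \<in> lboundary c}"

definition lface :: "'v set \<Rightarrow> 'v set \<Rightarrow> nat \<Rightarrow> ('v one_cell \<times> nat) set" where
  "lface e f i = {(EV e (edge_tail G f), i), (EV e (edge_head G f), pf f i)} \<union> (\<lambda>x. (VE x f, i)) ` e"

lemma girth_less: "k \<le> 20 * R + 40 \<Longrightarrow> enat k < girth G"
  using girth order.strict_trans1[of "enat k" "enat (20 * R + 40)" "girth G"] by simp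

lemma rlayer_ok_id: "layer_ok D L \<Longrightarrow> rlayer_ok (map (Pair id) L)"
proof -
  assume L: "layer_ok D L"
  have "rgate_ok (id, g)" if "g \<in> set L" for g
    using that L finite_subset[OF _ finite_one_cells] by (simp add: layer_ok_def gate_ok_def rgate_pair)
  then show ?thesis using L by (auto simp: rlayer_ok_def layer_ok_def sorted_wrt_map rgate_pair)
qed

lemma lifted_layers_ok:
  assumes "L \<in> set lifted_layers"
  shows "rlayer_ok L" "\<And>g. g \<in> set L \<Longrightarrow> rgate_supp g \<subseteq> lcells"
    "\<And>g c c'. g \<in> set L \<Longrightarrow> c \<in> rgate_supp g \<Longrightarrow> c' \<in> rgate_supp g \<Longrightarrow> near (2 * D) ltouch c c'"
proof -
  obtain L' where L': "L' \<in> set U" "L = lift_layer D L'" using assms by (auto simp: lifted_layers_def)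
  show "rlayer_ok L"
    unfolding L' by (rule rlayer_ok_lift[OF U[OF L'(1)] girth_less]) (use DR in simp)
  fix g assume "g \<in> set L"
  then obtain h i where h: "h \<in> set L'" "i < N" "g = (section_at D (SOME c. c \<in> fst h) i, h)"
    by (auto simp: L' lift_layer_def lift_gate_def)
  then have s: "rgate_supp g = section_at D (SOME c. c \<in> fst h) i ` fst h" by (simp add: rgate_pair)
  have ok: "gate_ok D h" using U[OF L'(1)] h by (auto simp: layer_ok_def)
  show "rgate_supp g \<subseteq> lcells"
    unfolding s using lift_gate_supp(2)[OF ok h(2)] by blast
  fix c c' assume "c \<in> rgate_supp g" "c' \<in> rgate_supp g"
  then show "near (2 * D) ltouch c c'"
    unfolding s mult_2 using near_from_common[OF sym_ltouch lift_gate_supp(1)[OF ok h(2)] lift_gate_supp(1)[OF ok h(2)]] by blast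
qed

lemma lifted_preserves:
  shows "qinner lcells (rcircuit_op lifted_layers \<phi>) (rcircuit_op lifted_layers \<chi>) = qinner lcells \<phi> \<chi>"
    and "\<chi> \<in> qubit_space lcells \<Longrightarrow> rcircuit_op lifted_layers \<chi> \<in> qubit_space lcells"
    and "rcircuit_op lifted_layers \<phi> = rcircuit_op lifted_layers \<chi> \<Longrightarrow> \<phi> = \<chi>"
  using rcircuit_op_preserves[OF _ finite_lcells, of lifted_layers] lifted_layers_ok(1,2) by blast+

lemma qinner_lifted: "qinner lcells lifted lifted = 1"
  unfolding lifted_def lifted_preserves(1) by (simp add: qinner_vacuum finite_lcells vacuum_def)

lemma lifted_in_qubit_space: "lifted \<in> qubit_space lcells"
  unfolding lifted_def by (rule lifted_preserves(2)) (rule vacuum_in_qubit_space)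

lemma ground_preserves:
  "qinner (one_cells G) (circuit_op U \<phi>) (circuit_op U \<chi>) = qinner (one_cells G) \<phi> \<chi>"
proof -
  have "rlayer_ok L \<and> (\<forall>g\<in>set L. rgate_supp g \<subseteq> one_cells G)" if L: "L \<in> set (map (map (Pair id)) U)" for L
  proof -
    obtain L' where L': "L' \<in> set U" "L = map (Pair id) L'" using L by auto
    then have "\<forall>g\<in>set L'. fst g \<subseteq> one_cells G" using U by (auto simp: layer_ok_def gate_ok_def)
    then show ?thesis using rlayer_ok_id[OF U[OF L'(1)]] by (simp add: L'(2) rgate_pair)
  qed
  then show ?thesis
    unfolding circuit_op_as_rcircuit by (intro rcircuit_op_preserves(1) finite_one_cells) blast
qed

text \<open>Pulled through the circuits, both operators become the same matrix \<open>u'\<close>,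
  and both sides equal \<open>u' {} {}\<close>. Radius 2 around one of its cells holds every star
  and the boundary of every square; the circuit adds at most \<open>R\<close>.\<close>

lemma expectation_lift:
  assumes "c0 \<in> one_cells G" "i0 < N" "\<And>c. c \<in> T \<Longrightarrow> near 2 (cell_touch G) c0 c"
  shows "qinner lcells lifted (relabelled_op (section_at (2 + R) c0 i0) T u lifted) =
         qinner (one_cells G) ground (act_on T u ground)"
proof -
  define Y where "Y k = {c. near (2 + k * D) (cell_touch G) c0 c}" for k
  have Yc: "Y k \<subseteq> one_cells G" for k
  proof
    fix c assume "c \<in> Y k"
    then have "near (2 + k * D) (cell_touch G) c0 c" by (simp add: Y_def)
    then show "c \<in> one_cells G"
      by (rule near_invariant[where P = "\<lambda>c. c \<in> one_cells G"]) (use assms(1) in \<open>auto simp: cell_touch_def\<close>)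
  qed
  have Yf: "finite (Y k)" for k using Yc finite_one_cells finite_subset by blast
  have Ym: "Y k \<subseteq> Y (Suc k)" for k
  proof
    fix c assume "c \<in> Y k"
    then have "near (2 + k * D) (cell_touch G) c0 c" by (simp add: Y_def)
    from near_mono[OF this, of "2 + Suc k * D"] show "c \<in> Y (Suc k)" by (simp add: Y_def)
  qed
  have spread: "fst g \<subseteq> Y (Suc k)" if "L \<in> set U" "g \<in> set L" "fst g \<inter> Y k \<noteq> {}" for L g k
  proof
    fix c assume "c \<in> fst g"
    from that(3) obtain c' where "c' \<in> fst g" and c': "near (2 + k * D) (cell_touch G) c0 c'" by (auto simp: Y_def)
    have "near D (cell_touch G) c' c"
      using U[OF that(1)] that(2) \<open>c \<in> fst g\<close> \<open>c' \<in> fst g\<close> by (auto simp: layer_ok_def gate_ok_def)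
    from near_trans[OF c' this] have "near ((2 + k * D) + D) (cell_touch G) c0 c" .
    then show "c \<in> Y (Suc k)" by (simp add: Y_def add_ac)
  qed
  have "\<exists>T' u'. T' \<subseteq> Y (0 + length U) \<and>
     (\<forall>\<psi>. relabelled_op id T u (rcircuit_op (map (map (Pair id)) U) \<psi>) =
        rcircuit_op (map (map (Pair id)) U) (relabelled_op id T' u' \<psi>)) \<and>
     (\<forall>\<psi>. relabelled_op (section_at (2 + R) c0 i0) T u (rcircuit_op lifted_layers \<psi>) =
        rcircuit_op lifted_layers (relabelled_op (section_at (2 + R) c0 i0) T' u' \<psi>))"
  proof (rule rcircuit_op_heisenberg[where Y = Y])
    show "fst g \<subseteq> Y (Suc k)" if "L \<in> set U" "g \<in> set L" "fst g \<inter> Y k \<noteq> {}" for L g k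
      using that by (rule spread)
  next
    fix j j' T
    assume jj: "j < length U" "j' < 0 + length U" "T \<subseteq> Y j'"
    have le: "2 + Suc j' * D \<le> 2 + R"
      using range mult_le_mono1[of "Suc j'" "length U" D] jj(2) by linarith
    have n: "near (2 + R) (cell_touch G) c0 c" if "c \<in> Y (Suc j')" for c
      using that near_mono[of "2 + Suc j' * D" "cell_touch G" c0 c, OF _ le] by (simp add: Y_def)
    have j: "U ! j \<in> set U" using jj(1) by simp
    have "list_all2 (rgate_agree (section_at (2 + R) c0 i0))
      (filter (\<lambda>h. rgate_supp h \<inter> section_at (2 + R) c0 i0 ` T \<noteq> {}) (lift_layer D (U ! j))) (filter (\<lambda>g. fst g \<inter> T \<noteq> {}) (U ! j))"
    proof (rule lift_layer_agree[OF U[OF j] assms(1,2)])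
      show "enat (Suc (2 * (2 + R) + 2 * D)) < girth G" by (rule girth_less) (use DR in simp)
      show "near (2 + R) (cell_touch G) c0 c" if "c \<in> T" for c using that n jj(3) Ym by blast
      show "\<forall>c\<in>fst g. near (2 + R) (cell_touch G) c0 c" if "g \<in> set (U ! j)" "fst g \<inter> T \<noteq> {}" for g
        using spread[OF j that(1), of j'] that(2) jj(3) n by blast
    qed
    then show "list_all2 (rgate_agree id) (filter (\<lambda>g. rgate_supp g \<inter> id ` T \<noteq> {}) (map (map (Pair id)) U ! j))
          (filter (\<lambda>g. fst g \<inter> T \<noteq> {}) (U ! j)) \<and>
        list_all2 (rgate_agree (section_at (2 + R) c0 i0))
          (filter (\<lambda>h. rgate_supp h \<inter> section_at (2 + R) c0 i0 ` T \<noteq> {}) (lifted_layers ! j)) (filter (\<lambda>g. fst g \<inter> T \<noteq> {}) (U ! j))"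
      using jj(1) list_all2_agree_id[of T "U ! j"] by (simp add: lifted_layers_def)
  next
    show "rlayer_ok L" if "L \<in> set (map (map (Pair id)) U)" for L
      using that rlayer_ok_id U by auto
    show "T \<subseteq> Y 0" using assms(3) by (auto simp: Y_def)
  qed (use lifted_layers_ok(1) inj_section_at Yf Ym in \<open>simp_all add: lifted_layers_def\<close>)
  then obtain T' u' where T': "T' \<subseteq> Y (length U)"
     and 1: "\<forall>\<psi>. relabelled_op id T u (circuit_op U \<psi>) = circuit_op U (relabelled_op id T' u' \<psi>)"
     and 2: "\<forall>\<psi>. relabelled_op (section_at (2 + R) c0 i0) T u (rcircuit_op lifted_layers \<psi>) =
        rcircuit_op lifted_layers (relabelled_op (section_at (2 + R) c0 i0) T' u' \<psi>)"
    by (auto simp: circuit_op_as_rcircuit)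
  have "finite T'" using T' Yf finite_subset by blast
  then show ?thesis
    unfolding lifted_def ground_def act_on_eq_relabelled 1[rule_format] 2[rule_format]
      lifted_preserves(1) ground_preserves
    by (simp only: qinner_vacuum finite_lcells finite_one_cells relabelled_op_vacuum)
qed

text \<open>A flip is unitary, so invariance is the case of equality in the Cauchy-Schwarz
  inequality, that is, expectation value 1. In this form it is local and passes to the
  covering.\<close>

lemma lifted_star_invariant:
  assumes "x \<in> pverts G" "v \<in> pverts G" "i < N" "toric_A G (x, v) ground = ground"
  shows "flip_op (lstar (x, (v, i))) lifted = lifted"
proof (cases "{c \<in> one_cells G. (x, v) \<in> boundary1 c} = {}")
  case True
  then have "lstar (x, (v, i)) = {}"
    using ltouch_boundary1 by (fastforce simp: lstar_def lcells_def)
  then show ?thesis by (simp add: flip_op_def fun_eq_iff)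
next
  case False
  define T where "T = {c \<in> one_cells G. (x, v) \<in> boundary1 c}"
  have finT: "finite T" using finite_one_cells by (auto simp: T_def)
  obtain c0 where c0: "c0 \<in> one_cells G" "(x, v) \<in> boundary1 c0" using False by blast
  then obtain i0 where i0: "i0 < N" "(x, (v, i)) \<in> lboundary (c0, i0)"
    using lboundary_exists[OF c0(2,1) assms(3)] by blast
  let ?s = "section_at (2 + R) c0 i0"
  have g: "enat (Suc (2 * (2 + R))) < girth G" by (rule girth_less) simp
  have near1: "?s c = (c, j)" if "(c, j) \<in> lstar (x, (v, i))" for c j
  proof (rule section_at_eqI[OF _ _ c0(1) i0(1) g])
    have "((c0, i0), (c, j)) \<in> ltouch"
      using that i0 c0 by (auto simp: ltouch_def lstar_def lcells_def)
    then show "near 1 ltouch (c0, i0) (c, j)" using near_step[of _ _ _ 0] by simp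
  qed simp
  have img: "?s ` T = lstar (x, (v, i))"
  proof (intro subset_antisym subsetI)
    fix p assume "p \<in> ?s ` T"
    then obtain c where c: "c \<in> T" "p = ?s c" by (rule imageE) simp
    then obtain j where "j < N" "(x, (v, i)) \<in> lboundary (c, j)"
      using lboundary_exists[of x v c i] assms(3) by (auto simp: T_def)
    then have "(c, j) \<in> lstar (x, (v, i))" using c by (auto simp: lstar_def lcells_def T_def)
    with near1[OF this] c show "p \<in> lstar (x, (v, i))" by simp
  next
    fix p assume p: "p \<in> lstar (x, (v, i))"
    obtain c j where pc: "p = (c, j)" by (cases p)
    then have "c \<in> T" using p ltouch_boundary1 by (auto simp: lstar_def lcells_def T_def)
    with near1[of c j] p pc show "p \<in> ?s ` T" by force
  qed
  have T2: "near 2 (cell_touch G) c0 c" if "c \<in> T" for c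
  proof -
    have "(c0, c) \<in> cell_touch G" using that c0 by (auto simp: cell_touch_def T_def)
    then show ?thesis using near_step[of _ _ _ 1] by (simp add: numeral_2_eq_2)
  qed
  have "relabelled_op id T (flip_mat T) = toric_A G (x, v)"
    using relabelled_flip[OF finT, of id] op_prod_pauli_x[OF finT] by (simp add: toric_A_def T_def)
  then have "qinner (one_cells G) ground (act_on T (flip_mat T) ground) = 1"
    using assms(4) ground_preserves[of vacuum vacuum] finite_one_cells
    by (simp add: act_on_eq_relabelled ground_def qinner_vacuum vacuum_def)
  then have q: "qinner lcells lifted (flip_op (lstar (x, (v, i))) lifted) = 1"
    using expectation_lift[OF c0(1) i0(1) T2, of T "flip_mat T"] relabelled_flip[OF finT inj_section_at] img by simp
  let ?f = "flip_op (lstar (x, (v, i))) lifted"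
  have sub: "lstar (x, (v, i)) \<subseteq> lcells" by (auto simp: lstar_def)
  have "?f \<sigma> = 0" if "\<not> \<sigma> \<subseteq> lcells" for \<sigma>
  proof -
    have "\<not> sym_diff \<sigma> (lstar (x, (v, i))) \<subseteq> lcells" using sub that by blast
    from qubit_spaceD[OF lifted_in_qubit_space this] show ?thesis by (simp only: flip_op_def)
  qed
  then have mem: "?f \<in> qubit_space lcells" by (simp add: qubit_space_def)
  have nf: "qinner lcells ?f ?f = 1"
  proof -
    have "qinner lcells ?f ?f = qinner lcells lifted lifted"
      unfolding qinner_def flip_op_def
      by (rule sum.reindex_bij_witness[where i = "\<lambda>\<sigma>. sym_diff \<sigma> (lstar (x, (v, i)))" and j = "\<lambda>\<sigma>. sym_diff \<sigma> (lstar (x, (v, i)))"])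
        (use sub in auto)
    then show ?thesis by (simp add: qinner_lifted)
  qed
  have "(\<Sum>\<sigma>\<in>Pow lcells. (cmod (?f \<sigma> - lifted \<sigma>))\<^sup>2) = 0"
  proof -
    have "complex_of_real (\<Sum>\<sigma>\<in>Pow lcells. (cmod (?f \<sigma> - lifted \<sigma>))\<^sup>2) =
      qinner lcells ?f ?f + qinner lcells lifted lifted - qinner lcells lifted ?f - cnj (qinner lcells lifted ?f)"
      unfolding qinner_def of_real_sum complex_norm_square cnj_sum sum.distrib[symmetric] sum_subtractf[symmetric]
      by (intro sum.cong refl) (simp add: algebra_simps)
    also have "\<dots> = 0" by (simp add: q nf qinner_lifted)
    finally show ?thesis using of_real_eq_0_iff by blast
  qed
  then have "\<forall>\<sigma>\<in>Pow lcells. ?f \<sigma> = lifted \<sigma>"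
    using sum_nonneg_eq_0_iff[of "Pow lcells" "\<lambda>\<sigma>. (cmod (?f \<sigma> - lifted \<sigma>))\<^sup>2"] finite_lcells by simp
  moreover have "?f \<sigma> = lifted \<sigma>" if "\<not> \<sigma> \<subseteq> lcells" for \<sigma>
    using qubit_spaceD[OF mem that] qubit_spaceD[OF lifted_in_qubit_space that] by simp
  ultimately show ?thesis by blast
qed

lemma lifted_face_expectation:
  assumes "e \<in> uedges G" "f \<in> uedges G" "i < N"
  shows "qinner lcells lifted (sign_op (lface e f i) lifted) =
         qinner (one_cells G) ground (toric_Bp (e, f) ground)"
proof -
  let ?a = "edge_tail G f" and ?b = "edge_head G f"
  note f = edge_ends[OF assms(2)] edge_ends'[OF assms(2)]
  obtain x where x: "x \<in> e" using edge_ends(1)[OF assms(1)] by blast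
  have ev: "e \<subseteq> pverts G" using assms(1) parcs_D by (auto simp: uedges_def)
  have fine: "finite e" using ev finite_pverts finite_subset by blast
  define T where "T = boundary2 (e, f)"
  have T: "T = {EV e ?a, EV e ?b} \<union> (\<lambda>x. VE x f) ` e"
  proof -
    have "EV e ` f = EV e ` {?a, ?b}" using f(1) by (rule arg_cong)
    moreover have "T = EV e ` f \<union> (\<lambda>x. VE x f) ` e" unfolding T_def by auto
    ultimately show ?thesis by simp
  qed
  have finT: "finite T" unfolding T using fine by simp
  let ?s = "section_at (2 + R) (VE x f) i"
  have c0: "VE x f \<in> one_cells G" using x ev assms(2) by (auto simp: one_cells_def)
  have cells: "(VE y f, i) \<in> lcells" "(EV e ?a, i) \<in> lcells" "(EV e ?b, pf f i) \<in> lcells" if "y \<in> e" for y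
    using that ev assms f pf_less by (auto simp: lcells_def one_cells_def)
  have t1: "((VE y f, i), (EV e ?a, i)) \<in> ltouch" "((VE y f, i), (EV e ?b, pf f i)) \<in> ltouch" if "y \<in> e" for y
    using cells that by (auto simp: ltouch_def)
  have n1: "near 1 ltouch (VE x f, i) (EV e ?a, i)" "near 1 ltouch (VE x f, i) (EV e ?b, pf f i)"
    using t1[OF x] near_step[of _ _ _ 0] by auto
  have n2: "near 2 ltouch (VE x f, i) (VE y f, i)" if "y \<in> e" for y
  proof -
    have "near 1 ltouch (VE y f, i) (EV e ?a, i)" using t1[OF that] near_step[of _ _ _ 0] by auto
    from near_to_common[OF sym_ltouch n1(1) this] show ?thesis by (simp add: numeral_2_eq_2)
  qed
  have g: "enat (Suc (2 * (2 + R))) < girth G" by (rule girth_less) simp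
  note sec = section_at_eqI[OF _ _ c0 assms(3) g]
  have s: "?s (EV e ?a) = (EV e ?a, i)" "?s (EV e ?b) = (EV e ?b, pf f i)" "\<And>y. y \<in> e \<Longrightarrow> ?s (VE y f) = (VE y f, i)"
    using sec[OF n1(1)] sec[OF n1(2)] sec[OF n2] by simp_all
  have img: "?s ` T = lface e f i"
    unfolding T lface_def image_Un image_insert image_image using s by simp
  have T2: "near 2 (cell_touch G) (VE x f) c" if "c \<in> T" for c
    using that near_project[OF near_mono[OF n1(1), of 2]] near_project[OF near_mono[OF n1(2), of 2]] near_project[OF n2]
    by (auto simp: T)
  have "relabelled_op id T sign_mat = toric_Bp (e, f)"
    using relabelled_sign[OF finT, of id] op_prod_pauli_z[OF finT] by (simp add: toric_Bp_def T_def)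
  then show ?thesis
    using expectation_lift[OF c0 assms(3) T2, of T sign_mat] relabelled_sign[OF finT inj_section_at] img
    by (simp add: act_on_eq_relabelled)
qed

end

section \<open>Independence of distant sheets by anticommuting operators\<close>

lemma neg_one_power_card_sym_diff:
  assumes "finite A" "finite B"
  shows "(-1 :: 'r :: ring_1) ^ card (sym_diff A B) = (-1) ^ card A * (-1) ^ card B"
proof -
  have "card (sym_diff A B) + 2 * card (A \<inter> B) = card A + card B"
  proof -
    have "card (sym_diff A B) = card (A - B) + card (B - A)"
      using assms by (intro card_Un_disjoint) auto
    moreover have "card A = card (A - B) + card (A \<inter> B)" "card B = card (B - A) + card (A \<inter> B)"
      using card_Diff_subset_Int[of A B] card_Diff_subset_Int[of B A] assms card_mono[of A "A \<inter> B"] card_mono[of B "A \<inter> B"]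
      by (simp_all add: Int_commute)
    ultimately show ?thesis by simp
  qed
  then have "(-1 :: 'r) ^ (card (sym_diff A B) + 2 * card (A \<inter> B)) = (-1) ^ (card A + card B)" by simp
  then show ?thesis by (simp add: power_add power_mult)
qed

lemma sign_flip_anticommute:
  assumes "finite S" "odd (card (S \<inter> T))"
  shows "sign_op S (flip_op T \<psi>) = (\<lambda>\<sigma>. - flip_op T (sign_op S \<psi>) \<sigma>)"
proof
  fix \<sigma>
  have "S \<inter> sym_diff \<sigma> T = sym_diff (S \<inter> \<sigma>) (S \<inter> T)" by auto
  then have "(-1 :: complex) ^ card (S \<inter> sym_diff \<sigma> T) = - ((-1) ^ card (S \<inter> \<sigma>))"
    using neg_one_power_card_sym_diff[of "S \<inter> \<sigma>" "S \<inter> T", where 'r = complex] assms by simp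
  then show "sign_op S (flip_op T \<psi>) \<sigma> = - flip_op T (sign_op S \<psi>) \<sigma>"
    by (simp add: sign_op_def flip_op_def)
qed

lemma flip_op_sym_diff: "flip_op (sym_diff A B) \<psi> = flip_op A (flip_op B \<psi>)"
proof
  fix \<sigma>
  have "sym_diff \<sigma> (sym_diff A B) = sym_diff (sym_diff \<sigma> A) B" by auto
  then show "flip_op (sym_diff A B) \<psi> \<sigma> = flip_op A (flip_op B \<psi>) \<sigma>" by (simp only: flip_op_def)
qed

lemma qinner_flip:
  assumes "T \<subseteq> C"
  shows "qinner C (flip_op T \<phi>) (flip_op T \<psi>) = qinner C \<phi> \<psi>"
  unfolding qinner_def flip_op_def
  by (rule sum.reindex_bij_witness[where i = "\<lambda>\<sigma>. sym_diff \<sigma> T" and j = "\<lambda>\<sigma>. sym_diff \<sigma> T"])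
    (use assms in auto)

lemma local_op_vacuum:
  assumes "local_op T O'" "O' vacuum \<sigma> \<noteq> 0"
  shows "\<sigma> \<subseteq> T"
proof (rule ccontr)
  assume "\<not> \<sigma> \<subseteq> T"
  then have "vacuum (\<sigma> - T \<union> \<tau>) = 0" for \<tau> by (auto simp: vacuum_def)
  with assms show False by (auto simp: local_op_def act_on_def)
qed

text \<open>Where \<phi> does not vanish, all qubits of \<open>S\<close> are in the first basis
  state. Every other entry of \<open>W\<close> leads into or out of configurations that meet
  \<open>S\<close>, where \<phi> is 0.\<close>

lemma local_op_off_support:
  assumes "local_op S W" "finite C" "\<phi> \<in> qubit_space C" "\<And>\<sigma>. \<phi> \<sigma> \<noteq> 0 \<Longrightarrow> \<sigma> \<inter> S = {}"
  shows "qinner C \<phi> (W \<phi>) = W vacuum {} * qinner C \<phi> \<phi>"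
proof -
  obtain w where w: "W = act_on S w" "finite S" using assms(1) by (auto simp: local_op_def)
  have "W \<phi> \<sigma> = w {} {} * \<phi> \<sigma>" if "\<phi> \<sigma> \<noteq> 0" for \<sigma>
  proof -
    have s: "\<sigma> \<inter> S = {}" using assms(4)[OF that] .
    have "\<phi> (\<sigma> - S \<union> \<tau>) = 0" if "\<tau> \<in> Pow S" "\<tau> \<noteq> {}" for \<tau>
      using assms(4)[of "\<sigma> - S \<union> \<tau>"] that by auto
    then have "W \<phi> \<sigma> = (\<Sum>\<tau>\<in>{{}}. w (\<sigma> \<inter> S) \<tau> * \<phi> (\<sigma> - S \<union> \<tau>))"
      unfolding w act_on_def using w(2) by (intro sum.mono_neutral_right) auto
    moreover have "\<sigma> - S = \<sigma>" using s by auto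
    ultimately show ?thesis by (simp add: s)
  qed
  then have *: "cnj (\<phi> \<sigma>) * W \<phi> \<sigma> = w {} {} * (cnj (\<phi> \<sigma>) * \<phi> \<sigma>)" for \<sigma>
    by (cases "\<phi> \<sigma> = 0") auto
  have "W vacuum {} = w {} {}"
    unfolding w act_on_eq_relabelled using w(2) by (rule relabelled_op_vacuum)
  then show ?thesis by (simp only: qinner_def sum_distrib_left *)
qed

lemma near_lift_arcs:
  assumes "near n A x y"
  shows "\<exists>t. near n (lift_arcs A \<pi>) (x, s) (y, t)"
proof -
  have "\<exists>t. ((x, s), (y, t)) \<in> lift_arcs A \<pi> ^^ k" if "(x, y) \<in> A ^^ k" for k
    using that
  proof (induction k arbitrary: y)
    case (Suc k)
    then obtain z where "(x, z) \<in> A ^^ k" "(z, y) \<in> A" by auto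
    with Suc.IH obtain t where "((x, s), (z, t)) \<in> lift_arcs A \<pi> ^^ k" by blast
    moreover have "((z, t), (y, \<pi> (z, y) t)) \<in> lift_arcs A \<pi>" using \<open>(z, y) \<in> A\<close> by (simp add: in_lift_arcs)
    ultimately show ?case by (blast intro: relpow_Suc_I)
  qed auto
  with assms show ?thesis by (fastforce simp: near_def)
qed

context lifted_circuit
begin

text \<open>The light cone of \<open>T\<close>. A lifted gate reaches at most \<open>D\<close> from
  the lift of its base cell, so two of its cells are up to \<open>2 * D\<close> apart; with
  \<open>length U * D \<le> R\<close> this adds up to \<open>2 * R\<close>.\<close>

definition nbhd :: "('v one_cell \<times> nat) set \<Rightarrow> ('v one_cell \<times> nat) set" where
  "nbhd T = {c \<in> lcells. \<exists>t\<in>T. near (2 * R) ltouch t c}"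

lemma local_op_lifted:
  assumes "local_op T O'" "T \<subseteq> lcells"
  shows "\<exists>O2. local_op (nbhd T) O2 \<and> (\<forall>\<psi>. O' (rcircuit_op lifted_layers \<psi>) = rcircuit_op lifted_layers (O2 \<psi>))"
proof -
  define Y where "Y k = {c \<in> lcells. \<exists>t\<in>T. near (k * (2 * D)) ltouch t c}" for k
  have f: "finite (Y k)" for k using finite_lcells by (simp add: Y_def)
  have m: "Y k \<subseteq> Y (Suc k)" for k
  proof
    fix c assume "c \<in> Y k"
    then obtain t where "t \<in> T" "near (k * (2 * D)) ltouch t c" "c \<in> lcells" by (auto simp: Y_def)
    with near_mono[OF this(2), of "Suc k * (2 * D)"] show "c \<in> Y (Suc k)" by (auto simp: Y_def)
  qed
  have T: "T \<subseteq> Y 0"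
  proof
    fix c assume "c \<in> T"
    moreover have "near (0 * (2 * D)) ltouch c c" by simp
    ultimately show "c \<in> Y 0" using assms(2) unfolding Y_def by blast
  qed
  have l0: "local_op (Y 0) O'" by (rule local_op_mono[OF assms(1) T f])
  have spread: "rgate_supp g \<subseteq> Y (Suc k)" if "L \<in> set lifted_layers" "g \<in> set L" "rgate_supp g \<inter> Y k \<noteq> {}" for L g k
  proof
    fix c assume c: "c \<in> rgate_supp g"
    from that(3) obtain c' t where c': "c' \<in> rgate_supp g" "t \<in> T" "near (k * (2 * D)) ltouch t c'" by (auto simp: Y_def)
    from near_trans[OF c'(3) lifted_layers_ok(3)[OF that(1,2) c'(1) c]]
    have "near (Suc k * (2 * D)) ltouch t c" by (simp add: add.commute)
    moreover have "c \<in> lcells" using lifted_layers_ok(2)[OF that(1,2)] c by blast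
    ultimately show "c \<in> Y (Suc k)" using c'(2) unfolding Y_def by blast
  qed
  have "\<exists>O2. local_op (Y (0 + length lifted_layers)) O2 \<and>
    (\<forall>\<psi>. O' (rcircuit_op lifted_layers \<psi>) = rcircuit_op lifted_layers (O2 \<psi>))"
    by (rule local_op_rcircuit[where Y = Y, OF _ l0 f m spread]) (rule lifted_layers_ok(1))
  then obtain O2 where O2: "local_op (Y (0 + length lifted_layers)) O2"
    "\<forall>\<psi>. O' (rcircuit_op lifted_layers \<psi>) = rcircuit_op lifted_layers (O2 \<psi>)"
    by blast
  have "Y (0 + length lifted_layers) \<subseteq> nbhd T"
  proof
    fix c assume "c \<in> Y (0 + length lifted_layers)"
    then obtain t where t: "t \<in> T" "near (length U * (2 * D)) ltouch t c" "c \<in> lcells"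
      by (auto simp: Y_def lifted_layers_def)
    have "near (2 * R) ltouch t c" by (rule near_mono[OF t(2)]) (use range in simp)
    with t show "c \<in> nbhd T" by (auto simp: nbhd_def)
  qed
  then have "local_op (nbhd T) O2"
    using local_op_mono[OF O2(1)] finite_lcells by (simp add: nbhd_def)
  with O2(2) show ?thesis by blast
qed

lemma local_op_flip: "finite T \<Longrightarrow> local_op T (flip_op T)"
  and local_op_sign: "finite T \<Longrightarrow> local_op T (sign_op T)"
  using local_op_relabelled[of id T "flip_mat T"] local_op_relabelled[of id T sign_mat]
    relabelled_flip[of T id] relabelled_sign[of T id] by simp_all

text \<open>
  Both flips produce the same state, which therefore differs from the vacuum (in the frame of the
  circuit) only where their neighbourhoods meet; there the sign operator acts trivially, although
  it anticommutes with the first flip.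
\<close>

lemma sign_expectation_vanishes:
  assumes "T1 \<subseteq> lcells" "T2 \<subseteq> lcells" "S \<subseteq> lcells"
    and eq: "flip_op T1 lifted = flip_op T2 lifted"
    and disj: "nbhd T1 \<inter> nbhd T2 \<inter> nbhd S = {}" and odd: "odd (card (S \<inter> T1))"
  shows "qinner lcells lifted (sign_op S lifted) = 0"
proof -
  let ?U = "rcircuit_op lifted_layers"
  have fin: "finite T1" "finite T2" "finite S" using assms(1-3) finite_lcells finite_subset by blast+
  obtain O1 where O1: "local_op (nbhd T1) O1" "\<forall>\<psi>. flip_op T1 (?U \<psi>) = ?U (O1 \<psi>)"
    using local_op_lifted[OF local_op_flip[OF fin(1)] assms(1)] by blast
  obtain O2 where O2: "local_op (nbhd T2) O2" "\<forall>\<psi>. flip_op T2 (?U \<psi>) = ?U (O2 \<psi>)"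
    using local_op_lifted[OF local_op_flip[OF fin(2)] assms(2)] by blast
  obtain W where W: "local_op (nbhd S) W" "\<forall>\<psi>. sign_op S (?U \<psi>) = ?U (W \<psi>)"
    using local_op_lifted[OF local_op_sign[OF fin(3)] assms(3)] by blast
  define \<phi> where "\<phi> = O1 vacuum"
  have U\<phi>: "?U \<phi> = flip_op T1 lifted" using O1(2) by (simp add: \<phi>_def lifted_def)
  have "?U (O1 vacuum) = ?U (O2 vacuum)" using eq O1(2) O2(2) by (simp add: lifted_def)
  then have \<phi>2: "\<phi> = O2 vacuum" unfolding \<phi>_def by (rule lifted_preserves(3))
  have supp: "\<sigma> \<subseteq> nbhd T1 \<inter> nbhd T2" if "\<phi> \<sigma> \<noteq> 0" for \<sigma>
    using local_op_vacuum[OF O1(1)] local_op_vacuum[OF O2(1)] that \<phi>_def \<phi>2 by auto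
  have mem: "\<phi> \<in> qubit_space lcells"
    using supp by (auto simp: qubit_space_def nbhd_def)
  have "qinner lcells \<phi> (W \<phi>) = W vacuum {} * qinner lcells \<phi> \<phi>"
    by (rule local_op_off_support[OF W(1) finite_lcells mem]) (use supp disj in blast)
  moreover have "qinner lcells \<phi> \<phi> = 1"
    using lifted_preserves(1)[of \<phi> \<phi>] qinner_flip[OF assms(1), of lifted lifted] by (simp add: U\<phi> qinner_lifted)
  moreover have "qinner lcells \<phi> (W \<phi>) = - qinner lcells lifted (sign_op S lifted)"
  proof -
    have "qinner lcells \<phi> (W \<phi>) = qinner lcells (?U \<phi>) (sign_op S (?U \<phi>))"
      using W(2) lifted_preserves(1) by simp
    also have "\<dots> = qinner lcells (flip_op T1 lifted) (\<lambda>\<sigma>. - flip_op T1 (sign_op S lifted) \<sigma>)"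
      unfolding U\<phi> sign_flip_anticommute[OF fin(3) odd] ..
    also have "\<dots> = - qinner lcells (flip_op T1 lifted) (flip_op T1 (sign_op S lifted))"
      by (simp add: qinner_def sum_negf)
    finally show ?thesis by (simp only: qinner_flip[OF assms(1)])
  qed
  moreover have "qinner lcells lifted (sign_op S lifted) = W vacuum {}"
    using W(2) lifted_preserves(1) by (simp add: lifted_def qinner_vacuum finite_lcells)
  ultimately show ?thesis by simp
qed

text \<open>The product of the star operators over \<open>V\<close> flips exactly these cells, since
  the flips at a cell with both ends in \<open>V\<close> cancel.\<close>

definition coboundary :: "('v \<times> ('v \<times> nat)) set \<Rightarrow> ('v one_cell \<times> nat) set" where
  "coboundary V = {c \<in> lcells. odd (card (lboundary c \<inter> V))}"

lemma finite_lboundary: "c \<in> lcells \<Longrightarrow> finite (lboundary c)"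
  by (auto simp: lcells_def one_cells_def uedges_def)

lemma card_lboundary: "c \<in> lcells \<Longrightarrow> card (lboundary c) = 2"
proof -
  assume c: "c \<in> lcells"
  obtain k i where ki: "c = (k, i)" by (cases c)
  show ?thesis
  proof (cases k)
    case (EV e v)
    then have "e \<in> uedges G" using c ki by (auto simp: lcells_def one_cells_def)
    then obtain a b where "e = {a, b}" "a \<noteq> b" using parcs_D by (auto simp: uedges_def)
    then show ?thesis using EV ki by (simp add: insert_Times_insert)
  next
    case (VE u f)
    then have "f \<in> uedges G" using c ki by (auto simp: lcells_def one_cells_def)
    from edge_ends'(3)[OF this] show ?thesis using VE ki by (simp add: insert_Times_insert)
  qed
qed

lemma flip_coboundary:
  assumes inv: "\<And>x v. x \<in> pverts G \<Longrightarrow> v \<in> pverts G \<Longrightarrow> toric_A G (x, v) ground = ground"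
    and "finite V" "V \<subseteq> pverts G \<times> (pverts G \<times> {..<N})"
  shows "flip_op (coboundary V) lifted = lifted"
  using assms(2,3)
proof (induction V)
  case empty
  then show ?case by (simp add: coboundary_def flip_op_def fun_eq_iff)
next
  case (insert s V)
  obtain x v i where s: "s = (x, (v, i))" by (cases s)
  have "coboundary (insert s V) = sym_diff (coboundary V) (lstar s)"
  proof (rule set_eqI)
    fix c
    show "c \<in> coboundary (insert s V) \<longleftrightarrow> c \<in> sym_diff (coboundary V) (lstar s)"
    proof (cases "c \<in> lcells")
      case True
      then have "finite (lboundary c \<inter> V)" using finite_lboundary by blast
      then have "card (lboundary c \<inter> insert s V) = (if s \<in> lboundary c then Suc (card (lboundary c \<inter> V)) else card (lboundary c \<inter> V))"
        using insert(2) by (simp add: Int_insert_right)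
      then show ?thesis using True by (simp add: coboundary_def lstar_def)
    qed (simp add: coboundary_def lstar_def)
  qed
  then show ?case
    using insert lifted_star_invariant[of x v i] inv[of x v] by (simp add: s flip_op_sym_diff)
qed

text \<open>The strip \<open>T1\<close> of copies of one edge of \<open>z\<close> over a ball
  \<open>B\<close> meets the two rows in a single cell, since the ball around sheet \<open>i\<close>
  does not reach sheet \<open>j\<close>. Multiplying by the stars over \<open>H \<times> B\<close>
  turns the strip into \<open>T2\<close>, whose cells leave \<open>H\<close> through an edge other
  than \<open>e0\<close>, or leave \<open>B\<close>. The vanishing of all these signs makes the
  difference of the classes at two sheets uniformly distributed.\<close>

lemma sheet_signs_vanish:
  assumes inv: "\<And>x v. x \<in> pverts G \<Longrightarrow> v \<in> pverts G \<Longrightarrow> toric_A G (x, v) ground = ground"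
    and v: "v \<in> pverts G" "i < N" "j < N" "i \<noteq> j" and z: "z \<subseteq> uedges G" "z \<noteq> {}"
  shows "qinner lcells lifted (sign_op ((\<lambda>e. (EV e v, i)) ` z \<union> (\<lambda>e. (EV e v, j)) ` z) lifted) = 0"
proof -
  obtain e0 where e0: "e0 \<in> z" "e0 \<in> uedges G" using z by blast
  define a where "a = edge_tail G e0"
  define b where "b = edge_head G e0"
  have ab: "e0 = {a, b}" "(a, b) \<in> parcs G" "a \<noteq> b" "a \<in> pverts G"
    using edge_ends[OF e0(2)] edge_ends'[OF e0(2)] by (simp_all add: a_def b_def)
  define \<kappa> :: "'v \<times> 'v \<Rightarrow> int \<Rightarrow> int"
    where "\<kappa> = (\<lambda>p k. if p = (a, b) then k + 1 else if p = (b, a) then k - 1 else k)"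
  let ?K = "lift_arcs (parcs G) \<kappa>"
  \<comment> \<open>Two light cones: a chain of \<open>2 * R\<close> steps moves a coordinate by up
    to \<open>2 * R + 1\<close>, and a cell of \<open>T2\<close> is compared with \<open>T1\<close>
    or \<open>S\<close> through a common cell of their cones.\<close>
  define \<rho> where "\<rho> = 4 * R + 2"
  \<comment> \<open>\<open>\<kappa>\<close> counts signed crossings of \<open>e0\<close>. No short closed walk has a nonzero count, so inside the ball
    of radius \<open>\<rho>\<close> around \<open>a\<close> the edge \<open>e0\<close> is the only one that leaves \<open>H\<close>.\<close>
  define B where "B = {y. near \<rho> cover_arcs (v, i) y}"
  define H where "H = {x. near \<rho> ?K (a, 0) (x, 0)}"
  define T1 where "T1 = (\<lambda>(y, l). (EV e0 y, l)) ` B"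
  define T2 where "T2 = sym_diff T1 (coboundary (H \<times> B))"
  define S where "S = (\<lambda>e. (EV e v, i)) ` z \<union> (\<lambda>e. (EV e v, j)) ` z"
  have \<kappa>inv: "\<kappa> (y, x) (\<kappa> (x, y) k) = k" for x y k
    using ab(3) by (auto simp: \<kappa>_def)
  have symK: "sym ?K" by (rule sym_lift_arcs[OF G]) (rule \<kappa>inv)
  have uniqueK: "s = t" if "near n ?K (x, s) (x, t)" "n \<le> 20 * R + 40" for n x s t
    using trivial_holonomy_near[OF G _ that(1) girth_less[OF that(2)]] \<kappa>inv by blast
  have uniqueB: "s = t" if "near n cover_arcs (x, s) (x, t)" "n \<le> 20 * R + 40" for n x s t
    using cover_arcs_unique[OF that(1) girth_less[OF that(2)]] .
  have B: "y \<in> pverts G \<times> {..<N}" if "y \<in> B" for y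
  proof -
    have "near \<rho> cover_arcs (v, i) y" using that by (simp add: B_def)
    then show ?thesis
      by (rule near_invariant[where P = "\<lambda>y. y \<in> pverts G \<times> {..<N}"])
        (use v parcs_D transport_less in \<open>auto simp: lift_arcs_def\<close>)
  qed
  have H: "x \<in> pverts G" if "x \<in> H" for x
  proof -
    have "near \<rho> ?K (a, 0) (x, 0)" using that by (simp add: H_def)
    then have "fst (x, 0 :: int) \<in> pverts G"
      by (rule near_invariant[where P = "\<lambda>y. fst y \<in> pverts G"])
        (use ab parcs_D in \<open>auto simp: lift_arcs_def\<close>)
    then show ?thesis by simp
  qed
  have fin: "finite (H \<times> B)"
    using finite_subset[of H "pverts G"] finite_subset[of B "pverts G \<times> {..<N}"] H B finite_pverts by blast
  have aH: "a \<in> H" by (simp add: H_def)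
  have bH: "b \<notin> H"
  proof
    assume "b \<in> H"
    then have "near \<rho> ?K (a, 0) (b, 0)" by (simp add: H_def)
    moreover have "near 1 ?K (a, 0) (b, 1)"
      using near_step[of "(a, 0)" "(b, 1)" ?K 0] ab(2) by (simp add: in_lift_arcs \<kappa>_def)
    ultimately have "near (\<rho> + 1) ?K (b, 0) (b, 1)" by (rule near_from_common[OF symK])
    from uniqueK[OF this] show False by (simp add: \<rho>_def)
  qed
  have T1: "T1 \<subseteq> coboundary (H \<times> B)"
  proof
    fix c assume "c \<in> T1"
    then obtain y l where c: "c = (EV e0 y, l)" "(y, l) \<in> B" by (auto simp: T1_def)
    have "c \<in> lcells" using c B e0(2) by (auto simp: lcells_def one_cells_def)
    moreover have "lboundary c \<inter> H \<times> B = {(a, (y, l))}"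
      using c ab(1) aH bH by auto
    ultimately show "c \<in> coboundary (H \<times> B)" by (simp add: coboundary_def)
  qed
  have sub: "T1 \<subseteq> lcells" "T2 \<subseteq> lcells" "S \<subseteq> lcells"
    using T1 v z by (auto simp: T2_def S_def coboundary_def lcells_def one_cells_def)
  have "flip_op (coboundary (H \<times> B)) lifted = lifted"
    by (rule flip_coboundary[OF inv fin]) (use H B in auto)
  then have eq: "flip_op T1 lifted = flip_op T2 lifted"
    by (simp only: T2_def flip_op_sym_diff)
  have "(v, j) \<notin> B"
  proof
    assume "(v, j) \<in> B"
    then have "near \<rho> cover_arcs (v, i) (v, j)" by (simp add: B_def)
    from uniqueB[OF this] v(4) show False by (simp add: \<rho>_def)
  qed
  moreover have "(v, i) \<in> B" by (simp add: B_def)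
  ultimately have "S \<inter> T1 = {(EV e0 v, i)}"
    using e0(1) by (auto simp: S_def T1_def)
  then have odd: "odd (card (S \<inter> T1))" by simp
  have "nbhd T1 \<inter> nbhd T2 \<inter> nbhd S = {}"
  proof (rule ccontr)
    assume "nbhd T1 \<inter> nbhd T2 \<inter> nbhd S \<noteq> {}"
    then obtain q t1 t2 s where q: "q \<in> lcells" and t1: "t1 \<in> T1" "near (2 * R) ltouch t1 q"
      and t2: "t2 \<in> T2" "near (2 * R) ltouch t2 q" and s: "s \<in> S" "near (2 * R) ltouch s q"
      by (auto simp: nbhd_def)
    obtain p where p: "p \<in> lboundary q" using lboundary_ne[OF q] by blast
    obtain y1 l1 where c1: "t1 = (EV e0 y1, l1)" using t1(1) by (auto simp: T1_def)
    have "(a, (y1, l1)) \<in> lboundary t1" by (simp add: c1 ab(1))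
    from near_ltouch_coords(1)[OF t1(2) _ this p] sub t1(1)
    have ap: "near (Suc (2 * R)) (parcs G) a (fst p)" by auto
    obtain e i' where e: "s = (EV e v, i')" "i' = i \<or> i' = j" "e \<in> uedges G"
      using s(1) z(1) by (auto simp: S_def)
    have "(edge_tail G e, (v, i')) \<in> lboundary s"
      using edge_ends(1)[OF e(3)] by (auto simp: e(1))
    from near_ltouch_coords(2)[OF s(2) _ this p] sub s(1)
    have vp: "near (Suc (2 * R)) cover_arcs (v, i') (snd p)" by auto
    have t2c: "t2 \<in> coboundary (H \<times> B)" "t2 \<notin> T1" "t2 \<in> lcells"
      using t2(1) T1 sub by (auto simp: T2_def)
    have "odd (card (lboundary t2 \<inter> H \<times> B))" using t2c(1) by (simp add: coboundary_def)
    then have "lboundary t2 \<inter> H \<times> B \<noteq> {}" "lboundary t2 \<inter> H \<times> B \<noteq> lboundary t2"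
      using card_lboundary[OF t2c(3)] by auto
    then obtain s1 s2 where s12: "s1 \<in> lboundary t2" "s1 \<in> H \<times> B" "s2 \<in> lboundary t2" "s2 \<notin> H \<times> B" by blast
    have s2p: "near (Suc (2 * R)) (parcs G) (fst s2) (fst p)" "near (Suc (2 * R)) cover_arcs (snd s2) (snd p)"
      using near_ltouch_coords[OF t2(2) t2c(3) s12(3) p] by auto
    have s1p: "near (Suc (2 * R)) cover_arcs (snd s1) (snd p)"
      using near_ltouch_coords[OF t2(2) t2c(3) s12(1) p] by auto
    obtain c2 l2 where t2eq: "t2 = (c2, l2)" by (cases t2)
    \<comment> \<open>One end of \<open>t2\<close> lies in \<open>H \<times> B\<close> and the other
      does not. A cell \<open>EV\<close> would leave \<open>H\<close> near \<open>a\<close> through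
      an edge other than \<open>e0\<close>; a cell \<open>VE\<close> would leave \<open>B\<close>
      near one of the two lifts of \<open>v\<close>.\<close>
    show False
    proof (cases c2)
      case (EV e' y')
      then have sn: "snd s1 = (y', l2)" "snd s2 = (y', l2)" "fst s1 \<in> e'" "fst s2 \<in> e'"
        using s12 by (auto simp: t2eq)
      have in_B: "(y', l2) \<in> B" and x: "fst s1 \<in> H" "fst s2 \<notin> H"
        using s12 sn by (auto simp: mem_Times_iff)
      have "e' \<noteq> e0" using t2c(2) in_B EV by (auto simp: t2eq T1_def)
      have "e' \<in> uedges G" using t2c(3) by (auto simp: t2eq EV lcells_def one_cells_def)
      then obtain m n where mn: "e' = {m, n}" "(m, n) \<in> parcs G" by (auto simp: uedges_def)
      have arc: "(fst s1, fst s2) \<in> parcs G" "{fst s1, fst s2} = e'"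
        using sn(3,4) x mn parcs_sym by auto
      \<comment> \<open>The cones place \<open>fst s2\<close> within \<rho> of \<open>a\<close>, but
        with an unknown crossing count \<open>t\<close>; the walk through \<open>fst s1\<close> has
        count 0 but may be one arc too long. Uniqueness transfers the count to the shorter
        walk.\<close>
      have "near (Suc (2 * R) + Suc (2 * R)) (parcs G) a (fst s2)"
        by (rule near_to_common[OF sym_parcs ap s2p(1)])
      from near_lift_arcs[OF this, of \<kappa> 0]
      obtain t where t: "near (Suc (2 * R) + Suc (2 * R)) ?K (a, 0) (fst s2, t)" by blast
      have "near \<rho> ?K (a, 0) (fst s1, 0)" using x(1) by (simp add: H_def)
      moreover have "near 1 ?K (fst s1, 0) (fst s2, 0)"
        using near_step[of "(fst s1, 0)" "(fst s2, 0)" ?K 0] arc \<open>e' \<noteq> e0\<close> ab(1)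
        by (auto simp: in_lift_arcs \<kappa>_def)
      ultimately have "near (\<rho> + 1) ?K (a, 0) (fst s2, 0)" by (rule near_trans)
      from near_from_common[OF symK t this] have "t = 0"
        by (rule uniqueK) (simp add: \<rho>_def)
      have "near \<rho> ?K (a, 0) (fst s2, t)"
        by (rule near_mono[OF t]) (simp add: \<rho>_def)
      with \<open>t = 0\<close> x(2) show False by (simp add: H_def)
    next
      case (VE x f)
      then have f: "fst s1 = x" "fst s2 = x" using s12 by (auto simp: t2eq)
      then have y: "snd s1 \<in> B" "snd s2 \<notin> B" using s12 by (auto simp: mem_Times_iff)
      show False
      proof (cases "i' = i")
        case True
        have "near (Suc (2 * R) + Suc (2 * R)) cover_arcs (v, i') (snd s2)"
          by (rule near_to_common[OF sym_cover_arcs vp s2p(2)])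
        from near_mono[OF this, of \<rho>] True y(2) show False by (simp add: B_def \<rho>_def)
      next
        case False
        then have "i' = j" using e(2) by simp
        \<comment> \<open>The inner end of \<open>t2\<close> is close to both lifts of
          \<open>v\<close>, which would then coincide.\<close>
        have "near \<rho> cover_arcs (v, i) (snd s1)" using y(1) by (simp add: B_def)
        from near_trans[OF this near_to_common[OF sym_cover_arcs s1p vp]]
        have "i = i'" by (rule uniqueB) (simp add: \<rho>_def)
        with False show False by simp
      qed
    qed
  qed
  from sign_expectation_vanishes[OF sub eq this odd] show ?thesis by (simp add: S_def)
qed

end

section \<open>Cuts and cycles\<close>

definition edge_cut :: "'v pair_pre_digraph \<Rightarrow> 'v set \<Rightarrow> 'v set set" where
  "edge_cut G W = {e \<in> uedges G. odd (card (e \<inter> W))}"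

definition cuts :: "'v pair_pre_digraph \<Rightarrow> 'v set set set" where
  "cuts G = edge_cut G ` Pow (pverts G)"

text \<open>The cycle space over the field with two elements: edge sets of even degree at every
  vertex. Its elements serve as characters on classes modulo \<open>cuts\<close>.\<close>

definition cycles :: "'v pair_pre_digraph \<Rightarrow> 'v set set set" where
  "cycles G = {z \<in> Pow (uedges G). \<forall>v\<in>pverts G. even (card (z \<inter> edge_cut G {v}))}"

lemma even_card_sym_diff:
  assumes "finite A" "finite B"
  shows "even (card (sym_diff A B)) \<longleftrightarrow> (even (card A) \<longleftrightarrow> even (card B))"
  using neg_one_power_card_sym_diff[OF assms, where 'r = int]
  by (cases "even (card A)"; cases "even (card B)"; cases "even (card (sym_diff A B))") auto

lemma finite_edge: "e \<in> uedges G \<Longrightarrow> finite e"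
  by (auto simp: uedges_def)

lemma edge_cut_sym_diff: "edge_cut G (sym_diff V W) = sym_diff (edge_cut G V) (edge_cut G W)"
proof -
  have "even (card (e \<inter> sym_diff V W)) \<longleftrightarrow> (even (card (e \<inter> V)) \<longleftrightarrow> even (card (e \<inter> W)))" if "e \<in> uedges G" for e
  proof -
    have "e \<inter> sym_diff V W = sym_diff (e \<inter> V) (e \<inter> W)" by auto
    then show ?thesis using even_card_sym_diff[of "e \<inter> V" "e \<inter> W"] finite_edge[OF that] by simp
  qed
  then show ?thesis by (auto simp: edge_cut_def)
qed

lemma cuts_sym_diff: "s \<in> cuts G \<Longrightarrow> t \<in> cuts G \<Longrightarrow> sym_diff s t \<in> cuts G"
proof -
  assume "s \<in> cuts G" "t \<in> cuts G"
  then obtain V W where "s = edge_cut G V" "t = edge_cut G W" "V \<subseteq> pverts G" "W \<subseteq> pverts G"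
    by (auto simp: cuts_def)
  then have "sym_diff s t = edge_cut G (sym_diff V W)" "sym_diff V W \<in> Pow (pverts G)"
    by (simp_all only: edge_cut_sym_diff) blast
  then show "sym_diff s t \<in> cuts G" unfolding cuts_def by (rule image_eqI)
qed

lemma empty_in_cuts: "{} \<in> cuts G"
  unfolding cuts_def by (rule image_eqI[of _ _ "{}"]) (auto simp: edge_cut_def)

lemma cycle_cut_even:
  assumes "finite (pverts G)" "finite (uedges G)" "z \<in> cycles G" "s \<in> cuts G"
  shows "even (card (z \<inter> s))"
proof -
  obtain W where W: "s = edge_cut G W" "W \<subseteq> pverts G" using assms(4) by (auto simp: cuts_def)
  have "finite W" using W(2) assms(1) finite_subset by blast
  then have "even (card (z \<inter> edge_cut G W))" using W(2)
  proof (induction W)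
    case empty
    then show ?case by (simp add: edge_cut_def)
  next
    case (insert v W)
    have "insert v W = sym_diff {v} W" using insert(2) by auto
    then have "edge_cut G (insert v W) = sym_diff (edge_cut G {v}) (edge_cut G W)"
      using edge_cut_sym_diff[of G "{v}" W] by simp
    then have "z \<inter> edge_cut G (insert v W) = sym_diff (z \<inter> edge_cut G {v}) (z \<inter> edge_cut G W)" by auto
    moreover have "finite z" using assms(2,3) finite_subset by (auto simp: cycles_def)
    moreover have "even (card (z \<inter> edge_cut G {v}))" using assms(3) insert(4) by (auto simp: cycles_def)
    ultimately show ?case using even_card_sym_diff[of "z \<inter> edge_cut G {v}" "z \<inter> edge_cut G W"] insert by simp
  qed
  then show ?thesis by (simp add: W)
qed

lemma empty_in_cycles: "{} \<in> cycles G"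
  by (simp add: cycles_def)

lemma finite_cycles: "finite (uedges G) \<Longrightarrow> finite (cycles G)"
  by (simp add: cycles_def)

lemma cycles_sym_diff:
  assumes "finite (uedges G)" "z \<in> cycles G" "z' \<in> cycles G"
  shows "sym_diff z z' \<in> cycles G"
proof -
  have f: "finite z" "finite z'" using assms finite_subset by (auto simp: cycles_def)
  have "even (card (sym_diff z z' \<inter> edge_cut G {v}))" if "v \<in> pverts G" for v
  proof -
    have "sym_diff z z' \<inter> edge_cut G {v} = sym_diff (z \<inter> edge_cut G {v}) (z' \<inter> edge_cut G {v})" by auto
    then show ?thesis
      using even_card_sym_diff[of "z \<inter> edge_cut G {v}" "z' \<inter> edge_cut G {v}"] f assms(2,3) that
      by (simp add: cycles_def)
  qed
  then show ?thesis using assms(2,3) by (auto simp: cycles_def)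
qed

text \<open>The sum over the characters in \<open>cycles\<close> is either
  \<open>card (cycles G)\<close> or 0. The inequality rests on the orthogonality of cuts and cycles
  alone; an equation would call for the converse, that a set orthogonal to all cycles is a
  cut.\<close>

lemma cut_indicator_le:
  assumes "finite (pverts G)" "finite (uedges G)"
  shows "(if s \<in> cuts G then real (card (cycles G)) else 0) \<le> (\<Sum>z\<in>cycles G. (-1) ^ card (z \<inter> s))"
proof (cases "\<exists>z0\<in>cycles G. odd (card (z0 \<inter> s))")
  case False
  then have "(\<Sum>z\<in>cycles G. (-1 :: real) ^ card (z \<inter> s)) = (\<Sum>z\<in>cycles G. 1)"
    by (intro sum.cong) auto
  then show ?thesis by simp
next
  case True
  then obtain z0 where z0: "z0 \<in> cycles G" "odd (card (z0 \<inter> s))" by blast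
  have fin: "finite z" if "z \<in> cycles G" for z
    using that assms(2) finite_subset by (auto simp: cycles_def)
  have inv: "sym_diff (sym_diff z z0) z0 = z" for z by auto
  have "(\<Sum>z\<in>cycles G. (-1 :: real) ^ card (z \<inter> s)) = (\<Sum>z\<in>cycles G. (-1) ^ card (sym_diff z z0 \<inter> s))"
    by (rule sum.reindex_bij_witness[where i = "\<lambda>z. sym_diff z z0" and j = "\<lambda>z. sym_diff z z0"])
      (simp_all only: inv cycles_sym_diff[OF assms(2) _ z0(1)])
  also have "\<dots> = (\<Sum>z\<in>cycles G. - ((-1) ^ card (z \<inter> s)))"
  proof (rule sum.cong[OF refl])
    fix z assume "z \<in> cycles G"
    moreover have "sym_diff z z0 \<inter> s = sym_diff (z \<inter> s) (z0 \<inter> s)" by auto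
    ultimately show "(-1 :: real) ^ card (sym_diff z z0 \<inter> s) = - ((-1) ^ card (z \<inter> s))"
      using neg_one_power_card_sym_diff[of "z \<inter> s" "z0 \<inter> s", where 'r = real] fin z0 by simp
  qed
  finally have "(\<Sum>z\<in>cycles G. (-1 :: real) ^ card (z \<inter> s)) = 0" by (simp add: sum_negf)
  moreover have "s \<notin> cuts G" using cycle_cut_even[OF assms z0(1)] z0(2) by blast
  ultimately show ?thesis by simp
qed

section \<open>A measurement outcome with few fluxes and few coincidences\<close>

context lifted_circuit
begin

definition outcome_prob :: "('v one_cell \<times> nat) set \<Rightarrow> real" where
  "outcome_prob \<sigma> = (cmod (lifted \<sigma>))\<^sup>2"

definition row :: "('v one_cell \<times> nat) set \<Rightarrow> 'v \<Rightarrow> nat \<Rightarrow> 'v set set" where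
  "row \<sigma> v i = {e \<in> uedges G. (EV e v, i) \<in> \<sigma>}"

definition flux :: "('v one_cell \<times> nat) set \<Rightarrow> ('v set \<times> 'v set \<times> nat) set" where
  "flux \<sigma> = {(e, f, i). e \<in> uedges G \<and> f \<in> uedges G \<and> i < N \<and> odd (card (lface e f i \<inter> \<sigma>))}"

definition coincidences :: "('v one_cell \<times> nat) set \<Rightarrow> 'v \<Rightarrow> (nat \<times> nat) set" where
  "coincidences \<sigma> v = {(i, j). i < N \<and> j < N \<and> sym_diff (row \<sigma> v i) (row \<sigma> v j) \<in> cuts G}"

lemma sum_outcome_prob: "(\<Sum>\<sigma>\<in>Pow lcells. outcome_prob \<sigma>) = 1"
proof -
  have "complex_of_real (\<Sum>\<sigma>\<in>Pow lcells. outcome_prob \<sigma>) = qinner lcells lifted lifted"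
    by (simp add: outcome_prob_def qinner_def complex_norm_square mult.commute del: of_real_power)
  then show ?thesis by (simp only: qinner_lifted of_real_eq_1_iff)
qed

lemma outcome_prob_nonneg: "0 \<le> outcome_prob \<sigma>"
  by (simp add: outcome_prob_def)

lemma sign_expectation:
  "(\<Sum>\<sigma>\<in>Pow lcells. outcome_prob \<sigma> * (-1) ^ card (S \<inter> \<sigma>)) = Re (qinner lcells lifted (sign_op S lifted))"
proof -
  have "complex_of_real (\<Sum>\<sigma>\<in>Pow lcells. outcome_prob \<sigma> * (-1) ^ card (S \<inter> \<sigma>)) = qinner lcells lifted (sign_op S lifted)"
  proof -
    have s: "complex_of_real ((-1) ^ k) = (-1) ^ k" for k by simp
    show ?thesis
      unfolding of_real_sum of_real_mult s outcome_prob_def qinner_def sign_op_def complex_norm_square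
      by (intro sum.cong refl) (simp only: mult_ac)
  qed
  then show ?thesis by (metis Re_complex_of_real)
qed

text \<open>Each square has \<open>N\<close> lifts, all with its own expectation value. A violated
  square changes its sign from 1 to -1, whence the division by 2.\<close>

lemma expected_flux:
  "(\<Sum>\<sigma>\<in>Pow lcells. outcome_prob \<sigma> * real (card (flux \<sigma>))) =
    real N * (real (card (two_cells G)) + Re (qinner (one_cells G) ground (toric_B G ground))) / 2"
proof -
  let ?I = "uedges G \<times> uedges G \<times> {..<N}"
  have fl: "real (card (flux \<sigma>)) = (\<Sum>(e, f, i)\<in>?I. (1 - (-1) ^ card (lface e f i \<inter> \<sigma>)) / 2)" for \<sigma>
  proof -
    have "flux \<sigma> = {p \<in> ?I. odd (card (lface (fst p) (fst (snd p)) (snd (snd p)) \<inter> \<sigma>))}"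
      by (auto simp: flux_def)
    then have "real (card (flux \<sigma>)) = (\<Sum>p\<in>?I. if odd (card (lface (fst p) (fst (snd p)) (snd (snd p)) \<inter> \<sigma>)) then 1 else 0)"
      using finite_uedges by (simp add: sum.If_cases Int_def)
    also have "\<dots> = (\<Sum>(e, f, i)\<in>?I. (1 - (-1) ^ card (lface e f i \<inter> \<sigma>)) / 2)"
      by (intro sum.cong) auto
    finally show ?thesis .
  qed
  have face: "(\<Sum>\<sigma>\<in>Pow lcells. outcome_prob \<sigma> * ((1 - (-1) ^ card (lface e f i \<inter> \<sigma>)) / 2)) =
      (1 - Re (qinner (one_cells G) ground (toric_Bp (e, f) ground))) / 2"
    if "e \<in> uedges G" "f \<in> uedges G" "i < N" for e f i
  proof -
    have "(\<Sum>\<sigma>\<in>Pow lcells. outcome_prob \<sigma> * ((1 - (-1) ^ card (lface e f i \<inter> \<sigma>)) / 2)) =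
      ((\<Sum>\<sigma>\<in>Pow lcells. outcome_prob \<sigma>) - (\<Sum>\<sigma>\<in>Pow lcells. outcome_prob \<sigma> * (-1) ^ card (lface e f i \<inter> \<sigma>))) / 2"
      unfolding sum_subtractf[symmetric] sum_divide_distrib by (intro sum.cong refl) (simp add: algebra_simps)
    then show ?thesis
      by (simp only: sum_outcome_prob sign_expectation lifted_face_expectation[OF that])
  qed
  have "(\<Sum>\<sigma>\<in>Pow lcells. outcome_prob \<sigma> * real (card (flux \<sigma>))) =
      (\<Sum>p\<in>?I. \<Sum>\<sigma>\<in>Pow lcells. outcome_prob \<sigma> * ((1 - (-1) ^ card (lface (fst p) (fst (snd p)) (snd (snd p)) \<inter> \<sigma>)) / 2))"
    unfolding fl sum_distrib_left by (subst sum.swap) (simp add: case_prod_unfold)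
  also have "\<dots> = (\<Sum>p\<in>?I. (1 - Re (qinner (one_cells G) ground (toric_Bp (fst p, fst (snd p)) ground))) / 2)"
    by (intro sum.cong refl face) auto
  also have "\<dots> = (\<Sum>e\<in>uedges G. \<Sum>f\<in>uedges G. \<Sum>i<N. (1 - Re (qinner (one_cells G) ground (toric_Bp (e, f) ground))) / 2)"
    by (simp only: sum.cartesian_product case_prod_unfold)
  also have "\<dots> = (\<Sum>p\<in>two_cells G. real N * ((1 - Re (qinner (one_cells G) ground (toric_Bp p ground))) / 2))"
    by (simp add: sum.cartesian_product two_cells_def case_prod_unfold)
  also have "\<dots> = real N * (real (card (two_cells G)) - (\<Sum>p\<in>two_cells G. Re (qinner (one_cells G) ground (toric_Bp p ground)))) / 2"
    by (simp add: sum_distrib_left[symmetric] sum_divide_distrib[symmetric] sum_subtractf)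
  also have "(\<Sum>p\<in>two_cells G. Re (qinner (one_cells G) ground (toric_Bp p ground))) =
      - Re (qinner (one_cells G) ground (toric_B G ground))"
  proof -
    have "qinner (one_cells G) ground (toric_B G ground) = - (\<Sum>p\<in>two_cells G. qinner (one_cells G) ground (toric_Bp p ground))"
      unfolding qinner_def toric_B_def by (subst sum.swap) (simp add: sum_distrib_left sum_negf)
    then show ?thesis by simp
  qed
  finally show ?thesis by simp
qed

text \<open>The indicator of equal classes is bounded by the mean of the signs along all cycles.
  Only the empty cycle has a nonzero expectation, and it contributes 1.\<close>

lemma coincidence_prob:
  assumes inv: "\<And>x v. x \<in> pverts G \<Longrightarrow> v \<in> pverts G \<Longrightarrow> toric_A G (x, v) ground = ground"
    and v: "v \<in> pverts G" "i < N" "j < N" "i \<noteq> j"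
  shows "(\<Sum>\<sigma>\<in>Pow lcells. outcome_prob \<sigma> * (if (i, j) \<in> coincidences \<sigma> v then 1 else 0)) \<le> 1 / real (card (cycles G))"
proof -
  let ?S = "\<lambda>z. (\<lambda>e. (EV e v, i)) ` z \<union> (\<lambda>e. (EV e v, j)) ` z"
  have Z: "card (cycles G) > 0"
    using empty_in_cycles finite_cycles[OF finite_uedges] by (auto simp: card_gt_0_iff)
  have sgn: "(-1 :: real) ^ card (z \<inter> sym_diff (row \<sigma> v i) (row \<sigma> v j)) = (-1) ^ card (?S z \<inter> \<sigma>)"
    if "z \<in> cycles G" for z \<sigma>
  proof -
    have z: "z \<subseteq> uedges G" "finite z" using that finite_subset[OF _ finite_uedges] by (auto simp: cycles_def)
    have a: "?S z \<inter> \<sigma> = (\<lambda>e. (EV e v, i)) ` (z \<inter> row \<sigma> v i) \<union> (\<lambda>e. (EV e v, j)) ` (z \<inter> row \<sigma> v j)"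
      using z(1) by (auto simp: row_def)
    have "card (?S z \<inter> \<sigma>) = card ((\<lambda>e. (EV e v, i)) ` (z \<inter> row \<sigma> v i)) + card ((\<lambda>e. (EV e v, j)) ` (z \<inter> row \<sigma> v j))"
      unfolding a by (rule card_Un_disjoint) (use z v(4) in auto)
    also have "\<dots> = card (z \<inter> row \<sigma> v i) + card (z \<inter> row \<sigma> v j)"
      by (simp add: card_image inj_on_def)
    finally have "(-1 :: real) ^ card (?S z \<inter> \<sigma>) = (-1) ^ card (z \<inter> row \<sigma> v i) * (-1) ^ card (z \<inter> row \<sigma> v j)"
      by (simp add: power_add)
    moreover have "z \<inter> sym_diff (row \<sigma> v i) (row \<sigma> v j) = sym_diff (z \<inter> row \<sigma> v i) (z \<inter> row \<sigma> v j)" by auto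
    ultimately show ?thesis
      using neg_one_power_card_sym_diff[of "z \<inter> row \<sigma> v i" "z \<inter> row \<sigma> v j", where 'r = real] z(2) by simp
  qed
  have "real (card (cycles G)) * (\<Sum>\<sigma>\<in>Pow lcells. outcome_prob \<sigma> * (if (i, j) \<in> coincidences \<sigma> v then 1 else 0)) =
     (\<Sum>\<sigma>\<in>Pow lcells. outcome_prob \<sigma> * (if sym_diff (row \<sigma> v i) (row \<sigma> v j) \<in> cuts G then real (card (cycles G)) else 0))"
    unfolding sum_distrib_left using v by (intro sum.cong refl) (simp add: coincidences_def)
  also have "\<dots> \<le> (\<Sum>\<sigma>\<in>Pow lcells. outcome_prob \<sigma> * (\<Sum>z\<in>cycles G. (-1) ^ card (z \<inter> sym_diff (row \<sigma> v i) (row \<sigma> v j))))"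
    by (intro sum_mono mult_left_mono cut_indicator_le finite_pverts finite_uedges outcome_prob_nonneg)
  also have "\<dots> = (\<Sum>z\<in>cycles G. \<Sum>\<sigma>\<in>Pow lcells. outcome_prob \<sigma> * (-1) ^ card (?S z \<inter> \<sigma>))"
    unfolding sum_distrib_left by (subst sum.swap) (intro sum.cong refl, simp add: sgn)
  also have "\<dots> = (\<Sum>z\<in>cycles G. if z = {} then 1 else 0)"
  proof (rule sum.cong[OF refl])
    fix z assume "z \<in> cycles G"
    then have "z \<subseteq> uedges G" by (simp add: cycles_def)
    then show "(\<Sum>\<sigma>\<in>Pow lcells. outcome_prob \<sigma> * (-1) ^ card (?S z \<inter> \<sigma>)) = (if z = {} then 1 else 0)"
      using sheet_signs_vanish[OF inv v, of z]
      by (cases "z = {}") (simp_all add: sum_outcome_prob sign_expectation del: image_is_empty)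
  qed
  also have "\<dots> = 1" using empty_in_cycles finite_cycles[OF finite_uedges] by simp
  finally show ?thesis using Z by (simp add: field_simps)
qed

text \<open>The diagonal contributes at most \<open>N\<close>, the other pairs at most
  \<open>1 / N\<close> each: the choice of \<open>N\<close> balances the two.\<close>

lemma expected_coincidences:
  assumes inv: "\<And>x v. x \<in> pverts G \<Longrightarrow> v \<in> pverts G \<Longrightarrow> toric_A G (x, v) ground = ground"
    and v: "v \<in> pverts G" and N: "N = card (cycles G)"
  shows "(\<Sum>\<sigma>\<in>Pow lcells. outcome_prob \<sigma> * real (card (coincidences \<sigma> v))) \<le> 2 * real N"
proof -
  let ?I = "{..<N} \<times> {..<N}"
  have c: "real (card (coincidences \<sigma> v)) = (\<Sum>p\<in>?I. if p \<in> coincidences \<sigma> v then 1 else 0)" for \<sigma>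
  proof -
    have "coincidences \<sigma> v = {p \<in> ?I. p \<in> coincidences \<sigma> v}" by (auto simp: coincidences_def)
    then show ?thesis by (simp add: sum.If_cases Int_def)
  qed
  have "(\<Sum>\<sigma>\<in>Pow lcells. outcome_prob \<sigma> * real (card (coincidences \<sigma> v))) =
     (\<Sum>p\<in>?I. \<Sum>\<sigma>\<in>Pow lcells. outcome_prob \<sigma> * (if p \<in> coincidences \<sigma> v then 1 else 0))"
    unfolding c sum_distrib_left by (rule sum.swap)
  also have "\<dots> \<le> (\<Sum>p\<in>?I. (if fst p = snd p then 1 else 0) + 1 / real N)"
  proof (rule sum_mono)
    fix p assume p: "p \<in> ?I"
    have "(\<Sum>\<sigma>\<in>Pow lcells. outcome_prob \<sigma> * (if p \<in> coincidences \<sigma> v then 1 else 0)) \<le> (\<Sum>\<sigma>\<in>Pow lcells. outcome_prob \<sigma>)"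
      by (intro sum_mono) (simp add: outcome_prob_nonneg)
    then have le1: "(\<Sum>\<sigma>\<in>Pow lcells. outcome_prob \<sigma> * (if p \<in> coincidences \<sigma> v then 1 else 0)) \<le> 1"
      by (simp only: sum_outcome_prob)
    show "(\<Sum>\<sigma>\<in>Pow lcells. outcome_prob \<sigma> * (if p \<in> coincidences \<sigma> v then 1 else 0)) \<le> (if fst p = snd p then 1 else 0) + 1 / real N"
    proof (cases "fst p = snd p")
      case True
      have "0 \<le> 1 / real N" by simp
      with le1 show ?thesis unfolding if_P[OF True] by linarith
    next
      case False
      then show ?thesis
        using coincidence_prob[OF inv v, of "fst p" "snd p"] p by (simp add: N[symmetric] mem_Times_iff)
    qed
  qed
  also have "\<dots> = (\<Sum>p\<in>?I. if fst p = snd p then 1 else 0) + real N"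
    by (simp add: sum.distrib)
  also have "(\<Sum>p\<in>?I. if fst p = snd p then 1 else (0 :: real)) = (\<Sum>i<N. \<Sum>j<N. if i = j then 1 else 0)"
    by (simp only: sum.cartesian_product case_prod_unfold)
  also have "\<dots> = real N" by simp
  finally show ?thesis by simp
qed

text \<open>The boundary of a face over \<open>f\<close> has one cell in each of the two rows and
  one over each end of \<open>e\<close>. The latter contribute the cut of all vertices whose cell
  over this lift of \<open>f\<close> lies in \<sigma>, so that modulo cuts the rows differ by the
  fluxes.\<close>

lemma flux_slice:
  assumes "f \<in> uedges G" "i < N"
  shows "sym_diff (sym_diff (row \<sigma> (edge_tail G f) i) (row \<sigma> (edge_head G f) (pf f i))) {e. (e, f, i) \<in> flux \<sigma>} \<in> cuts G"
proof -
  let ?a = "edge_tail G f" and ?b = "edge_head G f"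
  let ?W = "{x \<in> pverts G. (VE x f, i) \<in> \<sigma>}"
  have "e \<in> sym_diff (sym_diff (row \<sigma> ?a i) (row \<sigma> ?b (pf f i))) {e. (e, f, i) \<in> flux \<sigma>} \<longleftrightarrow> e \<in> edge_cut G ?W" for e
  proof (cases "e \<in> uedges G")
    case True
    have e: "e \<subseteq> pverts G" "finite e" using True parcs_D finite_edge by (auto simp: uedges_def)
    have "lface e f i \<inter> \<sigma> = ({(EV e ?a, i)} \<inter> \<sigma>) \<union> (({(EV e ?b, pf f i)} \<inter> \<sigma>) \<union> (\<lambda>x. (VE x f, i)) ` (e \<inter> ?W))"
      using e by (auto simp: lface_def)
    also have "card \<dots> = card ({(EV e ?a, i)} \<inter> \<sigma>) + (card ({(EV e ?b, pf f i)} \<inter> \<sigma>) + card ((\<lambda>x. (VE x f, i)) ` (e \<inter> ?W)))"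
      using e(2) edge_ends'(3)[OF assms(1)] by (subst card_Un_disjoint, auto)+
    also have "card ((\<lambda>x. (VE x f, i)) ` (e \<inter> ?W)) = card (e \<inter> ?W)"
      by (rule card_image) (simp add: inj_on_def)
    finally show ?thesis using True assms by (auto simp: row_def flux_def edge_cut_def)
  qed (auto simp: row_def flux_def edge_cut_def)
  then have "sym_diff (sym_diff (row \<sigma> ?a i) (row \<sigma> ?b (pf f i))) {e. (e, f, i) \<in> flux \<sigma>} = edge_cut G ?W" by blast
  then show ?thesis by (auto simp: cuts_def)
qed

text \<open>Both expectations are at most half of the allowed values, the first one strictly less.
  If every outcome exceeded one of the allowed values, the two expectations, divided by these
  values, would add up to at least 1.\<close>

lemma good_outcome:
  assumes inv: "\<And>x v. x \<in> pverts G \<Longrightarrow> v \<in> pverts G \<Longrightarrow> toric_A G (x, v) ground = ground"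
    and N: "N = card (cycles G)" and V: "pverts G \<noteq> {}" and \<epsilon>: "\<epsilon> > 0" "two_cells G \<noteq> {}"
    and energy: "Re (qinner (one_cells G) ground (toric_B G ground)) < - (1 - \<epsilon>) * real (card (two_cells G))"
  shows "\<exists>\<sigma>. real (card (flux \<sigma>)) \<le> \<epsilon> * real N * real (card (two_cells G)) \<and>
    (\<Sum>v\<in>pverts G. card (coincidences \<sigma> v)) \<le> 4 * card (pverts G) * N"
proof (rule ccontr)
  assume none: "\<not> ?thesis"
  have Npos: "real N > 0" using empty_in_cycles finite_cycles[OF finite_uedges] by (auto simp: N card_gt_0_iff)
  have np: "real (card (pverts G)) > 0" using V finite_pverts by (simp add: card_gt_0_iff)
  have cp: "real (card (two_cells G)) > 0" using \<epsilon>(2) finite_uedges by (auto simp: card_gt_0_iff two_cells_def)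
  define a where "a = \<epsilon> * real N * real (card (two_cells G))"
  define b where "b = 4 * real (card (pverts G)) * real N"
  have ab: "a > 0" "b > 0" using Npos np cp \<epsilon>(1) by (simp_all add: a_def b_def)
  define Y where "Y \<sigma> = (\<Sum>v\<in>pverts G. real (card (coincidences \<sigma> v)))" for \<sigma>
  have "1 \<le> real (card (flux \<sigma>)) / a + Y \<sigma> / b" for \<sigma>
  proof -
    have "real (card (flux \<sigma>)) > a \<or> Y \<sigma> > b"
    proof -
      have "\<not> real (card (flux \<sigma>)) \<le> a \<or> \<not> (\<Sum>v\<in>pverts G. card (coincidences \<sigma> v)) \<le> 4 * card (pverts G) * N"
        using none by (auto simp: a_def)
      moreover have "Y \<sigma> = real (\<Sum>v\<in>pverts G. card (coincidences \<sigma> v))" "b = real (4 * card (pverts G) * N)"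
        by (simp_all add: Y_def b_def)
      ultimately show ?thesis by (metis linorder_not_le of_nat_less_iff)
    qed
    moreover have "0 \<le> real (card (flux \<sigma>)) / a" "0 \<le> Y \<sigma> / b" using ab by (simp_all add: Y_def sum_nonneg)
    moreover have "1 < real (card (flux \<sigma>)) / a" if "real (card (flux \<sigma>)) > a"
      using that ab by simp
    moreover have "1 < Y \<sigma> / b" if "Y \<sigma> > b"
      using that ab by simp
    ultimately show ?thesis by linarith
  qed
  then have "(\<Sum>\<sigma>\<in>Pow lcells. outcome_prob \<sigma> * 1) \<le> (\<Sum>\<sigma>\<in>Pow lcells. outcome_prob \<sigma> * (real (card (flux \<sigma>)) / a + Y \<sigma> / b))"
    by (intro sum_mono mult_left_mono outcome_prob_nonneg)
  then have "1 \<le> (\<Sum>\<sigma>\<in>Pow lcells. outcome_prob \<sigma> * real (card (flux \<sigma>))) / a + (\<Sum>\<sigma>\<in>Pow lcells. outcome_prob \<sigma> * Y \<sigma>) / b"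
    by (simp add: sum_outcome_prob distrib_left sum.distrib sum_divide_distrib)
  moreover have "(\<Sum>\<sigma>\<in>Pow lcells. outcome_prob \<sigma> * real (card (flux \<sigma>))) < a / 2"
  proof -
    have "real (card (two_cells G)) + Re (qinner (one_cells G) ground (toric_B G ground)) < \<epsilon> * real (card (two_cells G))"
      using energy by (simp add: algebra_simps)
    then have "real N * (real (card (two_cells G)) + Re (qinner (one_cells G) ground (toric_B G ground))) < real N * (\<epsilon> * real (card (two_cells G)))"
      using Npos by simp
    then show ?thesis unfolding expected_flux
      by (intro divide_strict_right_mono) (simp_all add: a_def mult_ac)
  qed
  moreover have "(\<Sum>\<sigma>\<in>Pow lcells. outcome_prob \<sigma> * Y \<sigma>) \<le> b / 2"
  proof -
    have "(\<Sum>\<sigma>\<in>Pow lcells. outcome_prob \<sigma> * Y \<sigma>) = (\<Sum>v\<in>pverts G. \<Sum>\<sigma>\<in>Pow lcells. outcome_prob \<sigma> * real (card (coincidences \<sigma> v)))"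
      unfolding Y_def sum_distrib_left by (rule sum.swap)
    also have "\<dots> \<le> (\<Sum>v\<in>pverts G. 2 * real N)"
      by (intro sum_mono expected_coincidences[OF inv _ N])
    finally show ?thesis by (simp add: b_def mult_ac)
  qed
  ultimately have "1 < (a / 2) / a + (b / 2) / b"
    using ab by (elim le_less_trans) (intro add_less_le_mono divide_strict_right_mono divide_right_mono; simp)
  then show False using ab by simp
qed

end

section \<open>Counting coverings\<close>

lemma card_le_fibres:
  assumes "finite Y" "h ` A \<subseteq> Y" "finite A" "\<And>y. y \<in> Y \<Longrightarrow> card {x \<in> A. h x = y} \<le> k"
  shows "card A \<le> k * card Y"
proof -
  have "A = (\<Union>y\<in>Y. {x \<in> A. h x = y})" using assms(2) by auto
  then have "card A \<le> (\<Sum>y\<in>Y. card {x \<in> A. h x = y})" using card_UN_le[OF assms(1)] by metis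
  also have "\<dots> \<le> card Y * k" using sum_bounded_above[of Y _ k] assms(4) by simp
  finally show ?thesis by (simp add: mult.commute)
qed

lemma card_fibres:
  assumes "finite A" "\<And>y. y \<in> h ` A \<Longrightarrow> card {x \<in> A. h x = y} = k"
  shows "card A = k * card (h ` A)"
proof -
  have "card A = (\<Sum>y\<in>h ` A. card {x \<in> A. h x = y})"
    using sum.image_gen[OF assms(1), of "\<lambda>_. 1 :: nat" h] by simp
  then show ?thesis using assms(2) by simp
qed

text \<open>Without injectivity, \<open>q i\<close> ranges over the class prescribed by
  \<open>t i\<close>. If some solution \<open>q0\<close> exists, these classes are a rearrangement
  of the classes of \<open>g\<close>, which gives a bound free of \<open>t\<close>.\<close>

lemma card_permutations_over:
  fixes g :: "nat \<Rightarrow> 'a"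
  shows "card {q. q permutes {..<N} \<and> (\<forall>i<N. g (q i) = t i)} \<le> (\<Prod>j<N. card {i. i < N \<and> g i = g j})"
proof (cases "\<exists>q0. q0 permutes {..<N} \<and> (\<forall>i<N. g (q0 i) = t i)")
  case True
  then obtain q0 where q0: "q0 permutes {..<N}" "\<forall>i<N. g (q0 i) = t i" by blast
  let ?P = "\<Pi>\<^sub>E i\<in>{..<N}. {j. j < N \<and> g j = t i}"
  have inj: "inj_on (\<lambda>q. restrict q {..<N}) {q. q permutes {..<N} \<and> (\<forall>i<N. g (q i) = t i)}"
  proof (rule inj_onI)
    fix q r assume "q \<in> {q. q permutes {..<N} \<and> (\<forall>i<N. g (q i) = t i)}"
      "r \<in> {q. q permutes {..<N} \<and> (\<forall>i<N. g (q i) = t i)}" and eq: "restrict q {..<N} = restrict r {..<N}"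
    then have p: "q permutes {..<N}" "r permutes {..<N}" by auto
    show "q = r"
    proof
      fix i
      show "q i = r i"
      proof (cases "i \<in> {..<N}")
        case True
        with fun_cong[OF eq, of i] show ?thesis by simp
      next
        case False
        then show ?thesis using p by (simp add: permutes_not_in)
      qed
    qed
  qed
  have "card {q. q permutes {..<N} \<and> (\<forall>i<N. g (q i) = t i)} \<le> card ?P"
  proof (rule card_inj_on_le[OF inj])
    show "(\<lambda>q. restrict q {..<N}) ` {q. q permutes {..<N} \<and> (\<forall>i<N. g (q i) = t i)} \<subseteq> ?P"
    proof (rule image_subsetI)
      fix q assume "q \<in> {q. q permutes {..<N} \<and> (\<forall>i<N. g (q i) = t i)}"
      then show "restrict q {..<N} \<in> ?P"
        using permutes_in_image[of q "{..<N}"] by (simp add: restrict_PiE_iff)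
    qed
  qed (simp add: finite_PiE)
  also have "\<dots> = (\<Prod>i<N. card {j. j < N \<and> g j = t i})" by (simp add: card_PiE)
  also have "\<dots> = (\<Prod>i<N. card {j. j < N \<and> g j = g (q0 i)})" using q0(2) by (intro prod.cong) auto
  also have "\<dots> = (\<Prod>j<N. card {i. i < N \<and> g i = g j})"
    using prod.permute[OF q0(1), of "\<lambda>j. card {i. i < N \<and> g i = g j}"] by (simp add: o_def)
  finally show ?thesis .
next
  case False
  then have "{q. q permutes {..<N} \<and> (\<forall>i<N. g (q i) = t i)} = {}" by blast
  then show ?thesis by (simp only: card.empty)
qed

lemma prod_le_power_8:
  fixes c :: "'a \<Rightarrow> nat"
  assumes "finite I" "(\<Sum>i\<in>I. c i) \<le> 8 * card I"
  shows "(\<Prod>i\<in>I. c i) \<le> 8 ^ card I"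
proof -
  \<comment> \<open>replaces the inequality between the arithmetic and the geometric mean\<close>
  have "real (c i) \<le> 8 * exp (real (c i) / 8 - 1)" for i
    using exp_ge_add_one_self[of "real (c i) / 8 - 1"] by simp
  then have "(\<Prod>i\<in>I. real (c i)) \<le> (\<Prod>i\<in>I. 8 * exp (real (c i) / 8 - 1))"
    by (intro prod_mono) simp
  also have "\<dots> = 8 ^ card I * exp (\<Sum>i\<in>I. (real (c i) / 8 - 1))"
    using assms(1) by (simp add: prod.distrib exp_sum)
  also have "(\<Sum>i\<in>I. (real (c i) / 8 - 1)) \<le> 0"
  proof -
    have "real (\<Sum>i\<in>I. c i) \<le> real (8 * card I)" using assms(2) by (rule of_nat_mono)
    then show ?thesis by (simp add: sum_subtractf sum_divide_distrib[symmetric])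
  qed
  then have "8 ^ card I * exp (\<Sum>i\<in>I. (real (c i) / 8 - 1)) \<le> 8 ^ card I * 1"
    by (intro mult_left_mono) simp_all
  finally have "real (\<Prod>i\<in>I. c i) \<le> real (8 ^ card I)" by simp
  then show ?thesis by (simp only: of_nat_le_iff)
qed

text \<open>An exponential moment bound, with \<open>n = card A\<close>: for the weight
  \<open>(1/32)^card X\<close>, a sparse set weighs at least \<open>2^(-n/20)\<close> and all sets
  together \<open>(33/32)^n\<close>, which is at most \<open>2^(n/20)\<close> because
  \<open>(33/32)^20 \<le> 2\<close>.\<close>

lemma card_sparse_subsets:
  assumes "finite A"
  shows "real (card {X \<in> Pow A. real (card X) \<le> 1 / 100 * real (card A)}) \<le> 2 powr (real (card A) / 10)"
proof -
  let ?F = "{X \<in> Pow A. real (card X) \<le> 1 / 100 * real (card A)}" and ?n = "real (card A)"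
  have "real (card ?F) * 2 powr (- ?n / 20) = (\<Sum>X\<in>?F. 2 powr (- ?n / 20))" by simp
  also have "\<dots> \<le> (\<Sum>X\<in>?F. (1 / 32) ^ card X)"
  proof (rule sum_mono)
    fix X assume "X \<in> ?F"
    then have "2 powr (- ?n / 20) \<le> 2 powr (- 5 * real (card X))" by (intro powr_mono) simp_all
    also have "\<dots> = (2 powr (- 5)) powr real (card X)" by (simp add: powr_powr)
    also have "2 powr (- 5) = (1 / 32 :: real)" by (simp add: powr_minus powr_numeral)
    finally show "2 powr (- ?n / 20) \<le> (1 / 32) ^ card X" by (simp add: powr_realpow)
  qed
  also have "\<dots> \<le> (\<Sum>X\<in>Pow A. (1 / 32) ^ card X)" using assms by (intro sum_mono2) auto
  also have "\<dots> = (33 / 32) ^ card A"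
    using prod_add[OF assms, of "\<lambda>_. 1 / 32 :: real" "\<lambda>_. 1"] by simp
  also have "\<dots> = (33 / 32) powr ?n"
    by (rule powr_realpow[symmetric]) simp
  also have "\<dots> = ((33 / 32) powr 20) powr (?n / 20)"
    by (simp only: powr_powr) simp
  also have "\<dots> \<le> 2 powr (?n / 20)"
  proof (rule powr_mono2)
    have "(33 / 32 :: real) powr 20 = (33 / 32) ^ 20"
      using powr_realpow[of "33 / 32 :: real" 20] by simp
    then show "(33 / 32 :: real) powr 20 \<le> 2" by (simp add: power_divide)
  qed simp_all
  finally have "real (card ?F) * 2 powr (- ?n / 20) * 2 powr (?n / 20) \<le> 2 powr (?n / 20) * 2 powr (?n / 20)"
    by (intro mult_right_mono) simp_all
  then show ?thesis by (simp add: mult.assoc flip: powr_add)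
qed

text \<open>A weak form of Stirling's formula: 3 takes the place of Euler's number, by
  \<open>(1 + 1 / n)^n \<le> exp 1 \<le> 3\<close>.\<close>

lemma fact_ge_third_power: "(real n / 3) ^ n \<le> fact n"
proof (induction n)
  case (Suc n)
  have "(real (Suc n) / 3) ^ n \<le> 3 * (real n / 3) ^ n"
  proof (cases "n = 0")
    case False
    then have "real (Suc n) / 3 = (1 + 1 / real n) * (real n / 3)"
      by (simp add: field_simps)
    then have "(real (Suc n) / 3) ^ n = (1 + 1 / real n) ^ n * (real n / 3) ^ n"
      by (simp only: power_mult_distrib)
    moreover have "(1 + 1 / real n) ^ n \<le> exp (1 / real n) ^ n"
      by (intro power_mono exp_ge_add_one_self) simp
    moreover have "exp (1 / real n) ^ n = exp (1 :: real)" using False by (simp add: exp_of_nat_mult[symmetric])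
    moreover have "exp (1 :: real) \<le> 3" by (rule exp_le)
    ultimately show ?thesis by (simp add: mult_right_mono)
  qed simp
  then have "(real (Suc n) / 3) ^ Suc n \<le> (real (Suc n) / 3) * (3 * (real n / 3) ^ n)"
    by (simp del: of_nat_Suc add: mult_left_mono)
  also have "\<dots> \<le> real (Suc n) * fact n"
    using Suc.IH mult_left_mono[of "(real n / 3) ^ n" "fact n" "real (Suc n)"] by simp
  finally show ?case by simp
qed simp

section \<open>Sizes of the cut space, the cycle space and the quotient by cuts\<close>

context
  fixes G :: "'v pair_pre_digraph"
  assumes G: "pair_graph G"
begin

definition cut_coset :: "'v set set \<Rightarrow> 'v set set set" where
  "cut_coset s = sym_diff s ` cuts G"

lemma cut_coset_eq_iff: "cut_coset s = cut_coset t \<longleftrightarrow> sym_diff s t \<in> cuts G"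
proof
  assume "cut_coset s = cut_coset t"
  moreover have "s \<in> cut_coset s" using empty_in_cuts[of G] by (auto simp: cut_coset_def image_iff intro!: bexI[of _ "{}"])
  ultimately obtain b where "b \<in> cuts G" "s = sym_diff t b" by (auto simp: cut_coset_def)
  moreover from this(2) have "sym_diff s t = b" by auto
  ultimately show "sym_diff s t \<in> cuts G" by simp
next
  have sub: "cut_coset s \<subseteq> cut_coset t" if "sym_diff s t \<in> cuts G" for s t
  proof
    fix x assume "x \<in> cut_coset s"
    then obtain b where b: "b \<in> cuts G" "x = sym_diff s b" by (auto simp: cut_coset_def)
    have "x = sym_diff t (sym_diff (sym_diff s t) b)" unfolding b(2) by auto
    then show "x \<in> cut_coset t"
      unfolding cut_coset_def using cuts_sym_diff[OF that b(1)] by (rule image_eqI)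
  qed
  assume a: "sym_diff s t \<in> cuts G"
  moreover have "sym_diff t s = sym_diff s t" by auto
  ultimately show "cut_coset s = cut_coset t" using sub[of s t] sub[of t s] by simp
qed

lemma cut_coset_shift: "cut_coset (sym_diff s t) = (\<lambda>x. sym_diff x t) ` cut_coset s"
proof -
  have "sym_diff (sym_diff s t) b = sym_diff (sym_diff s b) t" for b by auto
  then show ?thesis by (simp only: cut_coset_def image_image)
qed

lemma fin: "finite (uedges G)" "finite (pverts G)"
proof -
  \<comment> \<open>No sheets at all: the locale only supplies facts about \<open>G\<close>
    here.\<close>
  interpret covering G 0 "\<lambda>_. id" by (rule covering.intro[OF G permutes_id])
  show "finite (uedges G)" "finite (pverts G)" by (rule finite_uedges, rule finite_pverts)
qed

lemma cuts_sub: "s \<in> cuts G \<Longrightarrow> s \<subseteq> uedges G"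
  by (auto simp: cuts_def edge_cut_def)

lemma card_cut_cosets: "card (cut_coset ` Pow (uedges G)) * card (cuts G) = 2 ^ card (uedges G)"
proof -
  have "card {x \<in> Pow (uedges G). cut_coset x = y} = card (cuts G)" if y: "y \<in> cut_coset ` Pow (uedges G)" for y
  proof -
    obtain s where s: "s \<subseteq> uedges G" "y = cut_coset s" using y by blast
    have "{x \<in> Pow (uedges G). cut_coset x = y} = sym_diff s ` cuts G"
    proof (intro subset_antisym subsetI)
      fix x assume "x \<in> {x \<in> Pow (uedges G). cut_coset x = y}"
      then have "sym_diff x s \<in> cuts G" using s cut_coset_eq_iff by simp
      moreover have "x = sym_diff s (sym_diff x s)" by auto
      ultimately show "x \<in> sym_diff s ` cuts G" by (rule rev_image_eqI)
    next
      fix x assume "x \<in> sym_diff s ` cuts G"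
      then obtain b where b: "b \<in> cuts G" "x = sym_diff s b" by blast
      have "sym_diff x s = b" unfolding b(2) by auto
      then show "x \<in> {x \<in> Pow (uedges G). cut_coset x = y}"
        using b s cuts_sub[OF b(1)] cut_coset_eq_iff[of x s] by auto
    qed
    moreover have "inj_on (sym_diff s) (cuts G)"
    proof (rule inj_onI)
      fix b c assume "sym_diff s b = sym_diff s c"
      moreover have "b = sym_diff s (sym_diff s b)" "c = sym_diff s (sym_diff s c)" by auto
      ultimately show "b = c" by metis
    qed
    ultimately show ?thesis by (simp add: card_image)
  qed
  from card_fibres[OF _ this] show ?thesis using fin by (simp add: card_Pow mult.commute)
qed

text \<open>\<open>cycles\<close> is the kernel of the map that sends an edge set to its vertices of
  odd degree; a nonempty fibre is a translate of the kernel.\<close>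

lemma card_cycles_ge: "2 ^ card (uedges G) \<le> card (cycles G) * 2 ^ card (pverts G)"
proof -
  let ?d = "\<lambda>z. {v \<in> pverts G. odd (card (z \<inter> edge_cut G {v}))}"
  have "card {x \<in> Pow (uedges G). ?d x = y} \<le> card (cycles G)" if "y \<in> Pow (pverts G)" for y
  proof (cases "{x \<in> Pow (uedges G). ?d x = y} = {}")
    case False
    then obtain x0 where x0: "x0 \<subseteq> uedges G" "?d x0 = y" by blast
    have "sym_diff x x0 \<in> cycles G" if x: "x \<subseteq> uedges G" "?d x = y" for x
    proof -
      have "even (card (sym_diff x x0 \<inter> edge_cut G {v}))" if "v \<in> pverts G" for v
      proof -
        have "sym_diff x x0 \<inter> edge_cut G {v} = sym_diff (x \<inter> edge_cut G {v}) (x0 \<inter> edge_cut G {v})" by auto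
        moreover have "finite x" "finite x0" using x x0 fin finite_subset by auto
        moreover have "v \<in> ?d x \<longleftrightarrow> v \<in> ?d x0" using x(2) x0(2) by simp
        ultimately show ?thesis
          using even_card_sym_diff[of "x \<inter> edge_cut G {v}" "x0 \<inter> edge_cut G {v}"] that by simp
      qed
      then show ?thesis using x x0 by (auto simp: cycles_def)
    qed
    then have "(\<lambda>x. sym_diff x x0) ` {x \<in> Pow (uedges G). ?d x = y} \<subseteq> cycles G" by blast
    moreover have "inj_on (\<lambda>x. sym_diff x x0) {x \<in> Pow (uedges G). ?d x = y}"
    proof (rule inj_onI)
      fix b c assume "sym_diff b x0 = sym_diff c x0"
      moreover have "b = sym_diff (sym_diff b x0) x0" "c = sym_diff (sym_diff c x0) x0" by auto
      ultimately show "b = c" by metis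
    qed
    ultimately show ?thesis using card_inj_on_le finite_cycles[OF fin(1)] by blast
  qed (simp only: card.empty)
  then have "card (Pow (uedges G)) \<le> card (cycles G) * card (Pow (pverts G))"
    by (intro card_le_fibres[where h = ?d]) (use fin in auto)
  then show ?thesis using fin by (simp add: card_Pow)
qed

lemma cut_empty_imp_trivial:
  assumes "Digraph_Component.connected (with_proj G)" "W \<subseteq> pverts G" "edge_cut G W = {}"
  shows "W = {} \<or> W = pverts G"
proof -
  have step: "u \<in> W \<longleftrightarrow> v \<in> W" if "(u, v) \<in> parcs G" for u v
  proof -
    have e: "{u, v} \<in> uedges G" "u \<noteq> v"
      using that pair_graph.axioms(1)[OF G] by (auto simp: uedges_def pair_digraph_def pair_loopfree_digraph_def pair_loopfree_digraph_axioms_def)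
    then have "even (card ({u, v} \<inter> W))" using assms(3) by (auto simp: edge_cut_def)
    with e(2) show ?thesis by (cases "u \<in> W"; cases "v \<in> W") auto
  qed
  have sym: "(u, v) \<in> parcs G \<or> (v, u) \<in> parcs G" if "(u, v) \<in> parcs (mk_symmetric (with_proj G))" for u v
    using that by (auto simp: mk_symmetric_def)
  have all: "u \<in> W \<longleftrightarrow> v \<in> W" if "u \<in> pverts G" "v \<in> pverts G" for u v
  proof -
    have "reachable (with_proj (mk_symmetric (with_proj G))) u v"
      using assms(1) that by (auto simp: connected_def strongly_connected_def mk_symmetric_def)
    then have "(u, v) \<in> rtrancl_on (pverts G) (parcs (mk_symmetric (with_proj G)))"
      by (simp add: reachable_def mk_symmetric_def)
    then show ?thesis
      by (induction rule: rtrancl_on.induct) (use step sym in blast)+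
  qed
  show ?thesis using all assms(2) by blast
qed

text \<open>By connectedness, only \<open>W\<close> and its complement have a given cut.\<close>

lemma card_cuts_ge:
  assumes "Digraph_Component.connected (with_proj G)"
  shows "2 ^ card (pverts G) \<le> 2 * card (cuts G)"
proof -
  have "card {x \<in> Pow (pverts G). edge_cut G x = y} \<le> 2" if y: "y \<in> cuts G" for y
  proof -
    obtain W where W: "W \<subseteq> pverts G" "y = edge_cut G W" using y by (auto simp: cuts_def)
    have "{x \<in> Pow (pverts G). edge_cut G x = y} \<subseteq> {W, sym_diff (pverts G) W}"
    proof
      fix x assume x: "x \<in> {x \<in> Pow (pverts G). edge_cut G x = y}"
      have "edge_cut G (sym_diff x W) = {}" using edge_cut_sym_diff[of G x W] x W by simp
      then have "sym_diff x W = {} \<or> sym_diff x W = pverts G"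
        by (rule cut_empty_imp_trivial[OF assms, rotated]) (use x W in auto)
      then show "x \<in> {W, sym_diff (pverts G) W}"
      proof
        assume "sym_diff x W = pverts G"
        moreover have "x = sym_diff (sym_diff x W) W" by auto
        ultimately show ?thesis by simp
      qed auto
    qed
    from card_mono[OF _ this] show ?thesis by (simp add: card_insert_if split: if_splits)
  qed
  then have "card (Pow (pverts G)) \<le> 2 * card (cuts G)"
    by (intro card_le_fibres[where h = "edge_cut G"]) (use fin in \<open>auto simp: cuts_def\<close>)
  then show ?thesis using fin by (simp add: card_Pow)
qed

lemma card_incident_edges:
  assumes "v \<in> pverts G"
  shows "card {e \<in> uedges G. v \<in> e} = out_degree (with_proj G) v"
proof -
  interpret pair_graph G by (rule G)
  have s: "(a, b) \<in> parcs G \<Longrightarrow> (b, a) \<in> parcs G" for a b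
    using pair_sym_arcs by (auto simp: symmetric_def sym_def)
  have "{e \<in> uedges G. v \<in> e} = (\<lambda>p. {fst p, snd p}) ` {p \<in> parcs G. fst p = v}"
  proof (intro subset_antisym subsetI)
    fix e assume "e \<in> {e \<in> uedges G. v \<in> e}"
    then obtain a b where e: "e = {a, b}" "(a, b) \<in> parcs G" "v \<in> e" by (auto simp: uedges_def)
    then consider "v = a" | "v = b" by blast
    then show "e \<in> (\<lambda>p. {fst p, snd p}) ` {p \<in> parcs G. fst p = v}"
    proof cases
      case 1
      then show ?thesis using e by (intro image_eqI[of _ _ "(a, b)"]) auto
    next
      case 2
      then show ?thesis using e s by (intro image_eqI[of _ _ "(b, a)"]) auto
    qed
  next
    fix e assume "e \<in> (\<lambda>p. {fst p, snd p}) ` {p \<in> parcs G. fst p = v}"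
    then obtain b where "(v, b) \<in> parcs G" "e = {v, b}" by auto
    then show "e \<in> {e \<in> uedges G. v \<in> e}" unfolding uedges_def by blast
  qed
  moreover have "inj_on (\<lambda>p. {fst p, snd p}) {p \<in> parcs G. fst p = v}"
    by (rule inj_onI) (auto simp: doubleton_eq_iff prod_eq_iff)
  ultimately show ?thesis by (simp only: card_image out_degree_def out_arcs_def with_proj_simps)
qed

lemma handshake:
  assumes "\<And>v. v \<in> pverts G \<Longrightarrow> out_degree (with_proj G) v = d"
  shows "d * card (pverts G) = 2 * card (uedges G)"
proof -
  have "d * card (pverts G) = (\<Sum>v\<in>pverts G. card {e \<in> uedges G. v \<in> e})"
    using assms card_incident_edges by simp
  also have "\<dots> = (\<Sum>v\<in>pverts G. \<Sum>e\<in>uedges G. if v \<in> e then 1 else 0)"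
    using fin by (simp add: sum.If_cases Int_def)
  also have "\<dots> = (\<Sum>e\<in>uedges G. \<Sum>v\<in>pverts G. if v \<in> e then 1 else 0)" by (rule sum.swap)
  also have "\<dots> = (\<Sum>e\<in>uedges G. 2)"
  proof (rule sum.cong[OF refl])
    fix e assume "e \<in> uedges G"
    then obtain a b where ab: "e = {a, b}" "(a, b) \<in> parcs G" by (auto simp: uedges_def)
    interpret covering G 0 "\<lambda>_. id" by (rule covering.intro[OF G permutes_id])
    have "pverts G \<inter> {v. v \<in> e} = {a, b}" "a \<noteq> b" using ab parcs_D by auto
    then show "(\<Sum>v\<in>pverts G. if v \<in> e then 1 else 0) = (2 :: nat)" using fin by (simp add: sum.If_cases)
  qed
  finally show ?thesis by simp
qed

end

section \<open>Comparison of the number of coverings with the number of labellings\<close>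

definition few_fluxes_and_coincidences ::
  "'v pair_pre_digraph \<Rightarrow> nat \<Rightarrow> ('v set \<Rightarrow> nat \<Rightarrow> nat) \<Rightarrow> ('v \<Rightarrow> nat \<Rightarrow> 'v set set) \<Rightarrow> ('v set \<times> 'v set \<times> nat) set \<Rightarrow> bool" where
  "few_fluxes_and_coincidences G N p \<rho> \<Phi> \<longleftrightarrow>
     (\<forall>v i. \<rho> v i \<subseteq> uedges G) \<and> \<Phi> \<subseteq> uedges G \<times> uedges G \<times> {..<N} \<and>
     real (card \<Phi>) \<le> 1 / 100 * real (card (uedges G \<times> uedges G \<times> {..<N})) \<and>
     (\<Sum>v\<in>pverts G. card {(i, j). i < N \<and> j < N \<and> sym_diff (\<rho> v i) (\<rho> v j) \<in> cuts G}) \<le> 4 * card (pverts G) * N \<and>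
     (\<forall>f\<in>uedges G. \<forall>i<N. sym_diff (sym_diff (\<rho> (edge_tail G f) i) (\<rho> (edge_head G f) (p f i))) {e. (e, f, i) \<in> \<Phi>} \<in> cuts G)"

text \<open>The quadratic terms are \<open>(m - n)^2\<close> and \<open>m^2 / 10\<close>. From
  \<open>3 * n \<le> 2 * m\<close> the former is at least \<open>m^2 / 9\<close>, and the difference
  \<open>m^2 / 90\<close> outgrows the linear terms.\<close>

lemma counting_exponents:
  fixes m n :: real
  assumes "(m - n - 2) * m \<le> 3 * m + (m - n + 1) * n + m\<^sup>2 / 10" "3 * n \<le> 2 * m" "n > 540"
  shows False
proof -
  have m: "m > 810" using assms(2,3) by simp
  have "(m / 3)\<^sup>2 \<le> (m - n)\<^sup>2" using assms(2) m by (intro power_mono) simp_all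
  also have "(m - n)\<^sup>2 \<le> 5 * m + n + m\<^sup>2 / 10" using assms(1) by (simp add: power2_eq_square algebra_simps)
  finally have "m * m \<le> 90 * (5 * m + n)" by (simp add: power2_eq_square)
  also have "\<dots> \<le> 510 * m" using assms(2) by simp
  finally show False using m by simp
qed

text \<open>Pigeonhole: a choice of permutations is mapped to the classes and the fluxes of an
  outcome on its covering. Given these, the permutation at each edge has to match the classes at
  tail and head, so that few choices share an image.\<close>

lemma no_good_labelling:
  assumes G: "pair_graph G" and con: "Digraph_Component.connected (with_proj G)"
    and reg: "\<And>v. v \<in> pverts G \<Longrightarrow> out_degree (with_proj G) v = d" and d: "d \<ge> 3"
    and large: "card (pverts G) > 540" and N: "N = card (cycles G)"
    and ex: "\<And>p. (\<And>f. f \<in> uedges G \<Longrightarrow> p f permutes {..<N}) \<Longrightarrow> \<exists>\<rho> \<Phi>. few_fluxes_and_coincidences G N p \<rho> \<Phi>"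
  shows False
proof -
  let ?E = "uedges G" and ?V = "pverts G"
  let ?m = "card ?E" and ?n = "card ?V"
  note fin = fin[OF G]
  define PP where "PP = (\<Pi>\<^sub>E f\<in>?E. {q. q permutes {..<N}})"
  define A where "A = ?E \<times> ?E \<times> {..<N}"
  define Q where "Q = cut_coset G ` Pow ?E"
  define YY where "YY = (\<Pi>\<^sub>E _\<in>?V \<times> {..<N}. Q) \<times> {X \<in> Pow A. real (card X) \<le> 1 / 100 * real (card A)}"
  have Npos: "N > 0" using empty_in_cycles finite_cycles[OF fin(1)] by (auto simp: N card_gt_0_iff)
  have hs: "d * ?n = 2 * ?m" by (rule handshake[OF G reg])
  have "\<forall>p\<in>PP. \<exists>x. few_fluxes_and_coincidences G N p (fst x) (snd x)"
  proof
    fix p assume "p \<in> PP"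
    then have "p f permutes {..<N}" if "f \<in> ?E" for f using that by (auto simp: PP_def dest: PiE_mem)
    from ex[OF this] show "\<exists>x. few_fluxes_and_coincidences G N p (fst x) (snd x)" by auto
  qed
  then obtain X where X: "\<And>p. p \<in> PP \<Longrightarrow> few_fluxes_and_coincidences G N p (fst (X p)) (snd (X p))"
    by metis
  \<comment> \<open>Only classes are recorded: whole rows would cost a further factor
    \<open>card (cuts G)\<close> at every vertex and sheet.\<close>
  define h where "h p = (restrict (\<lambda>(v, i). cut_coset G (fst (X p) v i)) (?V \<times> {..<N}), snd (X p))" for p
  have finPP: "finite PP" unfolding PP_def by (intro finite_PiE fin finite_permutations) simp
  have finA: "finite A" using fin by (simp add: A_def)
  have finQ: "finite Q" using fin by (simp add: Q_def)
  have finYY: "finite YY"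
    unfolding YY_def using fin finQ finA by (intro finite_cartesian_product finite_PiE) simp_all
  have hY: "h ` PP \<subseteq> YY"
  proof (rule image_subsetI)
    fix p assume "p \<in> PP"
    from X[OF this] show "h p \<in> YY"
      by (auto simp: few_fluxes_and_coincidences_def h_def YY_def A_def Q_def restrict_PiE_iff)
  qed
  have fibre: "card {p \<in> PP. h p = y} \<le> 8 ^ (?m * N)" if y: "y \<in> YY" for y
  proof (cases "{p \<in> PP. h p = y} = {}")
    case True
    then show ?thesis by (simp only: card.empty)
  next
    case False
    \<comment> \<open>The bound on coincidences is not part of \<open>YY\<close>; any element of the
      fibre supplies it.\<close>
    then obtain p0 where p0: "p0 \<in> PP" "h p0 = y" by blast
    define L where "L = fst y"
    define \<Phi> where "\<Phi> = snd y"
    define x where "x v = (\<Sum>j<N. card {i. i < N \<and> L (v, i) = L (v, j)})" for v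
    have L: "L (v, i) = cut_coset G (fst (X p) v i)" if "h p = y" "v \<in> ?V" "i < N" for p v i
      using that by (auto simp: L_def h_def)
    have xs: "(\<Sum>v\<in>?V. x v) \<le> 4 * ?n * N"
    proof -
      have "x v = card {(i, j). i < N \<and> j < N \<and> sym_diff (fst (X p0) v i) (fst (X p0) v j) \<in> cuts G}" if v: "v \<in> ?V" for v
      proof -
        have "{(i, j). i < N \<and> j < N \<and> sym_diff (fst (X p0) v i) (fst (X p0) v j) \<in> cuts G} =
          prod.swap ` (SIGMA j:{..<N}. {i. i < N \<and> L (v, i) = L (v, j)})"
          using L[OF p0(2) v] by (auto simp: cut_coset_eq_iff[OF G] image_iff)
        then show ?thesis by (simp add: x_def card_image card_SigmaI)
      qed
      then show ?thesis using X[OF p0(1)] by (simp add: few_fluxes_and_coincidences_def)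
    qed
    have hdV: "edge_head G f \<in> ?V" "edge_tail G f \<in> ?V" "edge_head G f \<in> f" if f: "f \<in> ?E" for f
    proof -
      interpret covering G 0 "\<lambda>_. id" by (rule covering.intro[OF G permutes_id])
      show "edge_head G f \<in> ?V" "edge_tail G f \<in> ?V" using edge_ends'[OF f] by auto
      show "edge_head G f \<in> f" using edge_ends(1)[OF f] by blast
    qed
    \<comment> \<open>The fluxes and the class at sheet \<open>i\<close> over the tail determine the
      class at sheet \<open>q i\<close> over the head; this constrains each edge separately.\<close>
    have sub: "{p \<in> PP. h p = y} \<subseteq> (\<Pi>\<^sub>E f\<in>?E. {q. q permutes {..<N} \<and> (\<forall>i<N. L (edge_head G f, q i) =
        (\<lambda>s. sym_diff s {e. (e, f, i) \<in> \<Phi>}) ` L (edge_tail G f, i))})"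
    proof
      fix p assume p: "p \<in> {p \<in> PP. h p = y}"
      then have \<Phi>: "snd (X p) = \<Phi>" by (auto simp: h_def \<Phi>_def)
      show "p \<in> (\<Pi>\<^sub>E f\<in>?E. {q. q permutes {..<N} \<and> (\<forall>i<N. L (edge_head G f, q i) =
        (\<lambda>s. sym_diff s {e. (e, f, i) \<in> \<Phi>}) ` L (edge_tail G f, i))})"
      proof (rule PiE_I)
        fix f assume f: "f \<in> ?E"
        then have q: "p f permutes {..<N}" using p by (auto simp: PP_def dest: PiE_mem)
        have "L (edge_head G f, p f i) = (\<lambda>s. sym_diff s {e. (e, f, i) \<in> \<Phi>}) ` L (edge_tail G f, i)" if i: "i < N" for i
        proof -
          let ?a = "fst (X p) (edge_tail G f) i" and ?b = "fst (X p) (edge_head G f) (p f i)" and ?t = "{e. (e, f, i) \<in> \<Phi>}"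
          have "sym_diff (sym_diff ?a ?b) ?t \<in> cuts G"
            using X[of p] p f i by (auto simp: few_fluxes_and_coincidences_def \<Phi>)
          moreover have "sym_diff (sym_diff ?a ?b) ?t = sym_diff ?b (sym_diff ?a ?t)" by auto
          ultimately have "cut_coset G ?b = cut_coset G (sym_diff ?a ?t)" by (simp only: cut_coset_eq_iff[OF G])
          moreover have "p f i < N" using permutes_in_image[OF q, of i] i by simp
          ultimately show ?thesis
            using L[of p] p hdV[OF f] i by (simp add: cut_coset_shift[OF G])
        qed
        with q show "p f \<in> {q. q permutes {..<N} \<and> (\<forall>i<N. L (edge_head G f, q i) =
           (\<lambda>s. sym_diff s {e. (e, f, i) \<in> \<Phi>}) ` L (edge_tail G f, i))}" by blast
      qed (use p in \<open>auto simp: PP_def PiE_def extensional_def\<close>)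
    qed
    have fp: "finite {q. q permutes {..<N} \<and> P q}" for P
      by (rule finite_subset[OF _ finite_permutations[of "{..<N}"]]) auto
    have "card {p \<in> PP. h p = y} \<le> (\<Prod>f\<in>?E. card {q. q permutes {..<N} \<and> (\<forall>i<N. L (edge_head G f, q i) =
        (\<lambda>s. sym_diff s {e. (e, f, i) \<in> \<Phi>}) ` L (edge_tail G f, i))})"
      using card_mono[OF _ sub] fin(1) by (simp add: card_PiE finite_PiE fp)
    also have "\<dots> \<le> (\<Prod>f\<in>?E. \<Prod>j<N. card {i. i < N \<and> L (edge_head G f, i) = L (edge_head G f, j)})"
      by (intro prod_mono conjI card_permutations_over[where g = "\<lambda>i. L (edge_head G _, i)"]) simp
    also have "\<dots> = (\<Prod>(f, j)\<in>?E \<times> {..<N}. card {i. i < N \<and> L (edge_head G f, i) = L (edge_head G f, j)})"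
      by (rule prod.cartesian_product)
    finally have le: "card {p \<in> PP. h p = y} \<le> (\<Prod>(f, j)\<in>?E \<times> {..<N}. card {i. i < N \<and> L (edge_head G f, i) = L (edge_head G f, j)})" .
    have "(\<Sum>(f, j)\<in>?E \<times> {..<N}. card {i. i < N \<and> L (edge_head G f, i) = L (edge_head G f, j)}) = (\<Sum>f\<in>?E. x (edge_head G f))"
      unfolding x_def by (rule sum.cartesian_product[symmetric])
    \<comment> \<open>Replacing the head by both ends of the edge removes the dependence on the
      orientation. Each vertex is then counted \<open>d\<close> times, and
      \<open>d * (4 * n * N) = 8 * m * N\<close> bounds the mean class size by 8.\<close>
    also have "\<dots> \<le> (\<Sum>f\<in>?E. \<Sum>v\<in>?V. if v \<in> f then x v else 0)"
    proof (rule sum_mono)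
      fix f assume f: "f \<in> ?E"
      have "x (edge_head G f) = (\<Sum>v\<in>{edge_head G f}. if v \<in> f then x v else 0)" using hdV[OF f] by simp
      also have "\<dots> \<le> (\<Sum>v\<in>?V. if v \<in> f then x v else 0)" using hdV[OF f] fin by (intro sum_mono2) auto
      finally show "x (edge_head G f) \<le> (\<Sum>v\<in>?V. if v \<in> f then x v else 0)" .
    qed
    also have "\<dots> = (\<Sum>v\<in>?V. \<Sum>f\<in>?E. if v \<in> f then x v else 0)" by (rule sum.swap)
    also have "\<dots> = (\<Sum>v\<in>?V. d * x v)"
      using fin card_incident_edges[OF G] reg by (intro sum.cong refl) (simp add: sum.If_cases Int_def)
    also have "\<dots> = d * (\<Sum>v\<in>?V. x v)" by (simp add: sum_distrib_left)
    also have "\<dots> \<le> d * (4 * ?n * N)" using xs by (rule mult_le_mono2)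
    also have "\<dots> = 8 * card (?E \<times> {..<N})" using hs by (simp add: card_cartesian_product mult_ac)
    finally have "(\<Prod>(f, j)\<in>?E \<times> {..<N}. card {i. i < N \<and> L (edge_head G f, i) = L (edge_head G f, j)}) \<le> 8 ^ card (?E \<times> {..<N})"
      using fin by (intro prod_le_power_8) simp_all
    with le show ?thesis by (simp add: card_cartesian_product)
  qed
  have cPP: "card PP = fact N ^ ?m"
    using fin by (simp add: PP_def card_PiE card_permutations[OF refl])
  have "card PP \<le> 8 ^ (?m * N) * card YY"
    by (rule card_le_fibres[OF finYY hY finPP fibre])
  then have nat_le: "fact N ^ ?m \<le> 8 ^ (?m * N) * (card Q ^ (?n * N) * card {X \<in> Pow A. real (card X) \<le> 1 / 100 * real (card A)})"
    using fin by (simp add: cPP YY_def card_cartesian_product card_PiE)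
  define m where "m = real ?m"
  define n where "n = real ?n"
  define M where "M = real N"
  have M: "M > 0" using Npos by (simp add: M_def)
  have cA: "real (card A) = m * m * M" by (simp add: A_def m_def M_def card_cartesian_product)
  have Nle: "2 powr (m - n) \<le> M"
  proof -
    have "2 ^ ?m \<le> N * 2 ^ ?n" using card_cycles_ge[OF G] by (simp add: N)
    then have "real (2 ^ ?m) \<le> real (N * 2 ^ ?n)" by (rule of_nat_mono)
    then have "2 powr m \<le> M * 2 powr n" by (simp add: m_def n_def M_def powr_realpow)
    then show ?thesis by (simp add: powr_diff field_simps)
  qed
  \<comment> \<open>The 2 in the exponent absorbs the 3 in the bound for the factorial, by
    \<open>3 \<le> 4\<close>.\<close>
  have N3: "2 powr (m - n - 2) \<le> M / 3"
  proof -
    have "2 powr (m - n - 2) = 2 powr (m - n) / 4" by (simp add: powr_diff)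
    then show ?thesis using Nle M by simp
  qed
  \<comment> \<open>The summand 1 reflects that a cut comes from two complementary vertex
    sets.\<close>
  have Qle: "real (card Q) \<le> 2 powr (m - n + 1)"
  proof -
    have "card Q * 2 ^ ?n \<le> card Q * (2 * card (cuts G))" using card_cuts_ge[OF G con] by (rule mult_le_mono2)
    also have "\<dots> = 2 * 2 ^ ?m" using card_cut_cosets[OF G] by (simp add: Q_def)
    finally have "real (card Q * 2 ^ ?n) \<le> real (2 * 2 ^ ?m)" by (rule of_nat_mono)
    then have "real (card Q) * 2 powr n \<le> 2 * 2 powr m" by (simp add: m_def n_def powr_realpow)
    then show ?thesis by (simp add: powr_add powr_diff field_simps)
  qed
  have "2 powr ((m - n - 2) * M * m) = ((2 powr (m - n - 2)) ^ N) ^ ?m"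
    by (simp add: powr_powr M_def m_def flip: powr_realpow)
  also have "\<dots> \<le> ((M / 3) ^ N) ^ ?m" using N3 by (intro power_mono) simp_all
  also have "\<dots> \<le> fact N ^ ?m" using fact_ge_third_power[of N] M by (intro power_mono) (simp_all add: M_def)
  also have "\<dots> \<le> 8 ^ (?m * N) * (real (card Q) ^ (?n * N) * real (card {X \<in> Pow A. real (card X) \<le> 1 / 100 * real (card A)}))"
  proof -
    have "real (fact N ^ ?m) \<le> real (8 ^ (?m * N) * (card Q ^ (?n * N) * card {X \<in> Pow A. real (card X) \<le> 1 / 100 * real (card A)}))"
      using nat_le by (rule of_nat_mono)
    then show ?thesis by (simp only: of_nat_mult of_nat_power of_nat_fact of_nat_numeral)
  qed
  also have "\<dots> \<le> 8 ^ (?m * N) * ((2 powr (m - n + 1)) ^ (?n * N) * 2 powr (real (card A) / 10))"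
    using Qle card_sparse_subsets[OF finA] by (intro mult_left_mono mult_mono power_mono) simp_all
  also have "8 ^ (?m * N) = 2 powr (3 * m * M)"
  proof -
    have "(8 :: real) ^ (?m * N) = 2 ^ (3 * (?m * N))" by (simp add: power_mult)
    also have "\<dots> = 2 powr real (3 * (?m * N))" by (rule powr_realpow[symmetric]) simp
    finally show ?thesis by (simp only: m_def M_def of_nat_mult of_nat_numeral mult.assoc)
  qed
  also have "(2 powr (m - n + 1)) ^ (?n * N) = 2 powr ((m - n + 1) * n * M)"
    by (simp add: powr_powr M_def n_def mult.assoc flip: powr_realpow)
  also have "2 powr (3 * m * M) * (2 powr ((m - n + 1) * n * M) * 2 powr (real (card A) / 10)) =
     2 powr (3 * m * M + (m - n + 1) * n * M + real (card A) / 10)"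
    by (simp add: powr_add)
  finally have "(m - n - 2) * M * m \<le> 3 * m * M + (m - n + 1) * n * M + real (card A) / 10"
    by simp
  then have "M * ((m - n - 2) * m) \<le> M * (3 * m + (m - n + 1) * n + m\<^sup>2 / 10)"
    by (simp add: cA power2_eq_square algebra_simps)
  then have "(m - n - 2) * m \<le> 3 * m + (m - n + 1) * n + m\<^sup>2 / 10" using M by simp
  moreover have "3 * n \<le> 2 * m"
  proof -
    have "3 * ?n \<le> 2 * ?m" using mult_le_mono1[OF d, of ?n] hs by simp
    then have "real (3 * ?n) \<le> real (2 * ?m)" by (rule of_nat_mono)
    then show ?thesis by (simp add: m_def n_def)
  qed
  moreover have "n > 540" using large by (simp add: n_def)
  ultimately show False by (rule counting_exponents)
qed

section \<open>Trivial states as circuits acting on the vacuum\<close>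

lemma cell_dist_near:
  assumes "cell_dist G a b \<le> enat D"
  shows "near D (cell_touch G) a b"
proof -
  have "\<exists>n\<le>D. (a, b) \<in> cell_adj G ^^ n"
  proof (rule ccontr)
    assume "\<not> ?thesis"
    then have "enat (Suc D) \<le> enat n" if "n \<in> {n. (a, b) \<in> cell_adj G ^^ n}" for n
      using that by (auto simp: not_le Suc_le_eq)
    then have "enat (Suc D) \<le> cell_dist G a b" unfolding cell_dist_def by (rule INF_greatest)
    from order.trans[OF this assms] have "enat (Suc D) \<le> enat D" .
    then show False by simp
  qed
  then have n: "near D (cell_adj G) a b" by (simp add: near_def)
  have "near 1 (cell_touch G) x y" if "(x, y) \<in> cell_adj G" for x y
    using that near_step[of x y "cell_touch G" 0] by (auto simp: cell_adj_def cell_touch_def)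
  from near_image[OF n this] show ?thesis by simp
qed

text \<open>The layer that prepares the product state adds one to the depth:
  \<open>(length U + 1) * D \<le> R + D\<close>, hence at most \<open>2 * R\<close>.\<close>

lemma trivial_state_circuit:
  assumes "pair_graph G" "trivial_state G R \<psi>"
  obtains U D where "\<psi> = circuit_op U vacuum" "\<And>L. L \<in> set U \<Longrightarrow> covering.layer_ok G D L"
    "length U * D \<le> 2 * R" "D \<le> 2 * R"
proof -
  interpret covering G 0 "\<lambda>_. id" by (rule covering.intro[OF assms(1) permutes_id])
  obtain U \<phi> where U: "unitary_circuit (one_cells G) U" "circuit_range G U \<le> enat R"
    and \<phi>: "\<forall>c\<in>one_cells G. (cmod (\<phi> c False))\<^sup>2 + (cmod (\<phi> c True))\<^sup>2 = 1"
    and \<psi>: "\<psi> = circuit_op U (tensor_state (one_cells G) \<phi>)"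
    using assms(2) by (auto simp: trivial_state_def product_state_def)
  let ?s = "SUP g \<in> (\<Union>L\<in>set U. set L). cell_diam G (fst g)"
  obtain D where D: "length U * D \<le> R" "D \<le> R" "U \<noteq> [] \<longrightarrow> ?s \<le> enat D"
  proof (cases "U = []")
    case True
    then show ?thesis using that[of 0] by simp
  next
    case False
    have r: "enat (length U) * ?s \<le> enat R" using U(2) by (simp add: circuit_range_def)
    \<comment> \<open>With at least one layer, the range also bounds the diameter of each single
      gate.\<close>
    have "1 * ?s \<le> enat (length U) * ?s"
      by (rule mult_right_mono) (use False in \<open>simp_all add: Suc_le_eq one_enat_def\<close>)
    from order.trans[OF this r] have "?s \<le> enat R" by simp
    then obtain k where k: "?s = enat k" "k \<le> R" by (cases ?s) auto
    then show ?thesis using that[of k] r by simp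
  qed
  obtain cs where cs: "set cs = one_cells G" "distinct cs"
    using finite_distinct_list[OF finite_one_cells] by blast
  let ?L0 = "product_layer \<phi> cs"
  have "layer_op ?L0 vacuum = circuit_op [?L0] vacuum" by (simp add: circuit_op_def)
  also have "\<dots> = tensor_state (one_cells G) \<phi>"
    using product_layer_vacuum[OF cs(2), of \<phi>] by (simp add: circuit_op_as_rcircuit cs(1))
  finally have "circuit_op (U @ [?L0]) vacuum = circuit_op U (tensor_state (one_cells G) \<phi>)"
    by (induction U) (simp_all add: circuit_op_def)
  then have 1: "\<psi> = circuit_op (U @ [?L0]) vacuum" using \<psi> by simp
  have "layer_ok D ?L0"
  proof -
    have "sorted_wrt (\<lambda>g h. fst g \<inter> fst h = {}) ?L0"
      using cs(2) unfolding product_layer_def by (induction cs) auto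
    moreover have "gate_ok D g" if "g \<in> set ?L0" for g
    proof -
      from that obtain c where "c \<in> one_cells G" "g = ({c}, qubit_mat c (\<phi> c))"
        using cs(1) by (auto simp: product_layer_def)
      then show ?thesis using unitary_qubit_mat[of "\<phi> c" c] \<phi> by (simp add: gate_ok_def)
    qed
    ultimately show ?thesis by (simp add: layer_ok_def)
  qed
  moreover have "layer_ok D L" if L: "L \<in> set U" for L
  proof -
    have "near D (cell_touch G) c c'" if g: "g \<in> set L" "c \<in> fst g" "c' \<in> fst g" for g c c'
    proof (rule cell_dist_near)
      have "cell_dist G c c' \<le> cell_diam G (fst g)"
        unfolding cell_diam_def using g by (meson SUP_upper SUP_upper2)
      also have "\<dots> \<le> ?s" using L g by (intro SUP_upper) auto
      also have "\<dots> \<le> enat D" using D(3) L by auto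
      finally show "cell_dist G c c' \<le> enat D" .
    qed
    then show ?thesis using U(1) L by (auto simp: layer_ok_def gate_ok_def unitary_circuit_def)
  qed
  ultimately have "layer_ok D L" if "L \<in> set (U @ [?L0])" for L using that by auto
  moreover have "length (U @ [?L0]) * D \<le> 2 * R" using D(1,2) by simp
  moreover have "D \<le> 2 * R" using D(2) by simp
  ultimately show ?thesis using that 1 by blast
qed

section \<open>No trivial state of low energy\<close>

lemma no_low_energy_trivial_state:
  assumes G: "pair_graph G" and con: "Digraph_Component.connected (with_proj G)"
    and reg: "\<And>v. v \<in> pverts G \<Longrightarrow> out_degree (with_proj G) v = d" and d: "d \<ge> 3"
    and large: "card (pverts G) > 540" and girth: "enat (40 * R + 41) \<le> girth G"
    and triv: "trivial_state G R \<psi>" and inv: "\<forall>s\<in>zero_cells G. toric_A G s \<psi> = \<psi>"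
  shows "- (1 - 1 / 100) * real (card (two_cells G)) \<le> Re (qinner (one_cells G) \<psi> (toric_B G \<psi>))"
proof (rule ccontr)
  assume energy: "\<not> ?thesis"
  obtain U D where circ: "\<psi> = circuit_op U vacuum" "\<And>L. L \<in> set U \<Longrightarrow> covering.layer_ok G D L"
    "length U * D \<le> 2 * R" "D \<le> 2 * R"
    using trivial_state_circuit[OF G triv] by blast
  have V: "pverts G \<noteq> {}" using large by auto
  have "uedges G \<noteq> {}"
  proof
    assume "uedges G = {}"
    then have "d * card (pverts G) = 0" using handshake[OF G reg] by simp
    then show False using d large by simp
  qed
  then have F: "two_cells G \<noteq> {}" by (simp add: two_cells_def)
  show False
  proof (rule no_good_labelling[OF G con reg d large refl])
    fix p assume p: "\<And>f. f \<in> uedges G \<Longrightarrow> p f permutes {..<card (cycles G)}"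
    \<comment> \<open>Started from the vacuum, the circuit has range up to \<open>2 * R\<close>;
      this is the origin of \<open>40 * R + 41\<close>.\<close>
    have "enat (20 * (2 * R) + 40) < girth G"
      using order.strict_trans2[OF _ girth, of "enat (20 * (2 * R) + 40)"] by simp
    then interpret lifted_circuit G "card (cycles G)" p U D "2 * R"
      by (intro lifted_circuit.intro covering.intro lifted_circuit_axioms.intro G p circ)
    have gr: "ground = \<psi>" by (simp add: ground_def circ(1))
    have inv': "toric_A G (x, v) ground = ground" if "x \<in> pverts G" "v \<in> pverts G" for x v
      using inv that by (simp add: gr zero_cells_def)
    obtain \<sigma> where \<sigma>: "real (card (flux \<sigma>)) \<le> 1 / 100 * real (card (cycles G)) * real (card (two_cells G))"
      "(\<Sum>v\<in>pverts G. card (coincidences \<sigma> v)) \<le> 4 * card (pverts G) * card (cycles G)"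
      using good_outcome[OF inv' refl V _ F, of "1 / 100"] energy by (auto simp: gr)
    have "few_fluxes_and_coincidences G (card (cycles G)) p (row \<sigma>) (flux \<sigma>)"
      unfolding few_fluxes_and_coincidences_def
    proof (intro conjI allI ballI impI)
      show "row \<sigma> v i \<subseteq> uedges G" for v i by (auto simp: row_def)
      show "flux \<sigma> \<subseteq> uedges G \<times> uedges G \<times> {..<card (cycles G)}" by (auto simp: flux_def)
      show "real (card (flux \<sigma>)) \<le> 1 / 100 * real (card (uedges G \<times> uedges G \<times> {..<card (cycles G)}))"
        using \<sigma>(1) by (simp add: two_cells_def card_cartesian_product mult_ac)
      show "(\<Sum>v\<in>pverts G. card {(i, j). i < card (cycles G) \<and> j < card (cycles G) \<and> sym_diff (row \<sigma> v i) (row \<sigma> v j) \<in> cuts G})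
          \<le> 4 * card (pverts G) * card (cycles G)"
        using \<sigma>(2) by (simp only: coincidences_def)
      show "sym_diff (sym_diff (row \<sigma> (edge_tail G f) i) (row \<sigma> (edge_head G f) (p f i))) {e. (e, f, i) \<in> flux \<sigma>} \<in> cuts G"
        if "f \<in> uedges G" "i < card (cycles G)" for f i
        using that by (rule flux_slice)
    qed
    then show "\<exists>\<rho> \<Phi>. few_fluxes_and_coincidences G (card (cycles G)) p \<rho> \<Phi>" by blast
  qed
qed

theorem theoremV4:
  fixes d :: nat and \<G> :: "'v pair_pre_digraph set"
  assumes "d \<ge> 3"
    and "infinite \<G>"
    and "\<And>G. G \<in> \<G> \<Longrightarrow> pair_graph G"
    and "\<And>G. G \<in> \<G> \<Longrightarrow> Digraph_Component.connected (with_proj G)"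
    and "\<And>G v. G \<in> \<G> \<Longrightarrow> v \<in> pverts G \<Longrightarrow> out_degree (with_proj G) v = d"
    and "\<And>g :: nat. \<exists>N :: nat. \<forall>G\<in>\<G>. N \<le> card (pverts G) \<longrightarrow> enat g \<le> girth G"
  shows "\<exists>\<epsilon> :: real. \<epsilon> > 0 \<and>
    (\<forall>R :: nat. \<exists>N :: nat. \<forall>G\<in>\<G>. N \<le> card (pverts G) \<longrightarrow>
      \<not> (\<exists>\<psi>. trivial_state G R \<psi> \<and> qnorm (one_cells G) \<psi> = 1 \<and>
             (\<forall>s\<in>zero_cells G. toric_A G s \<psi> = \<psi>) \<and>
             Re (qinner (one_cells G) \<psi> (toric_B G \<psi>)) < - (1 - \<epsilon>) * real (card (two_cells G))))"
proof (intro exI[of _ "1 / 100 :: real"] conjI allI)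
  fix R :: nat
  obtain N where N: "\<forall>G\<in>\<G>. N \<le> card (pverts G) \<longrightarrow> enat (40 * R + 41) \<le> girth G"
    using assms(6) by blast
  show "\<exists>N :: nat. \<forall>G\<in>\<G>. N \<le> card (pverts G) \<longrightarrow>
      \<not> (\<exists>\<psi>. trivial_state G R \<psi> \<and> qnorm (one_cells G) \<psi> = 1 \<and>
             (\<forall>s\<in>zero_cells G. toric_A G s \<psi> = \<psi>) \<and>
             Re (qinner (one_cells G) \<psi> (toric_B G \<psi>)) < - (1 - 1 / 100) * real (card (two_cells G)))"
  \<comment> \<open>541 vertices settle the comparison of exponents, \<open>N\<close> the
    girth.\<close>
  proof (intro exI[of _ "max N 541"] ballI impI notI, elim exE conjE)
    fix G \<psi>
    assume G: "G \<in> \<G>" "max N 541 \<le> card (pverts G)" and \<psi>: "trivial_state G R \<psi>"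
      "\<forall>s\<in>zero_cells G. toric_A G s \<psi> = \<psi>"
      "Re (qinner (one_cells G) \<psi> (toric_B G \<psi>)) < - (1 - 1 / 100) * real (card (two_cells G))"
    have "enat (40 * R + 41) \<le> girth G" "card (pverts G) > 540" using N G by auto
    from no_low_energy_trivial_state[OF assms(3)[OF G(1)] assms(4)[OF G(1)] assms(5)[OF G(1)] assms(1) this(2,1) \<psi>(1,2)] \<psi>(3)
    show False by simp
  qed
qed simp

end
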